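(* Let $(\mathbb{M},g,\psi)$ be an $N$-dimensional Riemannian model manifold with $N\ge4$ and $-\frac{\psi''(\rho(x))}{\psi(\rho(x))}\le-1$. Let $\mathcal{B}_1(o)\subset\mathbb{M}$ be the unit ball. Let $c>0$ and $0\le\beta\le N-4-c$. Then for any complex-valued function $f\in C_0^\infty(\mathcal{B}_1(o))$ there holds $$\left(\frac{N+\beta}{4}c\right)^2\int_{\mathcal{B}_1(o)}\frac{|f(x)|^2}{\rho^{4+\beta}(x)(1-\rho^c(x))^2}\,dv_g\le\int_{\mathcal{B}_1(o)}\frac{|\Delta_g f(x)|^2}{\rho^\beta(x)}\,dv_g.$$ In particular, choosing $c=N-\beta-4$, $$\int_{\mathcal{B}_1(o)}\frac{|f(x)|^2}{\rho^{4+\beta}(x)}\,dv_g\le\int_{\mathcal{B}_1(o)}\frac{|f(x)|^2}{\rho^{4+\beta}(x)(1-\rho^{N-\beta-4}(x))^2}\,dv_g\le\frac{16}{(N+\beta)^2(N-\beta-4)^2}\int_{\mathcal{B}_1(o)}\frac{|\Delta_g f(x)|^2}{\rho^\beta(x)}\,dv_g,$$ and the constant in this last display is sharp.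
   Context: An $N$-dimensional Riemannian model manifold $(\mathbb{M},g,\psi)$ with pole $o$ is a Riemannian manifold whose metric in spherical coordinates about $o$ is $ds^2=dt^2+\psi^2(t)\,d\sigma^2$, where $t$ is the Riemannian distance from $o$, $d\sigma^2$ is the standard metric on the sphere $\mathbb{S}^{N-1}$, and $\psi\in C^\infty([0,+\infty))$ satisfies $\psi>0$ on $(0,+\infty)$, $\psi'(0)=1$ and $\psi^{(2k)}(0)=0$ for all $k\ge0$. $\rho(x)=\mathrm{dist}(x,o)$; $\mathcal{B}_1(o)=\{x\in\mathbb{M}:\rho(x)<1\}$; $dv_g$ is the Riemannian volume; $\Delta_g$ is the Laplace--Beltrami operator of $g$. $C_0^\infty(\Omega)$ denotes compactly supported smooth functions on $\Omega$. "Sharp" means that the constant cannot be replaced by a better one (here, a smaller one) with the inequality still holding for all admissible functions. *)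

theory Defs
  imports "HOL-Analysis.Analysis"
begin

section \<open>Smooth functions\<close>

text \<open>Intended for open \<open>S\<close>: \<open>C\<^sup>k\<close> is defined through iterated partial derivatives.\<close>

fun Ck_on :: "nat \<Rightarrow> ('a::euclidean_space \<Rightarrow> 'b::real_normed_vector) \<Rightarrow> 'a set \<Rightarrow> bool" where
  "Ck_on 0 f S \<longleftrightarrow> continuous_on S f"
| "Ck_on (Suc k) f S \<longleftrightarrow> (\<forall>x\<in>S. f differentiable at x) \<and>
     (\<forall>b\<in>Basis. Ck_on k (\<lambda>x. frechet_derivative f (at x) b) S)"

definition smooth_on :: "'a set \<Rightarrow> ('a::euclidean_space \<Rightarrow> 'b::real_normed_vector) \<Rightarrow> bool" where
  "smooth_on S f \<longleftrightarrow> (\<forall>k. Ck_on k f S)"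

text \<open>Elements of \<open>C\<^sub>0\<^sup>\<infinity>(\<Omega>)\<close> are regarded as functions on the whole space, extended by zero.\<close>

definition test_functions :: "'a::euclidean_space set \<Rightarrow> ('a \<Rightarrow> complex) set" where
  "test_functions \<Omega> =
     {f. smooth_on UNIV f \<and> compact (closure {x. f x \<noteq> 0}) \<and> closure {x. f x \<noteq> 0} \<subseteq> \<Omega>}"

text \<open>Iterated derivatives on \<open>[0, \<infinity>)\<close>, one-sided at \<open>0\<close>.\<close>

primrec halfline_deriv :: "nat \<Rightarrow> (real \<Rightarrow> real) \<Rightarrow> real \<Rightarrow> real" where
  "halfline_deriv 0 h = h"
| "halfline_deriv (Suc k) h = (\<lambda>t. vector_derivative (halfline_deriv k h) (at t within {0..}))"

definition smooth_halfline :: "(real \<Rightarrow> real) \<Rightarrow> bool" where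
  "smooth_halfline h \<longleftrightarrow> (\<forall>k. halfline_deriv k h differentiable_on {0..})"


section \<open>Riemannian geometry in a global chart\<close>

text \<open>A metric is given by its matrix \<open>g x\<close> in the standard coordinates of \<open>real ^ 'n\<close>.\<close>

definition riemannian_metric :: "(real^'n \<Rightarrow> real^'n^'n) \<Rightarrow> bool" where
  "riemannian_metric g \<longleftrightarrow> smooth_on UNIV g \<and>
     (\<forall>x. transpose (g x) = g x) \<and> (\<forall>x v. v \<noteq> 0 \<longrightarrow> 0 < v \<bullet> (g x *v v))"

definition riem_volume :: "(real^'n \<Rightarrow> real^'n^'n) \<Rightarrow> (real^'n) measure" where
  "riem_volume g = density lborel (\<lambda>x. ennreal (sqrt (det (g x))))"

text \<open>Lengths are extended nonnegative reals: a \<open>valid_path\<close> may have an unbounded derivative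
  at its finitely many exceptional points, hence infinite length.\<close>

definition riem_length :: "(real^'n \<Rightarrow> real^'n^'n) \<Rightarrow> (real \<Rightarrow> real^'n) \<Rightarrow> ennreal" where
  "riem_length g \<gamma> = (\<integral>\<^sup>+t\<in>{0..1}.
     ennreal (sqrt (vector_derivative \<gamma> (at t) \<bullet> (g (\<gamma> t) *v vector_derivative \<gamma> (at t)))) \<partial>lborel)"

definition riem_dist :: "(real^'n \<Rightarrow> real^'n^'n) \<Rightarrow> real^'n \<Rightarrow> real^'n \<Rightarrow> real" where
  "riem_dist g x y =
     enn2real (INF \<gamma>\<in>{\<gamma>. valid_path \<gamma> \<and> pathstart \<gamma> = x \<and> pathfinish \<gamma> = y}. riem_length g \<gamma>)"

definition partial_deriv :: "'n \<Rightarrow> (real^'n \<Rightarrow> 'b::real_normed_vector) \<Rightarrow> real^'n \<Rightarrow> 'b" where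
  "partial_deriv i f x = frechet_derivative f (at x) (axis i 1)"

definition laplace_beltrami ::
    "(real^'n \<Rightarrow> real^'n^'n) \<Rightarrow> (real^'n \<Rightarrow> 'b::real_normed_vector) \<Rightarrow> real^'n \<Rightarrow> 'b" where
  "laplace_beltrami g f x = (1 / sqrt (det (g x))) *\<^sub>R
     (\<Sum>i\<in>UNIV. partial_deriv i (\<lambda>y. \<Sum>j\<in>UNIV.
        (sqrt (det (g y)) * matrix_inv (g y) $ i $ j) *\<^sub>R partial_deriv j f y) x)"


section \<open>Model manifolds\<close>

text \<open>The pole is the origin and spherical coordinates are \<open>x = t \<omega>\<close> with \<open>t > 0\<close>, \<open>\<bar>\<omega>\<bar> = 1\<close>.
  The tangent vector \<open>(\<tau>, \<eta>)\<close> at \<open>(t, \<omega>)\<close>, where \<open>\<eta>\<close> is orthogonal to \<open>\<omega>\<close>, is mapped to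
  \<open>\<tau> \<omega> + t \<eta>\<close>, so the last condition is \<open>ds\<^sup>2 = dt\<^sup>2 + \<psi>\<^sup>2(t) d\<sigma>\<^sup>2\<close>.\<close>

definition model_manifold :: "(real^'n \<Rightarrow> real^'n^'n) \<Rightarrow> (real \<Rightarrow> real) \<Rightarrow> bool" where
  "model_manifold g \<psi> \<longleftrightarrow>
     riemannian_metric g \<and>
     smooth_halfline \<psi> \<and> (\<forall>t>0. \<psi> t > 0) \<and>
     halfline_deriv 1 \<psi> 0 = 1 \<and> (\<forall>k. halfline_deriv (2 * k) \<psi> 0 = 0) \<and>
     (\<forall>t \<omega> \<tau> \<eta>. t > 0 \<and> norm \<omega> = 1 \<and> \<omega> \<bullet> \<eta> = 0 \<longrightarrow>
        (\<tau> *\<^sub>R \<omega> + t *\<^sub>R \<eta>) \<bullet> (g (t *\<^sub>R \<omega>) *v (\<tau> *\<^sub>R \<omega> + t *\<^sub>R \<eta>)) = \<tau>\<^sup>2 + (\<psi> t)\<^sup>2 * (norm \<eta>)\<^sup>2)"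

definition pole_dist :: "(real^'n \<Rightarrow> real^'n^'n) \<Rightarrow> real^'n \<Rightarrow> real" where
  "pole_dist g x = riem_dist g x 0"

definition pole_ball :: "(real^'n \<Rightarrow> real^'n^'n) \<Rightarrow> real \<Rightarrow> (real^'n) set" where
  "pole_ball g r = {x. pole_dist g x < r}"

end

theory Submission
  imports Defs
begin

text \<open>In the coordinates of the model, \<open>\<rho>\<close> is the Euclidean norm and the volume density is
  \<open>J(\<rho>) = (\<psi>(\<rho>) / \<rho>)\<^sup>N\<^sup>-\<^sup>1\<close>. For the inequality, integrate the divergence of the vector field
  \<open>w f \<nabla>f + v |f|\<^sup>2 \<partial>\<^sub>\<rho>\<close> with radial \<open>w\<close>, \<open>v\<close> (after a cutoff at the pole). It equals \<open>w f \<Delta>f\<close> plus a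
  quadratic form in \<open>(\<partial>\<^sub>\<rho>f, f)\<close>; convexity of \<open>\<psi>\<close> gives \<open>\<Delta>\<rho> \<ge> (N - 1) / \<rho>\<close>, and completing the square
  leaves \<open>w f \<Delta>f + K w\<^sup>2 \<rho>\<^sup>\<beta> |f|\<^sup>2\<close> as a lower bound as soon as \<open>w\<close>, \<open>v\<close> satisfy a Riccati inequality. The Rellich
  inequality with constant \<open>K\<^sup>2\<close> then follows from AM-GM. For sharpness, test with
  \<open>\<rho>\<^sup>-\<^sup>\<kappa> \<eta>((ln \<rho> - T) / n)\<close>, \<open>\<kappa> = (N - 4 - \<beta>) / 2\<close>, supported close to the pole, where the model is almost
  Euclidean, and let \<open>n\<close> grow.\<close>

section \<open>Calculus of \<open>C\<^sup>k\<close> functions\<close>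

text \<open>The divergence theorem is used for \<open>C\<^sup>1\<close> fields on the whole space,
  whereas the weights are singular at the pole and on the unit sphere. The sphere is harmless
  because a test function vanishes near it. At the pole the derivative of the cutoff, at most 4/r,
  multiplies terms of size r^(-3-\<beta>). The error is thus dominated by r^(-4-\<beta>), which is
  integrable because 4 + \<beta> < N, and it tends to 0 pointwise. The weight w is fixed by asking
  that w^2 r^\<beta> be the Rellich weight, and the constant is K = (N + \<beta>) c / 4. The Riccati
  inequality becomes tight only for c = N - 4 - \<beta> and r -> 0, so sharpness has to be tested
  next to the pole. There r^(-\<kappa>) turns |f|^2 r^(-4-\<beta>) into r^(-N), whose integral
  diverges logarithmically, and the flat Laplacian multiplies r^(-\<kappa>) by -\<kappa> (N - 2 -
  \<kappa>) r^(-2), where \<kappa> (N - 2 - \<kappa>) is exactly this K. Spreading \<eta> over the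
  logarithmic length 2 n makes both integrals grow like n, and the relative contribution of the
  derivatives of \<eta> vanishes.\<close>

lemma has_derivative_cong_open:
  assumes "open S" "x \<in> S" "\<And>y. y \<in> S \<Longrightarrow> f y = g y"
  shows "(f has_derivative D) (at x) \<longleftrightarrow> (g has_derivative D) (at x)"
  using assms by (metis has_derivative_transform_within_open)

lemma frechet_derivative_cong_open:
  assumes "open S" "x \<in> S" "\<And>y. y \<in> S \<Longrightarrow> f y = g y"
  shows "frechet_derivative f (at x) = frechet_derivative g (at x)"
  unfolding frechet_derivative_def using has_derivative_cong_open[OF assms] by simp

lemma Ck_on_subset: "Ck_on k f T \<Longrightarrow> S \<subseteq> T \<Longrightarrow> Ck_on k f S"
  by (induction k arbitrary: f) (auto intro: continuous_on_subset)

lemma Ck_on_cong: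
  assumes "open S" "\<And>x. x \<in> S \<Longrightarrow> f x = g x"
  shows "Ck_on k f S \<longleftrightarrow> Ck_on k g S"
  using assms(2)
proof (induction k arbitrary: f g)
  case 0
  then show ?case by (auto cong: continuous_on_cong)
next
  case (Suc k)
  have 1: "f differentiable at x \<longleftrightarrow> g differentiable at x" if "x \<in> S" for x
    unfolding differentiable_def using has_derivative_cong_open[OF assms(1) that Suc.prems] by simp
  have 2: "Ck_on k (\<lambda>x. frechet_derivative f (at x) b) S \<longleftrightarrow> Ck_on k (\<lambda>x. frechet_derivative g (at x) b) S"
    for b
    by (rule Suc.IH) (simp add: frechet_derivative_cong_open[OF assms(1) _ Suc.prems])
  show ?case using 1 2 by simp
qed

lemma Ck_on_Un:
  "open S \<Longrightarrow> open T \<Longrightarrow> Ck_on k f S \<Longrightarrow> Ck_on k f T \<Longrightarrow> Ck_on k f (S \<union> T)"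
  by (induction k arbitrary: f) (auto intro: continuous_on_open_Un)

lemma Ck_on_SucI:
  assumes "open S" "\<And>x. x \<in> S \<Longrightarrow> (f has_derivative f' x) (at x)"
    and "\<And>b. b \<in> Basis \<Longrightarrow> Ck_on k (\<lambda>x. f' x b) S"
  shows "Ck_on (Suc k) f S"
proof -
  have "frechet_derivative f (at x) = f' x" if "x \<in> S" for x
    using assms(2)[OF that] frechet_derivative_at by metis
  then have "Ck_on k (\<lambda>x. frechet_derivative f (at x) b) S" if "b \<in> Basis" for b
    using Ck_on_cong[OF assms(1), of "\<lambda>x. frechet_derivative f (at x) b" "\<lambda>x. f' x b" k]
      assms(3)[OF that] by simp
  then show ?thesis using assms(2) by (auto simp: differentiable_def)
qed

lemma Ck_on_real_SucI:
  assumes "open S" "\<And>t. t \<in> S \<Longrightarrow> (f has_vector_derivative f' t) (at t)" "Ck_on k f' S"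
  shows "Ck_on (Suc k) f S"
  by (rule Ck_on_SucI[where f' = "\<lambda>t h. h *\<^sub>R f' t"])
    (use assms in \<open>auto simp: has_vector_derivative_def\<close>)

lemma Ck_on_SucD:
  assumes "Ck_on (Suc k) f S"
  shows "x \<in> S \<Longrightarrow> (f has_derivative frechet_derivative f (at x)) (at x)"
    and "b \<in> Basis \<Longrightarrow> Ck_on k (\<lambda>x. frechet_derivative f (at x) b) S"
  using assms frechet_derivative_works by auto

lemma Ck_on_real_SucD:
  fixes f :: "real \<Rightarrow> 'b::real_normed_vector"
  assumes "Ck_on (Suc k) f S"
  shows "x \<in> S \<Longrightarrow> (f has_vector_derivative frechet_derivative f (at x) 1) (at x)"
    and "Ck_on k (\<lambda>x. frechet_derivative f (at x) 1) S"
proof -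
  show "Ck_on k (\<lambda>x. frechet_derivative f (at x) 1) S"
    using Ck_on_SucD(2)[OF assms] by simp
  assume "x \<in> S"
  from Ck_on_SucD(1)[OF assms this]
  have d: "(f has_derivative frechet_derivative f (at x)) (at x)" .
  interpret bounded_linear "frechet_derivative f (at x)"
    using d by (rule has_derivative_bounded_linear)
  have "frechet_derivative f (at x) = (\<lambda>h. h *\<^sub>R frechet_derivative f (at x) 1)"
  proof
    fix h :: real
    show "frechet_derivative f (at x) h = h *\<^sub>R frechet_derivative f (at x) 1"
      using scaleR[of h 1] by (simp only: real_scaleR_def mult_1_right)
  qed
  then show "(f has_vector_derivative frechet_derivative f (at x) 1) (at x)"
    using d by (simp add: has_vector_derivative_def)
qed

lemma Ck_on_Suc_imp: "Ck_on (Suc k) f S \<Longrightarrow> Ck_on k f S"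
proof (induction k arbitrary: f)
  case 0
  then show ?case
    by (auto simp: continuous_on_eq_continuous_within
        intro!: differentiable_imp_continuous_within intro: differentiable_at_withinI)
next
  case (Suc k)
  then show ?case by (metis Ck_on.simps(2))
qed

lemma Ck_on_continuous: "Ck_on k f S \<Longrightarrow> continuous_on S f"
  by (induction k) (auto dest: Ck_on_Suc_imp simp del: Ck_on.simps(2))

lemma Ck_on_const: "Ck_on k (\<lambda>x. c) S"
  by (induction k arbitrary: c) auto

lemma Ck_on_bounded_linear:
  assumes "bounded_linear L" "open S"
  shows "Ck_on k L S"
proof (cases k)
  case 0
  then show ?thesis using assms by (simp add: linear_continuous_on)
next
  case (Suc m)
  then show ?thesis
    using Ck_on_SucI[OF assms(2), of L "\<lambda>_. L" m] bounded_linear_imp_has_derivative[OF assms(1)]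
      Ck_on_const by auto
qed

lemma Ck_on_add:
  assumes "open S" "Ck_on k f S" "Ck_on k g S"
  shows "Ck_on k (\<lambda>x. f x + g x) S"
  using assms(2,3)
proof (induction k arbitrary: f g)
  case 0
  then show ?case by (auto intro: continuous_on_add)
next
  case (Suc k)
  show ?case
    by (rule Ck_on_SucI[OF assms(1)],
        rule has_derivative_add[OF Ck_on_SucD(1)[OF Suc.prems(1)] Ck_on_SucD(1)[OF Suc.prems(2)]])
      (use Suc in auto)
qed

lemma Ck_on_sum:
  assumes "open S" "\<And>i. i \<in> I \<Longrightarrow> Ck_on k (f i) S"
  shows "Ck_on k (\<lambda>x. \<Sum>i\<in>I. f i x) S"
  using assms(2)
  by (induction I rule: infinite_finite_induct) (auto intro: Ck_on_const Ck_on_add[OF assms(1)])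

lemma (in bounded_bilinear) Ck_on_prod:
  assumes "open S" "Ck_on k f S" "Ck_on k g S"
  shows "Ck_on k (\<lambda>x. prod (f x) (g x)) S"
  using assms(2,3)
proof (induction k arbitrary: f g)
  case 0
  then show ?case by (auto intro: continuous_on)
next
  case (Suc k)
  have D: "((\<lambda>x. prod (f x) (g x)) has_derivative
      (\<lambda>h. prod (f x) (frechet_derivative g (at x) h) + prod (frechet_derivative f (at x) h) (g x))) (at x)"
    if "x \<in> S" for x
    using FDERIV[OF Ck_on_SucD(1)[OF Suc.prems(1) that] Ck_on_SucD(1)[OF Suc.prems(2) that]] .
  show ?case
    by (rule Ck_on_SucI[OF assms(1) D], assumption, rule Ck_on_add[OF assms(1)])
      (use Suc.IH Suc.prems Ck_on_SucD(2) Ck_on_Suc_imp in blast)+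
qed

lemmas Ck_on_mult = bounded_bilinear.Ck_on_prod[OF bounded_bilinear_mult]
  and Ck_on_scaleR = bounded_bilinear.Ck_on_prod[OF bounded_bilinear_scaleR]
  and Ck_on_inner = bounded_bilinear.Ck_on_prod[OF bounded_bilinear_inner]

lemma Ck_on_power:
  fixes f :: "'a::euclidean_space \<Rightarrow> 'b::real_normed_field"
  assumes "open S" "Ck_on k f S"
  shows "Ck_on k (\<lambda>x. f x ^ n) S"
  by (induction n) (auto intro: Ck_on_const Ck_on_mult assms)

lemma Ck_on_diff:
  assumes "open S" "Ck_on k f S" "Ck_on k g S"
  shows "Ck_on k (\<lambda>x. f x - g x) S"
  using Ck_on_add[OF assms(1,2) Ck_on_scaleR[OF assms(1) Ck_on_const[of k "-1"] assms(3)]] by simp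

lemma Ck_on_compose_real:
  fixes q :: "'a::euclidean_space \<Rightarrow> real"
  assumes "open S" "open T" "Ck_on k h T" "Ck_on k q S" "\<And>x. x \<in> S \<Longrightarrow> q x \<in> T"
  shows "Ck_on k (\<lambda>x. h (q x)) S"
  using assms(3,4)
proof (induction k arbitrary: h)
  case 0
  then show ?case using assms(5) by (auto intro: continuous_on_compose2)
next
  case (Suc k)
  have "((\<lambda>x. h (q x)) has_derivative
      (\<lambda>v. frechet_derivative q (at x) v *\<^sub>R frechet_derivative h (at (q x)) 1)) (at x)"
    if "x \<in> S" for x
    using has_derivative_compose[OF Ck_on_SucD(1)[OF Suc.prems(2) that]
      Ck_on_real_SucD(1)[OF Suc.prems(1) assms(5)[OF that], unfolded has_vector_derivative_def]] .
  moreover have "Ck_on k (\<lambda>x. frechet_derivative q (at x) b *\<^sub>R frechet_derivative h (at (q x)) 1) S"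
    if "b \<in> Basis" for b
    using Suc.IH[OF Ck_on_real_SucD(2)[OF Suc.prems(1)] Ck_on_Suc_imp[OF Suc.prems(2)]]
      Ck_on_SucD(2)[OF Suc.prems(2) that]
    by (intro Ck_on_scaleR[OF assms(1)])
  ultimately show ?case by (rule Ck_on_SucI[OF assms(1)])
qed

lemma Ck_on_powr: "Ck_on k (\<lambda>t::real. t powr a) {0<..}"
proof (induction k arbitrary: a)
  case 0
  show ?case by (auto intro!: continuous_intros)
next
  case (Suc k)
  show ?case
    by (rule Ck_on_real_SucI[where f' = "\<lambda>t. a * t powr (a - 1)"])
      (auto intro!: Ck_on_mult Ck_on_const Suc DERIV_powr
        simp: has_real_derivative_iff_has_vector_derivative[symmetric] has_real_derivative_powr)
qed

lemma Ck_on_ln: "Ck_on k (ln :: real \<Rightarrow> real) {0<..}"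
proof (cases k)
  case 0
  then show ?thesis by (auto intro!: continuous_intros)
next
  case (Suc m)
  show ?thesis unfolding Suc
    by (rule Ck_on_real_SucI[OF _ _ Ck_on_powr[of _ "-1"]])
      (auto intro!: derivative_eq_intros
        simp: has_real_derivative_iff_has_vector_derivative[symmetric] powr_minus divide_inverse)
qed

lemma Ck_on_inverse: "Ck_on k (\<lambda>t::real. inverse t) {0<..}"
  using Ck_on_powr[of k "-1"] Ck_on_cong[of "{0<..}" "\<lambda>t::real. inverse t" "\<lambda>t. t powr (-1)" k]
  by (simp add: powr_minus)

lemma Ck_on_divide:
  fixes f q :: "'a::euclidean_space \<Rightarrow> real"
  assumes "open S" "Ck_on k f S" "Ck_on k q S" "\<And>x. x \<in> S \<Longrightarrow> q x > 0"
  shows "Ck_on k (\<lambda>x. f x / q x) S"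
  unfolding divide_inverse
  by (rule Ck_on_mult[OF assms(1,2) Ck_on_compose_real[OF assms(1) _ Ck_on_inverse assms(3)]])
    (use assms(4) in auto)

lemma Ck_on_norm: "Ck_on k (\<lambda>x::'a::euclidean_space. norm x) (- {0})"
proof -
  have "Ck_on k (\<lambda>x::'a. (x \<bullet> x) powr (1/2)) (- {0})"
    by (rule Ck_on_compose_real[OF _ _ Ck_on_powr]) 
      (auto intro!: Ck_on_inner Ck_on_bounded_linear[OF bounded_linear_ident])
  then show ?thesis
    using Ck_on_cong[of "-{0}" "\<lambda>x::'a. norm x" "\<lambda>x. (x \<bullet> x) powr (1/2)" k]
    by (simp add: powr_half_sqrt norm_eq_sqrt_inner)
qed

lemma Ck_on_radial:
  assumes "Ck_on k h {0<..}"
  shows "Ck_on k (\<lambda>x::'a::euclidean_space. h (norm x)) (- {0})"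
  by (rule Ck_on_compose_real[OF _ _ assms Ck_on_norm]) auto

subsection \<open>A flat function\<close>

text \<open>The index n gives closure under differentiation: the derivative of a member is a
  combination of the members n + 1 and n + 2, so one induction on k yields C^k for the whole
  family.\<close>

definition flat :: "nat \<Rightarrow> real \<Rightarrow> real" where
  "flat n t = (if t > 0 then inverse t ^ n * exp (- inverse t) else 0)"

lemma tendsto_flat_0: "(flat n \<longlongrightarrow> 0) (at 0)"
proof -
  have "((\<lambda>t::real. inverse t ^ n * exp (- inverse t)) \<longlongrightarrow> 0) (at_right 0)"
    using filterlim_compose[OF tendsto_power_div_exp_0 filterlim_inverse_at_top_right, of n]
    by (simp add: exp_minus divide_inverse)
  then have "(flat n \<longlongrightarrow> 0) (at_right 0)"
    by (rule Lim_transform_eventually)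
      (auto simp: flat_def eventually_at_filter)
  moreover have "(flat n \<longlongrightarrow> 0) (at_left 0)"
    by (rule Lim_transform_eventually[OF tendsto_const])
      (auto simp: flat_def eventually_at_filter)
  ultimately show ?thesis by (simp add: filterlim_split_at)
qed

lemma has_derivative_flat:
  "(flat n has_real_derivative - real n * flat (n + 1) t + flat (n + 2) t) (at t)"
proof -
  consider "t > 0" | "t < 0" | "t = 0" by linarith
  then show ?thesis
  proof cases
    case 1
    have "((\<lambda>t. inverse t ^ n * exp (- inverse t)) has_real_derivative
        - real n * flat (n + 1) t + flat (n + 2) t) (at t)"
    proof -
      have "((\<lambda>t. inverse t ^ n * exp (- inverse t)) has_real_derivative
          real n * inverse t ^ (n - 1) * (- (inverse t ^ 2)) * exp (- inverse t)
           + inverse t ^ n * (exp (- inverse t) * inverse t ^ 2)) (at t)"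
        using 1 by (auto intro!: derivative_eq_intros simp: power2_eq_square)
      moreover have "real n * inverse t ^ (n - 1) * (- (inverse t ^ 2)) * exp (- inverse t)
           + inverse t ^ n * (exp (- inverse t) * inverse t ^ 2) = - real n * flat (n + 1) t + flat (n + 2) t"
        using 1 by (cases n) (simp_all add: flat_def algebra_simps power2_eq_square)
      ultimately show ?thesis by simp
    qed
    then show ?thesis
      using 1 has_field_derivative_transform_within_open[of _ _ t "{0<..}" "flat n"]
      by (auto simp: flat_def)
  next
    case 2
    have "((\<lambda>t. 0) has_real_derivative 0) (at t)" by simp
    from has_field_derivative_transform_within_open[OF this, of "{..<0}" "flat n"]
    show ?thesis using 2 by (auto simp: flat_def)
  next
    case 3
    \<comment> \<open>The difference quotient at 0 is itself a member of the family, also at h = 0,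
      where both sides are 0.\<close>
    have "(\<lambda>h. (flat n (0 + h) - flat n 0) / h) = flat (n + 1)"
      by (auto simp: flat_def fun_eq_iff divide_inverse)
    with tendsto_flat_0[of "n + 1"] have "(flat n has_real_derivative 0) (at 0)"
      by (simp only: DERIV_def)
    then show ?thesis using 3 by (simp add: flat_def)
  qed
qed

lemma Ck_on_flat: "Ck_on k (flat n) UNIV"
proof (induction k arbitrary: n)
  case 0
  show ?case 
    by (auto intro: DERIV_continuous_on has_derivative_flat)
next
  case (Suc k)
  show ?case
    by (rule Ck_on_real_SucI[OF open_UNIV
          has_derivative_flat[unfolded has_real_derivative_iff_has_vector_derivative]])
      (intro Ck_on_add Ck_on_mult Ck_on_const Suc open_UNIV)
qed

section \<open>Integration on Euclidean space\<close>

lemma lborel_integral_shift: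
  fixes f :: "'a::euclidean_space \<Rightarrow> real"
  assumes [measurable]: "f \<in> borel_measurable borel"
  shows "(\<integral>x. f (x + a) \<partial>lborel) = (\<integral>x. f x \<partial>lborel)"
  using integral_distr[of "(+) a" lborel borel f] lborel_distr_plus[of a]
  by (simp add: add.commute)

lemma continuous_bounded_on_compact:
  fixes f :: "'a::topological_space \<Rightarrow> 'b::real_normed_vector"
  assumes "continuous_on S f" "compact S"
  obtains M where "\<And>x. x \<in> S \<Longrightarrow> norm (f x) \<le> M"
proof -
  have "bounded (f ` S)"
    using assms by (intro compact_imp_bounded compact_continuous_image) auto
  then obtain M where "\<forall>y\<in>f ` S. norm y \<le> M"
    unfolding bounded_iff by blast
  then show thesis using that by blast
qed

text \<open>By translation invariance the difference quotients of \<open>F\<close> have integral zero.\<close>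

lemma integral_partial_derivative_eq_0:
  fixes F :: "'a::euclidean_space \<Rightarrow> real"
  assumes C1: "Ck_on 1 F UNIV" and supp: "\<And>x. norm x > R \<Longrightarrow> F x = 0" and b: "b \<in> Basis"
  shows "integrable lborel (\<lambda>x. frechet_derivative F (at x) b)" (is "integrable _ ?D")
    and "(\<integral>x. frechet_derivative F (at x) b \<partial>lborel) = 0"
proof -
  have C1': "Ck_on (Suc 0) F UNIV" using C1 by simp
  have der: "(F has_derivative frechet_derivative F (at x)) (at x)" for x
    using Ck_on_SucD(1)[OF C1'] by simp
  have contD: "continuous_on UNIV ?D"
    using Ck_on_SucD(2)[OF C1' b] by simp
  have contF: "continuous_on UNIV F" using Ck_on_continuous[OF C1] .
  obtain M where M: "\<And>x. x \<in> cball 0 (R + 2) \<Longrightarrow> norm (?D x) \<le> M"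
    using continuous_bounded_on_compact[OF continuous_on_subset[OF contD subset_UNIV] compact_cball] by blast
  have lineder: "((\<lambda>s. F (x + s *\<^sub>R b)) has_real_derivative ?D (x + s *\<^sub>R b)) (at s)" for x s
  proof -
    interpret bounded_linear "frechet_derivative F (at (x + s *\<^sub>R b))"
      using der by (rule has_derivative_bounded_linear)
    have "((\<lambda>s. F (x + s *\<^sub>R b)) has_derivative
        (\<lambda>h. frechet_derivative F (at (x + s *\<^sub>R b)) (h *\<^sub>R b))) (at s)"
      by (rule has_derivative_compose[OF _ der]) (auto intro!: derivative_eq_intros)
    then show ?thesis
      unfolding has_field_derivative_def by (simp add: scaleR mult_commute_abs)
  qed
  define q where "q n x = real (Suc n) * (F (x + (1 / real (Suc n)) *\<^sub>R b) - F x)" for n x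
  \<comment> \<open>The step length 1 / (n + 1) is at most 1: the quotients vanish outside radius R
    + 1, and the mean value points stay within R + 2, where \<open>M\<close> bounds the
    derivative.\<close>
  define W where "W x = indicator (cball 0 (R + 1)) x * M" for x :: 'a
  have MVT: "\<exists>s. 0 < s \<and> s < 1 / real (Suc n) \<and> q n x = ?D (x + s *\<^sub>R b)" for n x
    using MVT2[of 0 "1 / real (Suc n)" "\<lambda>s. F (x + s *\<^sub>R b)" "\<lambda>s. ?D (x + s *\<^sub>R b)"] lineder
    by (auto simp: q_def)
  have qbound: "norm (q n x) \<le> W x" for n x
  proof (cases "norm x \<le> R + 1")
    case True
    from MVT[of n x] obtain s where s: "0 < s" "s < 1 / real (Suc n)" "q n x = ?D (x + s *\<^sub>R b)"
      by blast
    have "s \<le> 1" using s(2) by (rule order.strict_implies_order[OF order.strict_trans2]) simp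
    then have "norm (x + s *\<^sub>R b) \<le> R + 2"
      using norm_triangle_ineq[of x "s *\<^sub>R b"] True s(1) b by (simp add: norm_Basis)
    then show ?thesis using M s(3) True by (simp add: W_def)
  next
    case False
    have "norm ((1 / real (Suc n)) *\<^sub>R b) \<le> 1" using b by (simp add: norm_Basis)
    then have "norm (x + (1 / real (Suc n)) *\<^sub>R b) > R"
      using norm_diff_ineq[of x "(1 / real (Suc n)) *\<^sub>R b"] False by linarith
    then show ?thesis using False supp by (simp add: W_def q_def)
  qed
  have lim: "(\<lambda>n. q n x) \<longlonglongrightarrow> ?D x" for x
  proof -
    have "((\<lambda>h. (F (x + h *\<^sub>R b) - F x) / h) \<longlongrightarrow> ?D x) (at 0)"
      using lineder[where s=0 and x=x] by (simp add: DERIV_def)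
    moreover have "filterlim (\<lambda>n. 1 / real (Suc n)) (at 0) sequentially"
      unfolding filterlim_at using LIMSEQ_inverse_real_of_nat by (auto simp: inverse_eq_divide)
    ultimately have "(\<lambda>n. (F (x + (1 / real (Suc n)) *\<^sub>R b) - F x) / (1 / real (Suc n)))
        \<longlonglongrightarrow> ?D x"
      by (rule filterlim_compose)
    then show ?thesis by (simp add: q_def field_simps)
  qed
  have [measurable]: "F \<in> borel_measurable borel" "?D \<in> borel_measurable borel"
    using contF contD by (auto intro: borel_measurable_continuous_onI)
  have intW: "integrable lborel W"
    unfolding W_def by (intro integrable_mult_left integrable_real_indicator)
      (auto intro: emeasure_bounded_finite[unfolded infinity_ennreal_def])
  have qmeas: "q n \<in> borel_measurable lborel" for n
    unfolding q_def by measurable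
  have Dmeas: "?D \<in> borel_measurable lborel" by simp
  show "integrable lborel ?D"
    by (rule integrable_dominated_convergence[where s=q and w=W])
      (use Dmeas qmeas intW lim qbound in auto)
  have "(\<lambda>n. integral\<^sup>L lborel (q n)) \<longlonglongrightarrow> integral\<^sup>L lborel ?D"
    by (rule integral_dominated_convergence[where s=q and w=W])
      (use Dmeas qmeas intW lim qbound in auto)
  moreover have "integral\<^sup>L lborel (q n) = 0" for n
  proof -
    obtain MF where MF: "\<And>x. x \<in> cball 0 R \<Longrightarrow> norm (F x) \<le> MF"
      using continuous_bounded_on_compact[OF continuous_on_subset[OF contF subset_UNIV] compact_cball] by blast
    have "integrable lborel (\<lambda>x. indicator (cball 0 R) x * MF)"
      by (intro integrable_mult_left integrable_real_indicator)
        (auto intro: emeasure_bounded_finite[unfolded infinity_ennreal_def])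
    then have iF: "integrable lborel F"
    proof (rule Bochner_Integration.integrable_bound)
      show "AE x in lborel. norm (F x) \<le> norm (indicator (cball 0 R) x * MF)"
        using MF supp by (intro AE_I2) (fastforce simp: indicator_def)
    qed simp
    have "integrable lborel (\<lambda>x. F (x + a))" for a
      using iF lborel_distr_plus[of a]
        integrable_distr_eq[of "(+) a" lborel borel F] by (simp add: add.commute)
    then show ?thesis
      unfolding q_def using iF by (simp add: lborel_integral_shift)
  qed
  ultimately show "integral\<^sup>L lborel ?D = 0"
    by (simp add: LIMSEQ_const_iff)
qed

text \<open>Polar integration without a measure on the sphere: on a half-line both measures give the
  volume of a ball, one by definition and the other by integrating its derivative, and half-lines
  generate the Borel sets.\<close>

lemma distr_norm_lborel:
  "distr lborel borel (norm :: 'a::euclidean_space \<Rightarrow> real) = 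
     density lborel (\<lambda>r. ennreal (indicator {0..} r * real DIM('a) * unit_ball_vol DIM('a) * r ^ (DIM('a) - 1)))"
    (is "?M = ?N")
proof (rule measure_eqI_generator_eq[where E = "range atMost" and A = "\<lambda>i. {..real i}" and \<Omega> = UNIV])
  let ?v = "unit_ball_vol DIM('a)"
  have M: "emeasure ?M {..x} = ennreal (?v * (max 0 x) ^ DIM('a))" for x
  proof (cases "x \<ge> 0")
    case True
    have "emeasure ?M {..x} = emeasure lborel (cball (0::'a) x)"
      by (subst emeasure_distr) (auto intro!: arg_cong[where f="emeasure lborel"])
    then show ?thesis using True by (simp add: emeasure_cball max_def)
  next
    case False
    have "(norm :: 'a \<Rightarrow> real) -` {..x} = {}"
      using False by auto (smt (verit) norm_ge_zero)
    then have "emeasure ?M {..x} = 0" by (subst emeasure_distr) auto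
    then show ?thesis using False by (simp add: max_def power_0_left)
  qed
  have N: "emeasure ?N {..x} = ennreal (?v * (max 0 x) ^ DIM('a))" for x
  proof -
    have "emeasure ?N {..x} =
      (\<integral>\<^sup>+r. ennreal (DIM('a) * ?v * r ^ (DIM('a) - 1)) * indicator {0..max 0 x} r \<partial>lborel)"
    proof (subst emeasure_density)
      show "(\<integral>\<^sup>+r. ennreal (indicator {0..} r * real DIM('a) * ?v * r ^ (DIM('a) - 1)) * indicator {..x} r \<partial>lborel)
          = (\<integral>\<^sup>+r. ennreal (DIM('a) * ?v * r ^ (DIM('a) - 1)) * indicator {0..max 0 x} r \<partial>lborel)"
        \<comment> \<open>For x < 0 the interval \<open>{0..max 0 x}\<close> is the single point 0,
          where the integrands differ in dimension one.\<close>
        using AE_lborel_singleton[of "0::real"]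
        by (intro nn_integral_cong_AE) (auto elim!: eventually_mono split: split_indicator)
    qed auto
    also have "\<dots> = ennreal (?v * (max 0 x) ^ DIM('a) - ?v * 0 ^ DIM('a))"
      by (rule nn_integral_FTC_Icc) (auto intro!: derivative_eq_intros)
    finally show ?thesis by (simp add: power_0_left)
  qed
  show "emeasure ?M X = emeasure ?N X" if "X \<in> range atMost" for X
    using that M N by auto
  show "emeasure ?M {..real i} \<noteq> \<infinity>" for i
    using M by simp
  show "Int_stable (range atMost :: real set set)"
    by (auto simp: Int_stable_def)
  show "sets ?M = sigma_sets UNIV (range atMost)" "sets ?N = sigma_sets UNIV (range atMost)"
    by (simp_all add: borel_eq_atMost sets_measure_of_conv)
  show "(\<Union>i. {..real i}) = UNIV" using real_arch_simple by auto
qed auto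

text \<open>Polar coordinates: the constant is the area of the unit sphere.\<close>

lemma nn_integral_radial:
  fixes h :: "real \<Rightarrow> real"
  assumes [measurable]: "h \<in> borel_measurable borel"
  shows "(\<integral>\<^sup>+x. ennreal (h (norm (x::'a::euclidean_space))) \<partial>lborel) =
    ennreal (DIM('a) * unit_ball_vol DIM('a)) *
      (\<integral>\<^sup>+r. ennreal (indicator {0..} r * r ^ (DIM('a) - 1) * h r) \<partial>lborel)"
proof -
  have "(\<integral>\<^sup>+x. ennreal (h (norm (x::'a))) \<partial>lborel) =
      (\<integral>\<^sup>+r. ennreal (h r) \<partial>distr lborel borel (norm :: 'a \<Rightarrow> real))"
    by (subst nn_integral_distr) auto
  also have "\<dots> = (\<integral>\<^sup>+r. ennreal (indicator {0..} r * real DIM('a) * unit_ball_vol DIM('a) * r ^ (DIM('a) - 1))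
      * ennreal (h r) \<partial>lborel)"
    unfolding distr_norm_lborel by (subst nn_integral_density) auto
  also have "\<dots> = (\<integral>\<^sup>+r. ennreal (DIM('a) * unit_ball_vol DIM('a)) * 
      ennreal (indicator {0..} r * r ^ (DIM('a) - 1) * h r) \<partial>lborel)"
    by (intro nn_integral_cong, subst (1 2) ennreal_mult'[symmetric])
      (auto simp: mult_ac split: split_indicator)
  also have "\<dots> = ennreal (DIM('a) * unit_ball_vol DIM('a)) *
      (\<integral>\<^sup>+r. ennreal (indicator {0..} r * r ^ (DIM('a) - 1) * h r) \<partial>lborel)"
    by (rule nn_integral_cmult) measurable
  finally show ?thesis .
qed

text \<open>In polar coordinates the exponent becomes DIM - 1 - s > -1. With s = \<beta> + 4 this
  supplies the dominating function for the error of the cutoff.\<close>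

lemma nn_integral_norm_powr_finite:
  fixes s :: real
  assumes "s < DIM('a)"
  shows "(\<integral>\<^sup>+(x::'a::euclidean_space). ennreal (indicator (ball 0 1) x * norm x powr - s) \<partial>lborel) < \<infinity>"
proof -
  let ?p = "real DIM('a) - 1 - s"
  have "(\<integral>\<^sup>+(x::'a). ennreal (indicator (ball 0 1) x * norm x powr - s) \<partial>lborel) =
    (\<integral>\<^sup>+(x::'a). ennreal ((\<lambda>r. indicator {..<1} r * r powr - s) (norm x)) \<partial>lborel)"
    by (intro nn_integral_cong) (auto split: split_indicator)
  also have "\<dots> = ennreal (DIM('a) * unit_ball_vol DIM('a)) *
      (\<integral>\<^sup>+r. ennreal (indicator {0..} r * r ^ (DIM('a) - 1) * (indicator {..<1} r * r powr - s)) \<partial>lborel)"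
    by (rule nn_integral_radial) measurable
  also have "(\<integral>\<^sup>+r. ennreal (indicator {0..} r * r ^ (DIM('a) - 1) * (indicator {..<1} r * r powr - s)) \<partial>lborel)
    \<le> (\<integral>\<^sup>+r. ennreal (r powr ?p * indicator {0..1} r) \<partial>lborel)"
  proof (intro nn_integral_mono ennreal_leI)
    fix r :: real
    have "r ^ (DIM('a) - 1) * r powr - s = r powr ?p" if "r > 0"
      using that by (simp add: powr_realpow[symmetric] powr_add[symmetric] of_nat_diff)
    then show "indicator {0..} r * r ^ (DIM('a) - 1) * (indicator {..<1} r * r powr - s)
      \<le> r powr ?p * indicator {0..1} r"
      by (cases "r = 0") (auto split: split_indicator)
  qed
  also have "(\<integral>\<^sup>+r. ennreal (r powr ?p * indicator {0..1} r) \<partial>lborel) = ennreal (1 powr (?p + 1) / (?p + 1))"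
  proof (intro nn_integral_has_integral_lborel)
    have "(\<lambda>r. r powr ?p * indicator {0..1} r) = (\<lambda>r::real. if r \<in> {0..1} then r powr ?p else 0)"
      by (auto simp: indicator_def)
    then show "((\<lambda>r. r powr ?p * indicator {0..1} r) has_integral 1 powr (?p + 1) / (?p + 1)) UNIV"
      using assms has_integral_powr_from_0[of ?p 1] by (simp only: has_integral_restrict_UNIV)
  qed auto
  finally show ?thesis
    by (simp add: ennreal_mult_less_top mult_left_mono order.strict_trans1)
qed

text \<open>The exponent is the scale-invariant one, so an annulus weighs its logarithmic width. The
  test functions for sharpness are measured against this density.\<close>

lemma nn_integral_annulus:
  assumes "0 < a" "a \<le> b"
  shows "(\<integral>\<^sup>+(x::'a::euclidean_space). ennreal (indicator {a..b} (norm x) * norm x powr - real DIM('a)) \<partial>lborel)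
     = ennreal (DIM('a) * unit_ball_vol DIM('a) * (ln b - ln a))"
proof -
  have "(\<integral>\<^sup>+(x::'a). ennreal (indicator {a..b} (norm x) * norm x powr - real DIM('a)) \<partial>lborel) =
    ennreal (DIM('a) * unit_ball_vol DIM('a)) *
      (\<integral>\<^sup>+r. ennreal (indicator {0..} r * r ^ (DIM('a) - 1) * (indicator {a..b} r * r powr - real DIM('a))) \<partial>lborel)"
    by (rule nn_integral_radial) measurable
  also have "(\<integral>\<^sup>+r. ennreal (indicator {0..} r * r ^ (DIM('a) - 1) * (indicator {a..b} r * r powr - real DIM('a))) \<partial>lborel)
    = (\<integral>\<^sup>+r. ennreal (inverse r) * indicator {a..b} r \<partial>lborel)"
  proof (intro nn_integral_cong)
    fix r :: real
    have "r ^ (DIM('a) - 1) * r powr - real DIM('a) = r powr -1" if "r > 0"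
      using that by (simp add: powr_realpow[symmetric] powr_add[symmetric] of_nat_diff)
    then show "ennreal (indicator {0..} r * r ^ (DIM('a) - 1) * (indicator {a..b} r * r powr - real DIM('a)))
      = ennreal (inverse r) * indicator {a..b} r"
      using assms by (auto simp: powr_minus split: split_indicator)
  qed
  also have "\<dots> = ennreal (ln b - ln a)"
    using assms by (intro nn_integral_FTC_Icc) (auto intro!: derivative_eq_intros simp: divide_inverse)
  finally show ?thesis
    using assms by (simp add: ennreal_mult[symmetric])
qed

section \<open>Geometry of a model manifold\<close>

text \<open>The fundamental theorem along a \<open>valid_path\<close> produces a gauge integral,
  while \<open>riem_length\<close> is a Lebesgue integral that may be infinite. An infinite right
  side is trivial; a finite one makes a Borel representative Lebesgue integrable, and then both
  integrals agree.\<close>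

lemma has_integral_le_nn_integral_abs:
  fixes f :: "'a::euclidean_space \<Rightarrow> real"
  assumes I: "(f has_integral I) \<Omega>"
  shows "ennreal I \<le> (\<integral>\<^sup>+x. ennreal \<bar>f x\<bar> * indicator \<Omega> x \<partial>lborel)"
proof -
  from I have "(\<lambda>x. indicator \<Omega> x *\<^sub>R f x) \<in> lebesgue \<rightarrow>\<^sub>M borel"
    by (rule has_integral_implies_lebesgue_measurable)
  then obtain f' :: "'a \<Rightarrow> real"
    where [measurable]: "f' \<in> borel \<rightarrow>\<^sub>M borel" and eq: "AE x in lborel. indicator \<Omega> x * f x = f' x"
    by (auto dest: completion_ex_borel_measurable_real)
  have "(\<integral>\<^sup>+x. ennreal \<bar>f x\<bar> * indicator \<Omega> x \<partial>lborel) = (\<integral>\<^sup>+x. ennreal \<bar>f' x\<bar> \<partial>lborel)"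
    using eq by (intro nn_integral_cong_AE) (auto elim!: eventually_mono split: split_indicator)
  moreover have "ennreal I \<le> (\<integral>\<^sup>+x. ennreal \<bar>f' x\<bar> \<partial>lborel)"
  proof (cases "(\<integral>\<^sup>+x. ennreal \<bar>f' x\<bar> \<partial>lborel) = \<infinity>")
    case False
    then have int: "integrable lborel f'"
      by (intro integrableI_bounded) (auto simp: less_top[symmetric])
    have "((\<lambda>x. indicator \<Omega> x * f x) has_integral I) UNIV"
      using I by (subst has_integral_restrict_UNIV[symmetric])
        (simp add: indicator_def of_bool_def if_distrib[of "\<lambda>z. z * _"] cong: if_cong)
    then have "(f' has_integral I) UNIV"
      using has_integral_AE[of UNIV "\<lambda>x. indicator \<Omega> x * f x" f' I] eq by simp
    then have "I = integral\<^sup>L lborel f'"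
      using has_integral_integral_lborel[OF int] has_integral_unique by blast
    also have "\<dots> \<le> integral\<^sup>L lborel (\<lambda>x. \<bar>f' x\<bar>)"
      using int by (intro integral_mono) auto
    finally have "ennreal I \<le> ennreal (integral\<^sup>L lborel (\<lambda>x. \<bar>f' x\<bar>))"
      by (rule ennreal_leI)
    also have "\<dots> = (\<integral>\<^sup>+x. ennreal \<bar>f' x\<bar> \<partial>lborel)"
      using int by (intro nn_integral_eq_integral[symmetric]) auto
    finally show ?thesis .
  qed simp
  ultimately show ?thesis by simp
qed

lemma matrix_inv_eqI:
  fixes A B :: "real^'n^'n"
  assumes "A ** B = mat 1"
  shows "matrix_inv A = B"
proof -
  have BA: "B ** A = mat 1" using assms matrix_left_right_inverse by blast
  have "A ** matrix_inv A = mat 1 \<and> matrix_inv A ** A = mat 1"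
    unfolding matrix_inv_def by (rule someI[of _ B]) (use assms BA in blast)
  then have "matrix_inv A = (B ** A) ** matrix_inv A" "A ** matrix_inv A = mat 1"
    by (simp_all add: BA)
  then show ?thesis by (simp add: matrix_mul_assoc[symmetric])
qed

locale model =
  fixes g :: "real^'n \<Rightarrow> real^'n^'n" and \<psi> :: "real \<Rightarrow> real"
  assumes model: "model_manifold g \<psi>"
begin

abbreviation "\<psi>1 \<equiv> halfline_deriv 1 \<psi>"
abbreviation "\<psi>2 \<equiv> halfline_deriv 2 \<psi>"

lemma psi_pos: "t > 0 \<Longrightarrow> \<psi> t > 0"
  using model by (auto simp: model_manifold_def)

lemma psi_0: "\<psi> 0 = 0"
  using model unfolding model_manifold_def by (metis halfline_deriv.simps(1) mult_zero_right)

lemma psi1_0: "\<psi>1 0 = 1"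
  using model by (auto simp: model_manifold_def)

lemma halfline_deriv_works:
  assumes "t \<ge> 0"
  shows "(halfline_deriv k \<psi> has_real_derivative halfline_deriv (Suc k) \<psi> t) (at t within {0..})"
proof -
  have "halfline_deriv k \<psi> differentiable_on {0..}"
    using model by (auto simp: model_manifold_def smooth_halfline_def)
  then have "halfline_deriv k \<psi> differentiable (at t within {0..})"
    using assms by (auto simp: differentiable_on_def)
  then show ?thesis
    unfolding has_real_derivative_iff_has_vector_derivative halfline_deriv.simps
    by (rule vector_derivative_works[THEN iffD1])
qed

lemma halfline_deriv_works_pos:
  assumes "t > 0"
  shows "(halfline_deriv k \<psi> has_real_derivative halfline_deriv (Suc k) \<psi> t) (at t)"
proof -
  have "(halfline_deriv k \<psi> has_real_derivative halfline_deriv (Suc k) \<psi> t) (at t within {0<..})"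
    using assms by (intro has_field_derivative_subset[OF halfline_deriv_works]) auto
  then show ?thesis using assms at_within_open[of t "{0<..}"] by simp
qed

lemma psi_derivs:
  assumes "t > 0"
  shows "(\<psi> has_real_derivative \<psi>1 t) (at t)" "(\<psi>1 has_real_derivative \<psi>2 t) (at t)"
  using halfline_deriv_works_pos[OF assms, of 0] halfline_deriv_works_pos[OF assms, of 1]
  by (simp_all add: numeral_2_eq_2)

lemma Ck_on_halfline_deriv: "Ck_on k (halfline_deriv j \<psi>) {0<..}"
proof (induction k arbitrary: j)
  case 0
  have "continuous_on {0<..} (halfline_deriv j \<psi>)"
    by (rule DERIV_continuous_on[OF has_field_derivative_at_within[OF halfline_deriv_works_pos]]) simp
  then show ?case by simp
next
  case (Suc k)
  show ?case
    by (rule Ck_on_real_SucI[OF _ _ Suc[of "Suc j"]])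
      (simp_all only: has_real_derivative_iff_has_vector_derivative[symmetric] open_greaterThan
        greaterThan_iff halfline_deriv_works_pos)
qed

lemma Ck_on_psi: "Ck_on k \<psi> {0<..}"
  using Ck_on_halfline_deriv[of k 0] by simp

lemma psi_div_tendsto: "((\<lambda>r. \<psi> r / r) \<longlongrightarrow> 1) (at_right 0)"
proof -
  have "(\<psi> has_real_derivative 1) (at_right 0)"
    using halfline_deriv_works[of 0 0] psi1_0
    by (intro has_field_derivative_subset[of \<psi> 1 0 "{0..}" "{0<..}"]) auto
  then show ?thesis by (simp add: has_field_derivative_iff psi_0)
qed

lemma psi1_tendsto: "(\<psi>1 \<longlongrightarrow> 1) (at_right 0)"
proof -
  have "continuous (at 0 within {0..}) \<psi>1"
    using halfline_deriv_works[of 0 1] DERIV_continuous by blast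
  then have "continuous (at 0 within {0<..}) \<psi>1"
    by (rule continuous_within_subset) auto
  then show ?thesis by (simp only: continuous_within psi1_0)
qed

subsection \<open>The metric away from the pole\<close>

text \<open>The model condition determines only the quadratic form: splitting v into its radial part
  and r times a tangential vector shows that it is 1 on the radial line and (\<psi>(r)/r)^2 on the
  orthogonal complement. Polarization with the symmetry of \<open>g x\<close> then gives the
  matrix.\<close>

lemma metric_apply:
  assumes "x \<noteq> 0"
  shows "g x *v v = (\<psi> (norm x) / norm x)\<^sup>2 *\<^sub>R v
    + ((1 - (\<psi> (norm x) / norm x)\<^sup>2) / (norm x)\<^sup>2 * (x \<bullet> v)) *\<^sub>R x"
    (is "_ = ?h v")
proof -
  define r where "r = norm x"
  have r: "r > 0" using assms by (simp add: r_def)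
  define q where "q = \<psi> r / r"
  have sym: "u \<bullet> (g x *v v) = v \<bullet> (g x *v u)" for u v
    using model by (metis dot_lmul_matrix inner_commute model_manifold_def riemannian_metric_def
        transpose_matrix_vector)
  have Q: "v \<bullet> (g x *v v) = v \<bullet> ?h v" for v
  proof -
    define \<omega> where "\<omega> = x /\<^sub>R r"
    define \<tau> where "\<tau> = (x \<bullet> v) / r"
    define \<eta> where "\<eta> = (v - \<tau> *\<^sub>R \<omega>) /\<^sub>R r"
    have xx: "x \<bullet> x = r\<^sup>2" by (simp add: r_def dot_square_norm)
    have n\<omega>: "norm \<omega> = 1" using r by (simp add: \<omega>_def r_def)
    have orth: "\<omega> \<bullet> \<eta> = 0"
      using r by (simp add: \<omega>_def \<eta>_def \<tau>_def inner_diff_right xx power2_eq_square field_simps)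
    have v: "v = \<tau> *\<^sub>R \<omega> + r *\<^sub>R \<eta>" using r by (simp add: \<eta>_def)
    have x: "x = r *\<^sub>R \<omega>" using r by (simp add: \<omega>_def)
    have "v \<bullet> (g x *v v) = \<tau>\<^sup>2 + (\<psi> r)\<^sup>2 * (norm \<eta>)\<^sup>2"
      using model r n\<omega> orth unfolding v[symmetric] model_manifold_def
      by (metis v x)
    moreover have "(r *\<^sub>R \<eta>) \<bullet> (r *\<^sub>R \<eta>) = v \<bullet> v - \<tau>\<^sup>2"
      using r by (simp add: \<eta>_def \<omega>_def \<tau>_def inner_diff_left inner_diff_right xx inner_commute
          power2_eq_square field_simps)
    then have "(norm \<eta>)\<^sup>2 = (v \<bullet> v - \<tau>\<^sup>2) / r\<^sup>2"
      using r unfolding power2_norm_eq_inner by (simp add: field_simps power2_eq_square)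
    ultimately have "v \<bullet> (g x *v v) = \<tau>\<^sup>2 + q\<^sup>2 * (v \<bullet> v - \<tau>\<^sup>2)"
      using r by (simp add: q_def field_simps)
    also have "\<dots> = v \<bullet> ?h v"
      using r by (simp add: r_def[symmetric] q_def[symmetric] inner_add_right \<tau>_def inner_commute
          power2_eq_square field_simps)
    finally show ?thesis .
  qed
  have "u \<bullet> (g x *v v) = u \<bullet> ?h v" for u
  proof -
    have "2 * (u \<bullet> (g x *v v)) = (u + v) \<bullet> (g x *v (u + v)) - u \<bullet> (g x *v u) - v \<bullet> (g x *v v)"
      using sym[of u v] by (simp add: matrix_vector_right_distrib inner_add_left inner_add_right)
    also have "\<dots> = 2 * (u \<bullet> ?h v)"
    proof -
      define s c where "s = (\<psi> (norm x) / norm x)\<^sup>2" and "c = (1 - s) / (norm x)\<^sup>2"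
      show ?thesis
        unfolding Q s_def[symmetric] c_def[symmetric]
        by (simp add: inner_add_left inner_add_right inner_commute algebra_simps)
    qed
    finally show ?thesis by simp
  qed
  then show ?thesis by (metis inner_commute vector_eq_rdot)
qed

section \<open>Distance from the pole\<close>

lemma metric_apply_radial:
  assumes "x \<noteq> 0" "c \<noteq> 0"
  shows "g (c *\<^sub>R x) *v x = x" "g (c *\<^sub>R x) *v - x = - x"
proof -
  have "c *\<^sub>R (g (c *\<^sub>R x) *v x) = g (c *\<^sub>R x) *v (c *\<^sub>R x)"
    by (simp add: matrix_vector_mult_scaleR)
  also have "\<dots> = c *\<^sub>R x"
    using assms by (subst metric_apply)
      (auto simp: dot_square_norm power_mult_distrib scaleR_add_left[symmetric] distrib_right[symmetric])
  finally show *: "g (c *\<^sub>R x) *v x = x" using assms by simp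
  show "g (c *\<^sub>R x) *v - x = - x"
    using matrix_vector_mult_scaleR[of "g (c *\<^sub>R x)" "-1" x] * by simp
qed

text \<open>Infinitesimal Gauss lemma: the squared speed is the squared radial speed plus a
  nonnegative multiple of the squared tangential speed, whose sign is Cauchy-Schwarz.\<close>

lemma radial_speed_le:
  assumes "x \<noteq> 0"
  shows "\<bar>x \<bullet> v\<bar> / norm x \<le> sqrt (v \<bullet> (g x *v v))"
proof (rule real_le_rsqrt)
  define q where "q = \<psi> (norm x) / norm x"
  have "(x \<bullet> v)\<^sup>2 \<le> (norm x)\<^sup>2 * (norm v)\<^sup>2"
    using Cauchy_Schwarz_ineq[of x v] by (simp add: dot_square_norm)
  then have "0 \<le> q\<^sup>2 * ((norm v)\<^sup>2 - (x \<bullet> v)\<^sup>2 / (norm x)\<^sup>2)"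
    using assms by (intro mult_nonneg_nonneg) (auto simp: field_simps)
  also have "\<dots> = v \<bullet> (g x *v v) - (x \<bullet> v)\<^sup>2 / (norm x)\<^sup>2"
    unfolding metric_apply[OF assms] q_def[symmetric]
    by (simp add: inner_add_right dot_square_norm inner_commute algebra_simps power2_eq_square diff_divide_distrib)
  finally show "(\<bar>x \<bullet> v\<bar> / norm x)\<^sup>2 \<le> v \<bullet> (g x *v v)"
    by (simp add: power_divide)
qed

text \<open>A path may run through the pole, where the norm is not differentiable. The
  regularization sqrt(|y|^2 + e^2) is smooth, its derivative along the path is still bounded by the
  speed, and it costs at most e.\<close>

lemma norm_le_riem_length:
  assumes "valid_path \<gamma>" "pathstart \<gamma> = x" "pathfinish \<gamma> = 0"
  shows "ennreal (norm x) \<le> riem_length g \<gamma>"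
proof (rule ennreal_le_epsilon)
  fix e :: real
  assume e: "e > 0"
  obtain S where S: "finite S" "\<gamma> C1_differentiable_on ({0..1} - S)" and cont: "continuous_on {0..1} \<gamma>"
    using assms(1) by (auto simp: valid_path_def piecewise_C1_differentiable_on_def)
  define \<gamma>' where "\<gamma>' t = vector_derivative \<gamma> (at t)" for t
  \<comment> \<open>The minus sign accounts for paths that end at the pole: \<open>F 1 - F 0\<close>
    is sqrt(|x|^2 + e^2) - e.\<close>
  define F where "F t = - sqrt (\<gamma> t \<bullet> \<gamma> t + e\<^sup>2)" for t
  define F' where "F' t = (if t \<in> {0<..<1} - S then - (\<gamma> t \<bullet> \<gamma>' t) / sqrt (\<gamma> t \<bullet> \<gamma> t + e\<^sup>2) else 0)" for t
  have pos: "\<gamma> t \<bullet> \<gamma> t + e\<^sup>2 > 0" for t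
    using e by (simp add: add_nonneg_pos)
  have "(F' has_integral F 1 - F 0) {0..1}"
  proof (rule fundamental_theorem_of_calculus_interior_strong[OF S(1)])
    show "continuous_on {0..1} F"
      unfolding F_def by (intro continuous_intros cont)
    fix t assume t: "t \<in> {0<..<1} - S"
    then have "(\<gamma> has_vector_derivative \<gamma>' t) (at t)"
      using S(2) by (auto simp: C1_differentiable_on_eq vector_derivative_works \<gamma>'_def)
    then have "(F has_real_derivative F' t) (at t)"
      unfolding F_def has_vector_derivative_def has_field_derivative_def using t pos[of t]
      by (auto intro!: derivative_eq_intros simp: F'_def inner_commute fun_eq_iff field_simps)
    then show "(F has_vector_derivative F' t) (at t)"
      by (simp add: has_real_derivative_iff_has_vector_derivative)
  qed simp
  from has_integral_le_nn_integral_abs[OF this]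
  have "ennreal (F 1 - F 0) \<le> (\<integral>\<^sup>+t. ennreal \<bar>F' t\<bar> * indicator {0..1} t \<partial>lborel)" .
  also have "\<dots> \<le> riem_length g \<gamma>"
    unfolding riem_length_def
  proof (intro nn_integral_mono mult_right_mono ennreal_leI)
    fix t :: real
    have "\<bar>\<gamma> t \<bullet> \<gamma>' t\<bar> / sqrt (\<gamma> t \<bullet> \<gamma> t + e\<^sup>2) \<le> sqrt (\<gamma>' t \<bullet> (g (\<gamma> t) *v \<gamma>' t))"
      if nz: "\<gamma> t \<noteq> 0"
    proof -
      have "norm (\<gamma> t) \<le> sqrt (\<gamma> t \<bullet> \<gamma> t + e\<^sup>2)"
        by (simp add: norm_eq_sqrt_inner)
      then have "\<bar>\<gamma> t \<bullet> \<gamma>' t\<bar> / sqrt (\<gamma> t \<bullet> \<gamma> t + e\<^sup>2) \<le> \<bar>\<gamma> t \<bullet> \<gamma>' t\<bar> / norm (\<gamma> t)"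
        using nz by (intro divide_left_mono) (auto intro!: mult_pos_pos pos)
      also have "\<dots> \<le> sqrt (\<gamma>' t \<bullet> (g (\<gamma> t) *v \<gamma>' t))"
        by (rule radial_speed_le[OF nz])
      finally show ?thesis .
    qed
    moreover have "0 \<le> v \<bullet> (g y *v v)" for y v
      using model by (cases "v = 0") (auto simp: model_manifold_def riemannian_metric_def intro: less_imp_le)
    ultimately show "\<bar>F' t\<bar> \<le> sqrt (vector_derivative \<gamma> (at t) \<bullet> (g (\<gamma> t) *v vector_derivative \<gamma> (at t)))"
      by (cases "\<gamma> t = 0") (auto simp: F'_def \<gamma>'_def[symmetric] abs_div_pos[OF real_sqrt_gt_zero[OF pos], symmetric])
  qed auto
  finally have *: "ennreal (F 1 - F 0) \<le> riem_length g \<gamma>" .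
  have "norm x \<le> max 0 (F 1 - F 0) + e"
    using assms(2,3) e real_le_rsqrt[of "norm x" "x \<bullet> x + e\<^sup>2"]
    by (simp add: F_def pathstart_def pathfinish_def dot_square_norm)
  then have "ennreal (norm x) \<le> ennreal (max 0 (F 1 - F 0) + e)"
    by (rule ennreal_leI)
  also have "\<dots> = ennreal (F 1 - F 0) + ennreal e"
    using e by (simp add: max_def ennreal_neg)
  finally show "ennreal (norm x) \<le> riem_length g \<gamma> + ennreal e"
    using * by (meson add_right_mono order_trans)
qed

lemma riem_length_radial: "riem_length g (linepath x 0) = ennreal (norm x)"
proof -
  have "riem_length g (linepath x 0) = (\<integral>\<^sup>+t. ennreal (norm x) * indicator {0..1::real} t \<partial>lborel)"
    unfolding riem_length_def
  proof (intro nn_integral_cong_AE, use AE_lborel_singleton[of "1::real"] in eventually_elim, goal_cases)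
    case (1 t)
    have "- x \<bullet> (g ((1 - t) *\<^sub>R x) *v - x) = (norm x)\<^sup>2" if "t < 1" "x \<noteq> 0"
      using that by (simp add: metric_apply_radial dot_square_norm)
    with 1 show ?case
      by (cases "x = 0") (auto simp: linepath_def split: split_indicator)
  qed
  then show ?thesis by (simp add: nn_integral_cmult_indicator)
qed

lemma pole_dist_eq: "pole_dist g x = norm x"
proof -
  let ?P = "{\<gamma>. valid_path \<gamma> \<and> pathstart \<gamma> = x \<and> pathfinish \<gamma> = 0}"
  have "(INF \<gamma>\<in>?P. riem_length g \<gamma>) = ennreal (norm x)"
  proof (rule antisym)
    show "(INF \<gamma>\<in>?P. riem_length g \<gamma>) \<le> ennreal (norm x)"
      by (rule INF_lower2[of "linepath x 0"]) (auto simp: riem_length_radial)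
    show "ennreal (norm x) \<le> (INF \<gamma>\<in>?P. riem_length g \<gamma>)"
      by (rule INF_greatest) (auto intro: norm_le_riem_length)
  qed
  then show ?thesis by (simp add: pole_dist_def riem_dist_def)
qed

lemma pole_ball_eq: "pole_ball g r = ball 0 r"
  by (auto simp: pole_ball_def pole_dist_eq)

section \<open>Inverse metric and volume density\<close>

text \<open>The inverse has the shape of the metric with q = \<psi>(r)/r replaced by 1/q: eigenvalue
  1 on the radial line and 1/q^2 on its complement.\<close>

lemma matrix_inv_metric:
  assumes "x \<noteq> 0"
  shows "matrix_inv (g x) $ i $ j = (norm x / \<psi> (norm x))\<^sup>2 * (if i = j then 1 else 0)
    + (1 - (norm x / \<psi> (norm x))\<^sup>2) / (norm x)\<^sup>2 * (x $ i * x $ j)"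
proof -
  define q where "q = \<psi> (norm x) / norm x"
  have q: "q > 0" using assms psi_pos by (simp add: q_def)
  have qi: "norm x / \<psi> (norm x) = 1 / q" by (simp add: q_def)
  define c where "c = (1 - (1/q)\<^sup>2) / (norm x)\<^sup>2"
  define B :: "real^'n^'n" where "B = (\<chi> i j. (1/q)\<^sup>2 * (if i = j then 1 else 0) + c * (x $ i * x $ j))"
  have B: "B *v v = (1/q)\<^sup>2 *\<^sub>R v + (c * (x \<bullet> v)) *\<^sub>R x" for v
  proof -
    have "(B *v v) $ i = (1/q)\<^sup>2 * v $ i + c * (x \<bullet> v) * x $ i" for i
    proof -
      have "(B *v v) $ i = (\<Sum>j\<in>UNIV. (1/q)\<^sup>2 * (if i = j then v $ j else 0)) + (\<Sum>j\<in>UNIV. c * x $ i * (x $ j * v $ j))"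
        unfolding sum.distrib[symmetric] B_def matrix_vector_mult_def
        by (auto intro!: sum.cong simp: algebra_simps)
      then show ?thesis
        by (simp add: sum_distrib_left[symmetric] inner_vec_def)
    qed
    then show ?thesis by (simp add: vec_eq_iff)
  qed
  have "(g x ** B) *v v = mat 1 *v v" for v
  proof -
    have xx: "x \<bullet> x = (norm x)\<^sup>2" by (simp add: dot_square_norm)
    have "(g x ** B) *v v = q\<^sup>2 *\<^sub>R (B *v v) + ((1 - q\<^sup>2) / (norm x)\<^sup>2 * (x \<bullet> (B *v v))) *\<^sub>R x"
      unfolding matrix_vector_mul_assoc[symmetric] by (subst metric_apply[OF assms]) (simp add: q_def)
    also have "x \<bullet> (B *v v) = x \<bullet> v"
    proof -
      have "x \<bullet> (B *v v) = (1/q)\<^sup>2 * (x \<bullet> v) + (c * (norm x)\<^sup>2) * (x \<bullet> v)"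
        unfolding B by (simp add: inner_add_right xx)
      also have "c * (norm x)\<^sup>2 = 1 - (1/q)\<^sup>2"
        using assms by (simp add: c_def)
      finally show ?thesis by (simp add: left_diff_distrib)
    qed
    also have "q\<^sup>2 *\<^sub>R (B *v v) + ((1 - q\<^sup>2) / (norm x)\<^sup>2 * (x \<bullet> v)) *\<^sub>R x =
       v + ((q\<^sup>2 * c + (1 - q\<^sup>2) / (norm x)\<^sup>2) * (x \<bullet> v)) *\<^sub>R x"
      unfolding B using q by (simp add: scaleR_add_right scaleR_add_left power_divide distrib_right mult.assoc)
    also have "q\<^sup>2 * c + (1 - q\<^sup>2) / (norm x)\<^sup>2 = 0"
      using q assms by (simp add: c_def field_simps power_divide)
    finally show ?thesis by simp
  qed
  then have "g x ** B = mat 1" by (simp add: matrix_eq)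
  then have "matrix_inv (g x) = B" by (rule matrix_inv_eqI)
  then show ?thesis by (simp add: B_def qi c_def)
qed

text \<open>A rotation taking x/|x| to a coordinate axis diagonalizes the metric, with eigenvalue 1
  once and (\<psi>(r)/r)^2 in the remaining N - 1 directions; the determinant of the rotation
  squares to 1.\<close>

lemma sqrt_det_metric:
  assumes "x \<noteq> 0"
  shows "sqrt (det (g x)) = (\<psi> (norm x) / norm x) ^ (CARD('n) - 1)"
proof -
  define q where "q = \<psi> (norm x) / norm x"
  have q: "q > 0" using assms psi_pos by (simp add: q_def)
  obtain k :: 'n where True by simp
  obtain f where f: "orthogonal_transformation f" "f (x /\<^sub>R norm x) = axis k (1::real)"
    using orthogonal_transformation_exists_1[of "x /\<^sub>R norm x" "axis k (1::real)"] assms by auto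
  define A where "A = matrix f"
  have A: "orthogonal_matrix A" and fA: "f = (\<lambda>v. A *v v)"
    using f(1) by (auto simp: A_def orthogonal_transformation_matrix orthogonal_transformation_linear)
  define d where "d i = (if i = k then 1 else q\<^sup>2)" for i
  define D :: "real^'n^'n" where "D = (\<chi> i j. if i = j then d i else 0)"
  have "(D *v w) $ i = d i * w $ i" for w i
    by (simp add: D_def matrix_vector_mult_def if_distrib[of "\<lambda>z. z * _"] cong: if_cong)
  then have D: "D *v w = q\<^sup>2 *\<^sub>R w + ((1 - q\<^sup>2) * (w \<bullet> axis k 1)) *\<^sub>R axis k 1" for w
    by (auto simp: vec_eq_iff inner_axis d_def algebra_simps) (simp_all add: axis_def)
  have AtA: "transpose A ** A = mat 1" using A by (simp add: orthogonal_matrix)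
  have At: "transpose A *v axis k 1 = x /\<^sub>R norm x"
    using f(2) unfolding fA by (metis AtA matrix_vector_mul_assoc matrix_vector_mul_lid)
  have "(transpose A ** D ** A) *v v = g x *v v" for v
  proof -
    have "(transpose A ** D ** A) *v v = transpose A *v (D *v (A *v v))"
      by (simp only: matrix_vector_mul_assoc matrix_mul_assoc)
    also have "\<dots> = q\<^sup>2 *\<^sub>R (transpose A *v (A *v v)) +
        ((1 - q\<^sup>2) * ((A *v v) \<bullet> axis k 1)) *\<^sub>R (transpose A *v axis k 1)"
      unfolding D by (simp only: matrix_vector_right_distrib matrix_vector_mult_scaleR)
    also have "(A *v v) \<bullet> axis k 1 = f v \<bullet> f (x /\<^sub>R norm x)"
      using f(2) fA by simp
    also have "\<dots> = v \<bullet> (x /\<^sub>R norm x)"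
      using f(1) by (simp add: orthogonal_transformation_def)
    also have "transpose A *v (A *v v) = v"
      by (metis AtA matrix_vector_mul_assoc matrix_vector_mul_lid)
    finally show ?thesis
      unfolding At metric_apply[OF assms] q_def[symmetric]
      by (simp add: inner_commute power2_eq_square divide_inverse mult_ac)
  qed
  then have "g x = transpose A ** D ** A" by (simp add: matrix_eq)
  then have "det (g x) = det A * det A * det D"
    by (simp add: det_mul det_transpose)
  also have "det A * det A = 1"
    using det_orthogonal_matrix[OF A] by auto
  also have "det D = (\<Prod>i\<in>UNIV. if i = k then 1 else q\<^sup>2)"
    by (subst det_diagonal) (auto simp: D_def d_def)
  also have "\<dots> = (q\<^sup>2) ^ (CARD('n) - 1)"
    by (subst prod.remove[of _ k]) (auto simp: card_Diff_singleton)
  finally show ?thesis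
    using q by (simp add: q_def[symmetric] flip: power_mult) (simp add: mult.commute[of 2] power_mult)
qed

end

section \<open>The Laplace-Beltrami operator\<close>

lemma has_derivative_radial:
  fixes x :: "'a::real_inner" and h :: "real \<Rightarrow> real"
  assumes "x \<noteq> 0" "(h has_real_derivative h') (at (norm x))"
  shows "((\<lambda>y. h (norm y)) has_derivative (\<lambda>e. (x \<bullet> e) / norm x * h')) (at x)"
  using has_derivative_compose[OF has_derivative_norm[OF assms(1)] assms(2)[unfolded has_field_derivative_def]]
  by (simp add: sgn_div_norm inner_commute divide_inverse mult_ac)

lemma vec_derivative_expand:
  fixes f :: "real^'n \<Rightarrow> 'b::real_normed_vector"
  assumes "f differentiable at y"
  shows "frechet_derivative f (at y) v = (\<Sum>j\<in>UNIV. v $ j *\<^sub>R partial_deriv j f y)"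
proof -
  interpret bounded_linear "frechet_derivative f (at y)"
    using assms frechet_derivative_works has_derivative_bounded_linear by blast
  have "v = (\<Sum>j\<in>UNIV. v $ j *\<^sub>R axis j 1)"
    by (metis basis_expansion scalar_mult_eq_scaleR)
  then have "frechet_derivative f (at y) v = frechet_derivative f (at y) (\<Sum>j\<in>UNIV. v $ j *\<^sub>R axis j 1)"
    by simp
  also have "\<dots> = (\<Sum>j\<in>UNIV. v $ j *\<^sub>R partial_deriv j f y)"
    by (simp only: sum scaleR partial_deriv_def)
  finally show ?thesis .
qed

lemma Ck_on_partial_deriv:
  "Ck_on (Suc k) f S \<Longrightarrow> Ck_on k (\<lambda>y. partial_deriv j f y) S"
  unfolding partial_deriv_def by (rule Ck_on_SucD(2)) auto

text \<open>Cauchy-Schwarz with vector-valued coefficients. Complex values of f are treated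
  throughout as vectors of a real inner product space.\<close>

lemma norm_sum_scaleR_le:
  fixes a :: "'n::finite \<Rightarrow> 'b::real_inner" and x :: "real^'n"
  shows "(\<Sum>i\<in>UNIV. x $ i *\<^sub>R a i) \<bullet> (\<Sum>i\<in>UNIV. x $ i *\<^sub>R a i) \<le> (norm x)\<^sup>2 * (\<Sum>i\<in>UNIV. a i \<bullet> a i)"
proof -
  have "norm (\<Sum>i\<in>UNIV. x $ i *\<^sub>R a i) \<le> (\<Sum>i\<in>UNIV. \<bar>x $ i\<bar> * \<bar>norm (a i)\<bar>)"
    by (rule order_trans[OF norm_sum]) simp
  also have "\<dots> \<le> L2_set (($) x) UNIV * L2_set (\<lambda>i. norm (a i)) UNIV"
    by (rule L2_set_mult_ineq)
  finally have "(norm (\<Sum>i\<in>UNIV. x $ i *\<^sub>R a i))\<^sup>2 \<le> (L2_set (($) x) UNIV * L2_set (\<lambda>i. norm (a i)) UNIV)\<^sup>2"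
    by (rule power_mono) simp
  also have "\<dots> = (norm x)\<^sup>2 * (\<Sum>i\<in>UNIV. a i \<bullet> a i)"
    by (simp add: power_mult_distrib L2_set_def sum_nonneg norm_vec_def power2_norm_eq_inner)
  finally show ?thesis by (simp add: power2_norm_eq_inner)
qed

declare halfline_deriv.simps(2) [simp del]

context model
begin

definition J :: "real \<Rightarrow> real" where
  "J r = (\<psi> r / r) ^ (CARD('n) - 1)"

text \<open>The i-th component of the Riemannian gradient times the volume density. Its Euclidean
  divergence is the density times the Laplacian, so all integration by parts can be done in flat
  coordinates.\<close>

definition flux :: "(real^'n \<Rightarrow> 'b::real_normed_vector) \<Rightarrow> 'n \<Rightarrow> real^'n \<Rightarrow> 'b" where
  "flux f i y = (\<Sum>j\<in>UNIV. (sqrt (det (g y)) * matrix_inv (g y) $ i $ j) *\<^sub>R partial_deriv j f y)"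

lemma J_pos: "r > 0 \<Longrightarrow> J r > 0"
  by (simp add: J_def psi_pos)

lemma J_deriv:
  assumes "r > 0"
  shows "(J has_real_derivative J r * ((real CARD('n) - 1) * (\<psi>1 r / \<psi> r - 1 / r))) (at r)"
proof -
  define n where "n = CARD('n) - 1"
  have n: "real CARD('n) - 1 = real n"
    by (simp add: n_def of_nat_diff Suc_leI)
  have p: "\<psi> r > 0" using assms by (rule psi_pos)
  have "((\<lambda>r. \<psi> r / r) has_real_derivative (\<psi>1 r * r - \<psi> r) / (r * r)) (at r)"
    using assms by (auto intro!: derivative_eq_intros psi_derivs(1))
  from DERIV_power[OF this, of n]
  have "(J has_real_derivative real n * ((\<psi>1 r * r - \<psi> r) / (r * r) * (\<psi> r / r) ^ (n - Suc 0))) (at r)"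
    unfolding J_def n_def[symmetric] .
  also have "real n * ((\<psi>1 r * r - \<psi> r) / (r * r) * (\<psi> r / r) ^ (n - Suc 0)) = J r * (n * (\<psi>1 r / \<psi> r - 1 / r))"
    unfolding J_def n_def[symmetric] using assms p by (cases n) (simp_all, simp add: field_simps)
  finally show ?thesis by (simp only: n)
qed

lemma Ck_on_J: "Ck_on k J {0<..}"
  unfolding J_def
  by (intro Ck_on_power Ck_on_divide Ck_on_psi Ck_on_bounded_linear[OF bounded_linear_ident]) auto

lemma sqrt_det_eq: "x \<noteq> 0 \<Longrightarrow> sqrt (det (g x)) = J (norm x)"
  by (simp add: sqrt_det_metric J_def)

lemma laplace_beltrami_eq:
  assumes "x \<noteq> 0"
  shows "laplace_beltrami g f x = (1 / J (norm x)) *\<^sub>R (\<Sum>i\<in>UNIV. partial_deriv i (flux f i) x)"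
  unfolding laplace_beltrami_def sqrt_det_eq[OF assms] flux_def[abs_def] ..

lemma flux_eq:
  assumes "x \<noteq> 0" "f differentiable at x"
  shows "flux f i x = J (norm x) *\<^sub>R ((norm x / \<psi> (norm x))\<^sup>2 *\<^sub>R partial_deriv i f x
    + ((1 - (norm x / \<psi> (norm x))\<^sup>2) / (norm x)\<^sup>2 * x $ i) *\<^sub>R frechet_derivative f (at x) x)"
proof -
  define s where "s = (norm x / \<psi> (norm x))\<^sup>2"
  define c where "c = (1 - s) / (norm x)\<^sup>2"
  have "flux f i x = J (norm x) *\<^sub>R (\<Sum>j\<in>UNIV. s *\<^sub>R (if i = j then partial_deriv j f x else 0)
      + (c * x $ i) *\<^sub>R (x $ j *\<^sub>R partial_deriv j f x))"
    unfolding flux_def matrix_inv_metric[OF assms(1)] s_def[symmetric] c_def[symmetric]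
      sqrt_det_eq[OF assms(1)] scaleR_sum_right
    by (intro sum.cong) (auto simp: algebra_simps)
  also have "\<dots> = J (norm x) *\<^sub>R (s *\<^sub>R partial_deriv i f x + (c * x $ i) *\<^sub>R (\<Sum>j\<in>UNIV. x $ j *\<^sub>R partial_deriv j f x))"
    unfolding sum.distrib scaleR_sum_right[symmetric] by simp
  finally show ?thesis
    unfolding vec_derivative_expand[OF assms(2)] s_def c_def .
qed

lemma Ck_on_flux:
  assumes "Ck_on (Suc k) f (- {0})"
  shows "Ck_on k (flux f i) (- {0})"
proof -
  have "Ck_on k (\<lambda>y. \<Sum>j\<in>UNIV. (J (norm y) * ((norm y / \<psi> (norm y))\<^sup>2 * (if i = j then 1 else 0)
    + (1 - (norm y / \<psi> (norm y))\<^sup>2) / (norm y)\<^sup>2 * (y $ i * y $ j))) *\<^sub>R partial_deriv j f y) (- {0})"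
    by (intro Ck_on_sum Ck_on_scaleR Ck_on_mult Ck_on_add Ck_on_divide Ck_on_diff Ck_on_power Ck_on_const
        Ck_on_radial Ck_on_J Ck_on_psi Ck_on_bounded_linear[OF bounded_linear_vec_nth] Ck_on_norm
        Ck_on_partial_deriv assms) (auto simp: psi_pos)
  then show ?thesis
    by (subst Ck_on_cong[where g = "\<lambda>y. \<Sum>j\<in>UNIV. (J (norm y) * ((norm y / \<psi> (norm y))\<^sup>2 * (if i = j then 1 else 0)
    + (1 - (norm y / \<psi> (norm y))\<^sup>2) / (norm y)\<^sup>2 * (y $ i * y $ j))) *\<^sub>R partial_deriv j f y"])
      (auto simp: flux_def matrix_inv_metric sqrt_det_eq)
qed

lemma continuous_on_laplace_beltrami:
  assumes "Ck_on 2 f (- {0})"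
  shows "continuous_on (- {0}) (laplace_beltrami g f)"
proof -
  have 2: "Ck_on (Suc (Suc 0)) f (- {0})" using assms by (simp add: numeral_2_eq_2)
  have "Ck_on 0 (\<lambda>x. (1 / J (norm x)) *\<^sub>R (\<Sum>i\<in>UNIV. partial_deriv i (flux f i) x)) (- {0})"
    by (intro Ck_on_scaleR Ck_on_sum Ck_on_partial_deriv Ck_on_flux 2 Ck_on_divide Ck_on_const Ck_on_radial Ck_on_J)
      (auto simp: J_pos)
  then show ?thesis
    by (simp add: laplace_beltrami_eq cong: continuous_on_cong_simp)
qed

text \<open>The inverse metric fixes the radial direction, so contracting with x leaves no trace of
  \<psi> except in the density.\<close>

lemma sum_flux:
  assumes "x \<noteq> 0" "f differentiable at x"
  shows "(\<Sum>i\<in>UNIV. x $ i *\<^sub>R flux f i x) = J (norm x) *\<^sub>R frechet_derivative f (at x) x"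
proof -
  define s where "s = (norm x / \<psi> (norm x))\<^sup>2"
  define D where "D = frechet_derivative f (at x) x"
  have nx: "(\<Sum>i\<in>UNIV. x $ i * x $ i) = (norm x)\<^sup>2"
    by (simp add: inner_vec_def[symmetric, where 'a=real, simplified] power2_norm_eq_inner)
  define c where "c = (1 - s) / (norm x)\<^sup>2"
  have "(\<Sum>i\<in>UNIV. x $ i *\<^sub>R flux f i x) = J (norm x) *\<^sub>R (s *\<^sub>R (\<Sum>i\<in>UNIV. x $ i *\<^sub>R partial_deriv i f x)
      + (c * (\<Sum>i\<in>UNIV. x $ i * x $ i)) *\<^sub>R D)"
    unfolding flux_eq[OF assms] s_def[symmetric] D_def[symmetric] c_def[symmetric]
    by (simp add: scaleR_sum_right scaleR_sum_left sum_distrib_left sum.distrib scaleR_add_right mult_ac)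
  also have "\<dots> = J (norm x) *\<^sub>R (s *\<^sub>R D + (1 - s) *\<^sub>R D)"
    using assms(1) unfolding nx vec_derivative_expand[OF assms(2), of x, folded D_def, symmetric]
    by (simp add: c_def)
  finally show ?thesis by (simp add: D_def scaleR_add_left[symmetric])
qed

text \<open>The squared Riemannian gradient is the squared radial derivative plus s =
  (r/\<psi>(r))^2 times the tangential part, and that part is dropped. The derivative at x in
  direction x is r times the radial derivative, hence the division by |x|.\<close>

lemma sum_partial_flux_ge:
  fixes f :: "real^'n \<Rightarrow> 'b::real_inner"
  assumes "x \<noteq> 0" "f differentiable at x"
  shows "(\<Sum>i\<in>UNIV. partial_deriv i f x \<bullet> flux f i x) \<ge>
    J (norm x) * (norm (frechet_derivative f (at x) x) / norm x)\<^sup>2"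
proof -
  define s where "s = (norm x / \<psi> (norm x))\<^sup>2"
  define D where "D = frechet_derivative f (at x) x"
  define G where "G = (\<Sum>i\<in>UNIV. partial_deriv i f x \<bullet> partial_deriv i f x)"
  have D: "D = (\<Sum>j\<in>UNIV. x $ j *\<^sub>R partial_deriv j f x)"
    unfolding D_def by (rule vec_derivative_expand[OF assms(2)])
  have "(\<Sum>i\<in>UNIV. partial_deriv i f x \<bullet> flux f i x)
    = J (norm x) * (s * G + (1 - s) / (norm x)\<^sup>2 * (\<Sum>i\<in>UNIV. (x $ i *\<^sub>R partial_deriv i f x) \<bullet> D))"
    unfolding flux_eq[OF assms] s_def[symmetric] D_def[symmetric] G_def
    by (simp add: inner_add_right sum.distrib sum_distrib_left distrib_left mult_ac)
  also have "(\<Sum>i\<in>UNIV. (x $ i *\<^sub>R partial_deriv i f x) \<bullet> D) = D \<bullet> D"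
    by (subst (2) D) (simp only: inner_sum_left)
  finally have eq: "(\<Sum>i\<in>UNIV. partial_deriv i f x \<bullet> flux f i x)
    = J (norm x) * (s * G + (1 - s) / (norm x)\<^sup>2 * (D \<bullet> D))" .
  have "(D \<bullet> D) / (norm x)\<^sup>2 \<le> G"
    using norm_sum_scaleR_le[of x "\<lambda>i. partial_deriv i f x"] assms(1)
    by (simp add: D[symmetric] G_def[symmetric] field_simps)
  then have "s * ((D \<bullet> D) / (norm x)\<^sup>2) \<le> s * G"
    by (intro mult_left_mono) (simp_all add: s_def)
  then have "(D \<bullet> D) / (norm x)\<^sup>2 \<le> s * G + (1 - s) / (norm x)\<^sup>2 * (D \<bullet> D)"
    by (simp add: algebra_simps diff_divide_distrib)
  then show ?thesis
    unfolding eq D_def[symmetric] using assms(1) J_pos[of "norm x"]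
    by (intro mult_left_mono) (auto simp: power_divide power2_norm_eq_inner intro: less_imp_le)
qed

definition wfield :: "(real \<Rightarrow> real) \<Rightarrow> (real \<Rightarrow> real) \<Rightarrow> (real^'n \<Rightarrow> 'b::real_inner) \<Rightarrow> 'n \<Rightarrow> real^'n \<Rightarrow> real" where
  "wfield h k f i y = h (norm y) * (f y \<bullet> flux f i y) + k (norm y) * (f y \<bullet> f y) * y $ i"

text \<open>Product rule in each coordinate, after which three sums are recognized: the divergence
  of the flux is the density times the Laplacian, and contracting x with the partial derivatives or
  with the flux gives the derivative along x, in the second case times \<open>J\<close>.\<close>

lemma divergence_wfield:
  fixes f :: "real^'n \<Rightarrow> 'b::real_inner"
  assumes f: "Ck_on 2 f (- {0})" and x: "x \<noteq> 0"
    and h: "(h has_real_derivative h') (at (norm x))"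
    and k: "(k has_real_derivative k') (at (norm x))"
  shows "(\<Sum>i\<in>UNIV. frechet_derivative (wfield h k f i) (at x) (axis i 1)) =
      h' / norm x * J (norm x) * (f x \<bullet> frechet_derivative f (at x) x)
    + h (norm x) * (\<Sum>i\<in>UNIV. partial_deriv i f x \<bullet> flux f i x)
    + h (norm x) * J (norm x) * (f x \<bullet> laplace_beltrami g f x)
    + (norm x * k' + real CARD('n) * k (norm x)) * (f x \<bullet> f x)
    + 2 * k (norm x) * (f x \<bullet> frechet_derivative f (at x) x)"
proof -
  have 2: "Ck_on (Suc (Suc 0)) f (- {0})" using f by (simp add: numeral_2_eq_2)
  define D where "D = frechet_derivative f (at x)"
  have D: "(f has_derivative D) (at x)"
    unfolding D_def using Ck_on_SucD(1)[OF 2] x by simp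
  then have fd: "f differentiable at x" by (auto simp: differentiable_def)
  define F where "F i = frechet_derivative (flux f i) (at x)" for i
  have F: "(flux f i has_derivative F i) (at x)" for i
    unfolding F_def using Ck_on_SucD(1)[OF Ck_on_flux[OF 2]] x by simp
  let ?r = "norm x"
  have "(wfield h k f i has_derivative (\<lambda>e. (h ?r * (f x \<bullet> F i e + D e \<bullet> flux f i x)
      + (x \<bullet> e) / ?r * h' * (f x \<bullet> flux f i x))
      + ((k ?r * (f x \<bullet> f x)) * e $ i + (k ?r * (f x \<bullet> D e + D e \<bullet> f x) + (x \<bullet> e) / ?r * k' * (f x \<bullet> f x)) * x $ i))) (at x)" for i
    unfolding wfield_def
    by (intro has_derivative_add has_derivative_mult has_derivative_inner has_derivative_radial[OF x] h k D F
        bounded_linear_imp_has_derivative[OF bounded_linear_vec_nth])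
  from frechet_derivative_at[OF this, symmetric]
  have "frechet_derivative (wfield h k f i) (at x) (axis i 1) = (h ?r * (f x \<bullet> F i (axis i 1) + D (axis i 1) \<bullet> flux f i x)
      + x $ i / ?r * h' * (f x \<bullet> flux f i x))
      + ((k ?r * (f x \<bullet> f x)) + (k ?r * (2 * (f x \<bullet> D (axis i 1))) + x $ i / ?r * k' * (f x \<bullet> f x)) * x $ i)" for i
    by (simp add: inner_axis inner_commute)
  then have "(\<Sum>i\<in>UNIV. frechet_derivative (wfield h k f i) (at x) (axis i 1)) =
    (\<Sum>i\<in>UNIV. (h ?r * (f x \<bullet> F i (axis i 1) + D (axis i 1) \<bullet> flux f i x)
      + x $ i / ?r * h' * (f x \<bullet> flux f i x))
      + ((k ?r * (f x \<bullet> f x)) + (k ?r * (2 * (f x \<bullet> D (axis i 1))) + x $ i / ?r * k' * (f x \<bullet> f x)) * x $ i))"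
    by simp
  also have "\<dots> = h ?r * (f x \<bullet> (\<Sum>i\<in>UNIV. F i (axis i 1))) + h ?r * (\<Sum>i\<in>UNIV. D (axis i 1) \<bullet> flux f i x)
     + h' / ?r * (f x \<bullet> (\<Sum>i\<in>UNIV. x $ i *\<^sub>R flux f i x))
     + real CARD('n) * k ?r * (f x \<bullet> f x) + 2 * k ?r * (f x \<bullet> (\<Sum>i\<in>UNIV. x $ i *\<^sub>R D (axis i 1)))
     + (x \<bullet> x) / ?r * k' * (f x \<bullet> f x)"
    by (simp add: sum.distrib inner_sum_right sum_distrib_left sum_distrib_right distrib_left distrib_right
        inner_vec_def sum_divide_distrib mult_ac)
  also have "(\<Sum>i\<in>UNIV. F i (axis i 1)) = J ?r *\<^sub>R laplace_beltrami g f x"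
    using J_pos[of ?r] x by (simp add: laplace_beltrami_eq F_def partial_deriv_def)
  also have "(\<Sum>i\<in>UNIV. x $ i *\<^sub>R D (axis i 1)) = D x"
    unfolding D_def vec_derivative_expand[OF fd, of x] partial_deriv_def ..
  also have "(\<Sum>i\<in>UNIV. x $ i *\<^sub>R flux f i x) = J ?r *\<^sub>R D x"
    unfolding D_def by (rule sum_flux[OF x fd])
  also have "(x \<bullet> x) / ?r = ?r"
    using x by (simp add: dot_square_norm power2_eq_square)
  finally show ?thesis
    by (simp add: D_def partial_deriv_def algebra_simps)
qed

end

section \<open>A weighted Rellich inequality\<close>

subsection \<open>A cutoff near the pole\<close>

text \<open>Squaring the positive part of 1 - e^2/r^2 makes it \<open>C\<^sup>1\<close>, the
  regularity that the divergence theorem asks for. The derivative is at most 4/r uniformly in e and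
  tends to 0 at each fixed r, which is what dominated convergence needs.\<close>

definition cutoff :: "real \<Rightarrow> real \<Rightarrow> real" where
  "cutoff e r = (if r \<le> e then 0 else (1 - e\<^sup>2 / r\<^sup>2)\<^sup>2)"

definition cutoff' :: "real \<Rightarrow> real \<Rightarrow> real" where
  "cutoff' e r = 4 * e\<^sup>2 / r ^ 3 * max 0 (1 - e\<^sup>2 / r\<^sup>2)"

lemma has_derivative_max0_square:
  "((\<lambda>u::real. (max 0 u)\<^sup>2) has_real_derivative 2 * max 0 u) (at u)"
proof -
  consider "u > 0" | "u < 0" | "u = 0" by linarith
  then show ?thesis
  proof cases
    case 1
    have "((\<lambda>u::real. u\<^sup>2) has_real_derivative 2 * max 0 u) (at u)"
      using 1 by (auto intro!: derivative_eq_intros)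
    then show ?thesis
      by (rule has_field_derivative_transform_within_open[where S = "{0<..}"]) (use 1 in auto)
  next
    case 2
    have "((\<lambda>u::real. 0) has_real_derivative 2 * max 0 u) (at u)"
      using 2 by (auto intro!: derivative_eq_intros)
    then show ?thesis
      by (rule has_field_derivative_transform_within_open[where S = "{..<0}"]) (use 2 in auto)
  next
    case 3
    have "((\<lambda>h::real. max 0 h) \<longlongrightarrow> max 0 0) (at 0)"
      by (intro tendsto_intros)
    moreover have "(\<lambda>h::real. ((max 0 (0 + h))\<^sup>2 - (max 0 0)\<^sup>2) / h) = (\<lambda>h. max 0 h)"
      by (auto simp: fun_eq_iff max_def power2_eq_square)
    ultimately show ?thesis using 3 by (simp add: DERIV_def)
  qed
qed

context
  fixes e :: real
  assumes e: "e > 0"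
begin

lemma cutoff_eq_max:
  assumes "r > 0"
  shows "cutoff e r = (max 0 (1 - e\<^sup>2 / r\<^sup>2))\<^sup>2"
proof -
  have "e\<^sup>2 \<le> r\<^sup>2 \<longleftrightarrow> e \<le> r" using assms e by (simp add: power_mono_iff)
  then show ?thesis using assms e by (auto simp: cutoff_def max_def field_simps)
qed

lemma cutoff_deriv:
  assumes "r > 0"
  shows "(cutoff e has_real_derivative cutoff' e r) (at r)"
proof -
  have "((\<lambda>r. 1 - e\<^sup>2 / r\<^sup>2) has_real_derivative 2 * e\<^sup>2 / r ^ 3) (at r)"
    using assms by (auto intro!: derivative_eq_intros simp: field_simps power2_eq_square power3_eq_cube)
  from DERIV_chain2[OF has_derivative_max0_square this]
  have "((\<lambda>r. (max 0 (1 - e\<^sup>2 / r\<^sup>2))\<^sup>2) has_real_derivative cutoff' e r) (at r)"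
    by (simp add: cutoff'_def mult_ac)
  then show ?thesis
    by (rule has_field_derivative_transform_within_open[where S = "{0<..}"])
      (use assms cutoff_eq_max in auto)
qed

lemma Ck_on_cutoff: "Ck_on 1 (cutoff e) {0<..}"
proof -
  have "continuous_on {0<..} (cutoff' e)"
    unfolding cutoff'_def by (intro continuous_intros) auto
  then have "Ck_on (Suc 0) (cutoff e) {0<..}"
    by (intro Ck_on_real_SucI[where f' = "cutoff' e"])
      (simp_all only: Ck_on.simps open_greaterThan greaterThan_iff cutoff_deriv
        has_real_derivative_iff_has_vector_derivative[symmetric])
  then show ?thesis by simp
qed

lemma cutoff_bounds:
  assumes "r > 0"
  shows "0 \<le> cutoff e r" "cutoff e r \<le> 1" "0 \<le> cutoff' e r" "cutoff' e r \<le> 4 / r"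
proof -
  let ?m = "max 0 (1 - e\<^sup>2 / r\<^sup>2)"
  have m: "0 \<le> ?m" "?m \<le> 1" by auto
  show "0 \<le> cutoff e r" "cutoff e r \<le> 1"
    using m by (simp_all only: cutoff_eq_max[OF assms] power_le_one zero_le_power)
  show "0 \<le> cutoff' e r" using assms m by (auto simp: cutoff'_def)
  have "e\<^sup>2 / r\<^sup>2 * ?m \<le> 1"
  proof (cases "e\<^sup>2 / r\<^sup>2 \<le> 1")
    case True
    then show ?thesis using m by (intro mult_le_one) auto
  qed (simp add: max_def)
  then have "4 / r * (e\<^sup>2 / r\<^sup>2 * ?m) \<le> 4 / r * 1"
    using assms by (intro mult_left_mono) auto
  then show "cutoff' e r \<le> 4 / r"
    by (simp add: cutoff'_def power2_eq_square power3_eq_cube mult_ac)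
qed

end

lemma cutoff_tendsto:
  assumes r: "r > 0"
  shows "(\<lambda>n. cutoff (1 / real (Suc n)) r) \<longlonglongrightarrow> 1" "(\<lambda>n. cutoff' (1 / real (Suc n)) r) \<longlonglongrightarrow> 0"
proof -
  have z: "(\<lambda>n. 1 / real (Suc n)) \<longlonglongrightarrow> 0"
    using LIMSEQ_inverse_real_of_nat by (simp add: inverse_eq_divide)
  have "(\<lambda>n. (max 0 (1 - (1 / real (Suc n))\<^sup>2 / r\<^sup>2))\<^sup>2) \<longlonglongrightarrow> (max 0 (1 - 0\<^sup>2 / r\<^sup>2))\<^sup>2"
    using r by (intro tendsto_intros z) auto
  then show "(\<lambda>n. cutoff (1 / real (Suc n)) r) \<longlonglongrightarrow> 1"
    using r by (simp add: cutoff_eq_max)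
  have "(\<lambda>n. 4 * (1 / real (Suc n))\<^sup>2 / r ^ 3 * max 0 (1 - (1 / real (Suc n))\<^sup>2 / r\<^sup>2))
      \<longlonglongrightarrow> 4 * 0\<^sup>2 / r ^ 3 * max 0 (1 - 0\<^sup>2 / r\<^sup>2)"
    using r by (intro tendsto_intros z) auto
  then show "(\<lambda>n. cutoff' (1 / real (Suc n)) r) \<longlonglongrightarrow> 0"
    by (simp add: cutoff'_def)
qed

subsection \<open>The pointwise inequality\<close>

text \<open>Complete the square in \<open>D / r\<close>, then use AM-GM to absorb \<open>w (f \<bullet> L)\<close>.\<close>

lemma rellich_pointwise:
  fixes f D L :: "'b::real_inner"
  assumes "w > 0" "r > 0" "K > 0" "P > 0"
    and hyp: "K * w\<^sup>2 * P \<le> v0 - (w' + 2 * v)\<^sup>2 / (4 * w)"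
  shows "K / 2 * (w\<^sup>2 * P * (norm f)\<^sup>2) - (norm L)\<^sup>2 / P / (2 * K)
    \<le> w * (norm D / r)\<^sup>2 + (w' + 2 * v) / r * (f \<bullet> D) + w * (f \<bullet> L) + v0 * (norm f)\<^sup>2"
proof -
  define a where "a = (w' + 2 * v) / (2 * w)"
  have a: "w' + 2 * v = 2 * w * a" using assms by (simp add: a_def)
  have "0 \<le> w * (norm (D /\<^sub>R r + a *\<^sub>R f))\<^sup>2" using assms by simp
  also have "\<dots> = w * ((norm D / r)\<^sup>2 + 2 * a / r * (f \<bullet> D) + a\<^sup>2 * (norm f)\<^sup>2)"
    unfolding power2_norm_eq_inner power_divide
    by (simp add: inner_add_left inner_add_right inner_commute power2_eq_square divide_inverse algebra_simps)
  also have "\<dots> = w * (norm D / r)\<^sup>2 + (w' + 2 * v) / r * (f \<bullet> D) + (w' + 2 * v)\<^sup>2 / (4 * w) * (norm f)\<^sup>2"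
    unfolding a using assms by (simp add: power2_eq_square field_simps)
  finally have 1: "0 \<le> w * (norm D / r)\<^sup>2 + (w' + 2 * v) / r * (f \<bullet> D) + (w' + 2 * v)\<^sup>2 / (4 * w) * (norm f)\<^sup>2" .
  have "(K * w\<^sup>2 * P) * (norm f)\<^sup>2 \<le> (v0 - (w' + 2 * v)\<^sup>2 / (4 * w)) * (norm f)\<^sup>2"
    using hyp by (rule mult_right_mono) simp
  then have 2: "K * (w\<^sup>2 * P * (norm f)\<^sup>2) \<le> v0 * (norm f)\<^sup>2 - (w' + 2 * v)\<^sup>2 / (4 * w) * (norm f)\<^sup>2"
    by (simp only: left_diff_distrib mult.assoc)
  \<comment> \<open>The Riccati hypothesis yields the term \<open>K * w\<^sup>2 * P\<close>. Half of
    it pays for the mixed term here, and the other half remains in the conclusion.\<close>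
  have "0 \<le> (K * w * P * norm f - norm L)\<^sup>2 / (2 * K * P)"
    using assms by simp
  also have "\<dots> = K / 2 * (w\<^sup>2 * P * (norm f)\<^sup>2) + (norm L)\<^sup>2 / P / (2 * K) - w * (norm f * norm L)"
    using assms by (simp add: power2_eq_square field_simps)
  finally have "w * (norm f * norm L) \<le> K / 2 * (w\<^sup>2 * P * (norm f)\<^sup>2) + (norm L)\<^sup>2 / P / (2 * K)" by simp
  moreover have "- (norm f * norm L) \<le> f \<bullet> L"
    using Cauchy_Schwarz_ineq2[of f L] by linarith
  then have "w * (- (norm f * norm L)) \<le> w * (f \<bullet> L)"
    using assms by (intro mult_left_mono) auto
  ultimately have 3: "- (w * (f \<bullet> L)) \<le> K / 2 * (w\<^sup>2 * P * (norm f)\<^sup>2) + (norm L)\<^sup>2 / P / (2 * K)"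
    by simp
  show ?thesis using 1 2 3 by argo
qed

text \<open>Lets a pointwise inequality be integrated without knowing that a is integrable: if the
  right side is finite, a lies between 0 and the integrable function d + b.\<close>

lemma nn_integral_le_if_integral_eq_0:
  fixes a b d :: "'a \<Rightarrow> real"
  assumes [measurable]: "a \<in> borel_measurable M" "b \<in> borel_measurable M"
    and d: "integrable M d" "integral\<^sup>L M d = 0"
    and nn: "\<And>x. 0 \<le> a x" "\<And>x. 0 \<le> b x" and le: "\<And>x. a x \<le> d x + b x"
  shows "(\<integral>\<^sup>+x. ennreal (a x) \<partial>M) \<le> (\<integral>\<^sup>+x. ennreal (b x) \<partial>M)"
proof (cases "(\<integral>\<^sup>+x. ennreal (b x) \<partial>M) = \<infinity>")
  case False
  then have b: "integrable M b"
    using nn by (intro integrableI_bounded) (auto simp: less_top[symmetric])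
  have a: "integrable M a"
  proof (rule Bochner_Integration.integrable_bound[OF Bochner_Integration.integrable_add[OF d(1) b]])
    show "AE x in M. norm (a x) \<le> norm (d x + b x)"
      using nn le by (intro AE_I2) (auto intro: order_trans[OF _ abs_ge_self])
  qed simp
  have "integral\<^sup>L M a \<le> integral\<^sup>L M (\<lambda>x. d x + b x)"
    using a b d le by (intro integral_mono) auto
  also have "\<dots> = integral\<^sup>L M b" using d b by simp
  finally show ?thesis
    using nn a b by (simp add: nn_integral_eq_integral ennreal_leI)
qed simp

text \<open>Compactness leaves a gap below radius 1. The gap matters because the weights blow up on
  the unit sphere.\<close>

lemma test_function_support:
  assumes "f \<in> test_functions (ball 0 1)"
  obtains R where "0 < R" "R < 1" "\<And>x. norm x > R \<Longrightarrow> f x = 0"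
proof -
  let ?S = "closure {x. f x \<noteq> 0}"
  have S: "compact ?S" "?S \<subseteq> ball 0 1" using assms by (auto simp: test_functions_def)
  show thesis
  proof (cases "?S = {}")
    case True
    then have "{x. f x \<noteq> 0} = {}" by (metis closure_eq_empty)
    then show thesis using that[of "1/2"] by auto
  next
    case False
    obtain y where y: "y \<in> ?S" "\<And>x. x \<in> ?S \<Longrightarrow> norm x \<le> norm y"
      using continuous_attains_sup[OF S(1) False continuous_on_norm_id] by blast
    have "norm y < 1" using y(1) S(2) by (auto simp: subset_iff)
    \<comment> \<open>The maximum with 1/2 keeps R positive even if the support is the pole
      alone.\<close>
    moreover have "f x = 0" if "norm x > max (1/2) (norm y)" for x
      using y(2)[of x] that closure_subset[of "{x. f x \<noteq> 0}"] by force
    ultimately show thesis using that[of "max (1/2) (norm y)"] by auto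
  qed
qed

context model
begin

text \<open>Since \<psi>(0) = 0, the mean value theorem turns \<psi>(r)/r into a value of
  \<open>\<psi>1\<close>, which is continuous up to 0.\<close>

lemma J_bounded: "\<exists>C. \<forall>r\<in>{0<..1}. J r \<le> C"
proof -
  have "continuous_on {0..} \<psi>1"
    using halfline_deriv_works[of _ 1] by (intro DERIV_continuous_on) auto
  then obtain C where C: "\<And>t. t \<in> {0..1} \<Longrightarrow> norm (\<psi>1 t) \<le> C"
    using continuous_bounded_on_compact[of "{0..1}" \<psi>1]
    by (meson atLeastAtMost_iff atLeast_iff compact_Icc continuous_on_subset subsetI)
  have c\<psi>: "continuous_on {0..} \<psi>"
    using halfline_deriv_works[of _ 0] by (intro DERIV_continuous_on) auto
  have "J r \<le> C ^ (CARD('n) - 1)" if r: "r \<in> {0<..1}" for r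
  proof -
    have "\<exists>l z. 0 < z \<and> z < r \<and> (\<psi> has_real_derivative l) (at z) \<and> \<psi> r - \<psi> 0 = (r - 0) * l"
    proof (rule MVT)
      show "continuous_on {0..r} \<psi>" by (rule continuous_on_subset[OF c\<psi>]) auto
      show "\<psi> differentiable (at x)" if "0 < x" for x
        using psi_derivs(1)[OF that] real_differentiable_def by blast
    qed (use r in auto)
    then obtain l z where z: "0 < z" "z < r" "(\<psi> has_real_derivative l) (at z)" "\<psi> r - \<psi> 0 = (r - 0) * l"
      by blast
    then have "l = \<psi>1 z" using psi_derivs(1) DERIV_unique by blast
    then have "\<psi> r / r \<le> C"
      using C[of z] r z by (simp add: psi_0 field_simps)
    moreover have "0 \<le> \<psi> r / r" using psi_pos[of r] r by simp
    ultimately show ?thesis unfolding J_def by (rule power_mono)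
  qed
  then show ?thesis by blast
qed

text \<open>The derivative along x carries a factor |x|; it offsets the division by r in the error
  term of the cutoff.\<close>

lemma frechet_derivative_at_self_le:
  fixes f :: "real^'n \<Rightarrow> 'b::real_normed_vector"
  assumes "Ck_on 1 f UNIV"
  shows "\<exists>C. \<forall>x\<in>ball 0 1. norm (frechet_derivative f (at x) x) \<le> C * norm x"
proof -
  have C1: "Ck_on (Suc 0) f UNIV" using assms by simp
  have "continuous_on (cball 0 1) (\<lambda>x. \<Sum>j\<in>UNIV. norm (partial_deriv j f x))"
    using Ck_on_continuous[OF Ck_on_partial_deriv[OF C1]]
    by (intro continuous_intros) (auto intro: continuous_on_subset)
  then obtain C where C: "\<And>x. x \<in> cball 0 1 \<Longrightarrow> norm (\<Sum>j\<in>UNIV. norm (partial_deriv j f x)) \<le> C"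
    using continuous_bounded_on_compact[OF _ compact_cball] by blast
  have "norm (frechet_derivative f (at x) x) \<le> C * norm x" if "x \<in> ball 0 1" for x
  proof -
    have "norm (frechet_derivative f (at x) x) \<le> (\<Sum>j\<in>UNIV. norm (x $ j *\<^sub>R partial_deriv j f x))"
      using C1 by (subst vec_derivative_expand) (simp_all only: Ck_on.simps UNIV_I norm_sum)
    also have "\<dots> \<le> (\<Sum>j\<in>UNIV. norm x * norm (partial_deriv j f x))"
      by (intro sum_mono) (simp add: mult_right_mono component_le_norm_cart)
    also have "\<dots> \<le> C * norm x"
    proof -
      have "(\<Sum>j\<in>UNIV. norm (partial_deriv j f x)) \<le> C"
        using C[of x] that by (simp add: sum_nonneg)
      then show ?thesis
        unfolding sum_distrib_left[symmetric] using mult_right_mono[OF _ norm_ge_zero, of _ C x]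
        by (metis mult.commute)
    qed
    finally show ?thesis .
  qed
  then show ?thesis by blast
qed

section \<open>The weighted inequality for abstract weights\<close>

text \<open>Each hypothesis on the data enters at one place: \<open>riccati\<close> and
  \<open>mono\<close> make the quadratic form in the divergence bounded below, while
  \<open>bound\<close> together with \<beta> + 4 < N dominates the terms in which the derivative
  falls on the cutoff.\<close>

theorem rellich_weighted:
  fixes f :: "real^'n \<Rightarrow> complex" and w w' v v' :: "real \<Rightarrow> real" and K \<beta> :: real
  assumes f: "f \<in> test_functions (ball 0 1)" and K: "K > 0" and \<beta>: "\<beta> + 4 < real CARD('n)"
    and mono: "\<And>r. r > 0 \<Longrightarrow> \<psi> r \<le> r * \<psi>1 r"
    and Ckw: "Ck_on 1 w {0<..<1}" and Ckv: "Ck_on 1 v {0<..<1}"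
    and w_pos: "\<And>r. r \<in> {0<..<1} \<Longrightarrow> w r > 0" and v_nonneg: "\<And>r. r \<in> {0<..<1} \<Longrightarrow> v r \<ge> 0"
    and dw: "\<And>r. r \<in> {0<..<1} \<Longrightarrow> (w has_real_derivative w' r) (at r)"
    and dv: "\<And>r. r \<in> {0<..<1} \<Longrightarrow> (v has_real_derivative v' r) (at r)"
    and riccati: "\<And>r. r \<in> {0<..<1} \<Longrightarrow>
      K * (w r)\<^sup>2 * r powr \<beta> \<le> v' r + (real CARD('n) - 1) * v r / r - (w' r + 2 * v r)\<^sup>2 / (4 * w r)"
    and bound: "\<And>R. R \<in> {0<..<1} \<Longrightarrow>
      \<exists>C. \<forall>r\<in>{0<..R}. w r \<le> C * r powr (- 2 - \<beta>) \<and> v r \<le> C * r powr (- 3 - \<beta>)"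
  shows "ennreal (K\<^sup>2) * (\<integral>\<^sup>+x\<in>ball 0 1. ennreal (J (norm x) * ((w (norm x))\<^sup>2 * norm x powr \<beta> * (norm (f x))\<^sup>2)) \<partial>lborel)
    \<le> (\<integral>\<^sup>+x\<in>ball 0 1. ennreal (J (norm x) * ((norm (laplace_beltrami g f x))\<^sup>2 / norm x powr \<beta>)) \<partial>lborel)"
proof -
  define U :: "(real^'n) set" where "U = ball 0 1 - {0}"
  have openU: "open U" by (simp add: U_def open_delete)
  have U: "norm x \<in> {0<..<1}" "norm x > 0" "norm x < 1" "x \<noteq> 0" if "x \<in> U" for x
    using that by (auto simp: U_def)
  have Ckf: "Ck_on k f S" for k S
    using f by (auto simp: test_functions_def smooth_on_def intro: Ck_on_subset)
  have f2: "Ck_on 2 f (- {0})" by (rule Ckf)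
  have fdiff: "f differentiable at x" for x using Ckf[of "Suc 0" UNIV] by simp
  define \<Delta> where "\<Delta> = laplace_beltrami g f"
  define D where "D x = frechet_derivative f (at x) x" for x
  obtain R where R: "0 < R" "R < 1" "\<And>x. norm x > R \<Longrightarrow> f x = 0"
    using test_function_support[OF f] by blast
  have CkU: "Ck_on 1 (\<lambda>x. h (norm x)) U" if "Ck_on 1 h {0<..<1}" for h
  proof (rule Ck_on_compose_real[OF openU _ that])
    show "Ck_on 1 norm U" by (rule Ck_on_subset[OF Ck_on_norm]) (auto simp: U_def)
  qed (use U in auto)
  have contU: "continuous_on U (\<lambda>x. h (norm x))" if "Ck_on 1 h {0<..<1}" for h
    using Ck_on_continuous[OF CkU[OF that]] .
  have CkJ: "Ck_on k J {0<..<1}" for k by (rule Ck_on_subset[OF Ck_on_J]) auto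
  have cont_cutoff': "continuous_on U (\<lambda>x. cutoff' e (norm x))" for e
    unfolding cutoff'_def by (intro continuous_intros) (auto simp: U_def)
  have cont_powr: "continuous_on U (\<lambda>x. norm x powr \<beta>)"
    by (intro continuous_intros) (auto simp: U_def)
  have cont_f: "continuous_on U f" by (rule Ck_on_continuous[OF Ckf])
  have cont_D: "continuous_on U D"
    unfolding D_def vec_derivative_expand[OF fdiff]
    by (intro continuous_intros Ck_on_continuous[OF Ck_on_partial_deriv[OF Ckf]])
  have cont_\<Delta>: "continuous_on U \<Delta>"
    unfolding \<Delta>_def by (rule continuous_on_subset[OF continuous_on_laplace_beltrami[OF f2]]) (auto simp: U_def)
  note conts = contU[OF Ckw] contU[OF Ckv] contU[OF CkJ] cont_powr cont_f cont_D cont_\<Delta> cont_cutoff'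
  define A where "A x = indicator U x * (J (norm x) * ((w (norm x))\<^sup>2 * norm x powr \<beta> * (norm (f x))\<^sup>2))" for x
  define B where "B x = indicator U x * (J (norm x) * ((norm (\<Delta> x))\<^sup>2 / norm x powr \<beta>))" for x
  \<comment> \<open>The terms with the derivative of the cutoff, with absolute values so that they
    can stand under a nonnegative integral on the right.\<close>
  define E where "E e x = indicator U x * (cutoff' e (norm x) * J (norm x) *
    (w (norm x) / norm x * \<bar>f x \<bullet> D x\<bar> + v (norm x) * (norm (f x))\<^sup>2))" for e x
  have measU: "(\<lambda>x. indicator U x * h x) \<in> borel_measurable borel" if "continuous_on U h" for h :: "real^'n \<Rightarrow> real"
    using borel_measurable_continuous_on_indicator[OF _ that] openU by simp
  have [measurable]: "A \<in> borel_measurable borel" unfolding A_def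
    by (rule measU) (intro continuous_intros conts)
  have [measurable]: "B \<in> borel_measurable borel" unfolding B_def
    by (rule measU) (intro continuous_intros conts, auto simp: U_def)
  have [measurable]: "E e \<in> borel_measurable borel" for e unfolding E_def
    by (rule measU) (intro continuous_intros conts, auto simp: U_def)
  have A_nonneg: "A x \<ge> 0" for x
    using U J_pos by (auto simp: A_def less_imp_le split: split_indicator)
  have B_nonneg: "B x \<ge> 0" for x
    using U J_pos by (auto simp: B_def less_imp_le split: split_indicator)
  have E_nonneg: "E e x \<ge> 0" if "e > 0" for e x
    using U[of x] J_pos[of "norm x"] w_pos[of "norm x"] v_nonneg[of "norm x"] cutoff_bounds(3)[OF that, of "norm x"]
    by (auto simp: E_def less_imp_le split: split_indicator intro!: mult_nonneg_nonneg add_nonneg_nonneg divide_nonneg_nonneg)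

  have step: "(\<integral>\<^sup>+x. ennreal (K / 2 * (cutoff e (norm x) * A x)) \<partial>lborel)
      \<le> (\<integral>\<^sup>+x. ennreal (B x / (2 * K) + E e x) \<partial>lborel)" if e: "e > 0" for e
  proof -
    define h where "h r = cutoff e r * w r" for r
    \<comment> \<open>In \<open>wfield\<close> the flux already contains the density and the second
      coefficient multiplies the position vector; the factor J/r makes it the density times v along
      the unit radial vector.\<close>
    define k where "k r = cutoff e r * J r * v r / r" for r
    define Z where "Z = wfield h k f"
    have Z0: "Z i x = 0" if "norm x < e \<or> norm x > R" for i x
      using that R(3)[of x] by (auto simp: Z_def wfield_def h_def k_def cutoff_def)
    have CkZ: "Ck_on 1 (Z i) UNIV" for i
    proof -
      have cut1: "Ck_on 1 (cutoff e) {0<..<1}" by (rule Ck_on_subset[OF Ck_on_cutoff[OF e]]) auto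
      have id: "Ck_on 1 (\<lambda>r::real. r) {0<..<1}"
        by (rule Ck_on_bounded_linear[OF bounded_linear_ident]) auto
      have Ckh: "Ck_on 1 h {0<..<1}" unfolding h_def
        by (rule Ck_on_mult[OF _ cut1 Ckw]) simp
      have Ckk: "Ck_on 1 k {0<..<1}" unfolding k_def
        by (intro Ck_on_divide Ck_on_mult cut1 Ckv CkJ id) auto
      have flux1: "Ck_on 1 (flux f i) U"
        by (rule Ck_on_subset[OF Ck_on_flux[OF Ckf]]) (auto simp: U_def)
      have "Ck_on 1 (Z i) U"
        unfolding Z_def wfield_def
        by (intro Ck_on_add Ck_on_mult Ck_on_inner openU CkU[OF Ckh] CkU[OF Ckk] Ckf flux1
            Ck_on_bounded_linear[OF bounded_linear_vec_nth])
      moreover have "Ck_on 1 (Z i) (ball 0 e)"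
        by (subst Ck_on_cong[where g = "\<lambda>_. 0"]) (auto simp: Z0 intro: Ck_on_const)
      moreover have "Ck_on 1 (Z i) (- cball 0 R)"
        by (subst Ck_on_cong[where g = "\<lambda>_. 0"]) (auto simp: Z0 intro: Ck_on_const)
      \<comment> \<open>The field vanishes near the pole by the cutoff and outside radius R by the
        support of f, so regularity on the punctured ball extends to the whole space.\<close>
      ultimately have "Ck_on 1 (Z i) ((U \<union> ball 0 e) \<union> (- cball 0 R))"
        by (intro Ck_on_Un openU open_Un) auto
      moreover have "(U \<union> ball 0 e) \<union> (- cball 0 R) = UNIV"
        using R e by (auto simp: U_def not_less)
      ultimately show ?thesis by simp
    qed
    define d where "d x = (\<Sum>i\<in>UNIV. frechet_derivative (Z i) (at x) (axis i 1))" for x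
    have int: "integrable lborel (\<lambda>x. frechet_derivative (Z i) (at x) (axis i 1))"
      "(\<integral>x. frechet_derivative (Z i) (at x) (axis i 1) \<partial>lborel) = 0" for i
      using integral_partial_derivative_eq_0[OF CkZ, where R = R and b = "axis i 1"] Z0 by auto
    have d: "integrable lborel d" "integral\<^sup>L lborel d = 0"
      unfolding d_def using int by (auto simp: Bochner_Integration.integral_sum)
    have d0: "d x = 0" if "x \<notin> U" for x
    proof -
      have "frechet_derivative (Z i) (at x) = frechet_derivative (\<lambda>_. 0) (at x)" for i
        using that e R by (intro frechet_derivative_cong_open[of "ball 0 e \<union> - cball 0 R"])
          (auto simp: U_def Z0)
      then show ?thesis by (simp add: d_def)
    qed
    have le: "K / 2 * (cutoff e (norm x) * A x) \<le> d x + (B x / (2 * K) + E e x)" for x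
    proof (cases "x \<in> U")
      case False
      then show ?thesis using d0[OF False] by (simp add: A_def B_def E_def)
    next
      case xU: True
      define r where "r = norm x"
      have r: "r \<in> {0<..<1}" "r > 0" using U[OF xU] by (auto simp: r_def)
      let ?c = "cutoff e r" and ?c' = "cutoff' e r"
      note cb = cutoff_bounds[OF e r(2)]
      define m where "m = (real CARD('n) - 1) * (\<psi>1 r / \<psi> r - 1 / r)"
      define X where "X = f x \<bullet> D x"
      define F where "F = f x \<bullet> f x"
      define G where "G = (\<Sum>i\<in>UNIV. partial_deriv i f x \<bullet> flux f i x)"
      have F: "F = (norm (f x))\<^sup>2" "F \<ge> 0" by (simp_all add: F_def power2_norm_eq_inner)
      have dh: "(h has_real_derivative (?c' * w r + ?c * w' r)) (at r)"
        unfolding h_def using cutoff_deriv[OF e r(2)] dw[OF r(1)]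
        by (auto intro!: derivative_eq_intros)
      have dk: "(k has_real_derivative (J r / r * (?c' * v r + ?c * (m * v r + v' r - v r / r)))) (at r)"
        unfolding k_def using cutoff_deriv[OF e r(2)] dv[OF r(1)] J_deriv[OF r(2), folded m_def] r(2)
        by (auto intro!: derivative_eq_intros simp: field_simps)
      have "d x = (?c' * w r + ?c * w' r) / r * J r * X + h r * G + h r * J r * (f x \<bullet> \<Delta> x)
        + (r * (J r / r * (?c' * v r + ?c * (m * v r + v' r - v r / r))) + real CARD('n) * k r) * F + 2 * k r * X"
        unfolding d_def Z_def r_def X_def F_def G_def D_def \<Delta>_def
        by (rule divergence_wfield[OF f2 U(4)[OF xU] dh[unfolded r_def] dk[unfolded r_def]])
      also have "\<dots> = ?c * w r * G + ?c * J r * ((w' r + 2 * v r) / r * X + w r * (f x \<bullet> \<Delta> x)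
         + (v' r + (m + (real CARD('n) - 1) / r) * v r) * F) + ?c' * J r * (w r / r * X + v r * F)"
        using r(2) by (simp add: h_def k_def field_simps)
      finally have dx: "d x = \<dots>" .
      have "J r * (norm (D x) / r)\<^sup>2 \<le> G"
        using sum_partial_flux_ge[OF U(4)[OF xU] fdiff] by (simp add: G_def D_def r_def)
      then have G: "?c * w r * (J r * (norm (D x) / r)\<^sup>2) \<le> ?c * w r * G"
        using cb w_pos[OF r(1)] by (intro mult_left_mono) auto
      \<comment> \<open>The logarithmic derivative of the density plus the Euclidean (N - 1)/r is
        the Laplacian of the distance. This is where the comparison with flat space enters.\<close>
      have "m + (real CARD('n) - 1) / r = (real CARD('n) - 1) * (\<psi>1 r / \<psi> r)"
        by (simp add: m_def right_diff_distrib)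
      moreover have "1 / r \<le> \<psi>1 r / \<psi> r"
        using mono[OF r(2)] psi_pos[OF r(2)] r by (simp add: field_simps)
      then have "(real CARD('n) - 1) * (1 / r) \<le> (real CARD('n) - 1) * (\<psi>1 r / \<psi> r)"
        by (rule mult_left_mono) (simp add: Suc_leI)
      ultimately have m: "(real CARD('n) - 1) * (1 / r) \<le> m + (real CARD('n) - 1) / r"
        by (simp only:)
      have "v' r + (real CARD('n) - 1) * v r / r \<le> v' r + (m + (real CARD('n) - 1) / r) * v r"
        using mult_right_mono[OF m v_nonneg[OF r(1)]] by simp
      then have hyp: "K * (w r)\<^sup>2 * r powr \<beta> \<le>
          (v' r + (m + (real CARD('n) - 1) / r) * v r) - (w' r + 2 * v r)\<^sup>2 / (4 * w r)"
        using riccati[OF r(1)] by linarith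
      have "K / 2 * ((w r)\<^sup>2 * r powr \<beta> * (norm (f x))\<^sup>2) - (norm (\<Delta> x))\<^sup>2 / r powr \<beta> / (2 * K)
        \<le> w r * (norm (D x) / r)\<^sup>2 + (w' r + 2 * v r) / r * (f x \<bullet> D x) + w r * (f x \<bullet> \<Delta> x)
          + (v' r + (m + (real CARD('n) - 1) / r) * v r) * (norm (f x))\<^sup>2"
        using r(2) by (intro rellich_pointwise[OF w_pos[OF r(1)] r(2) K _ hyp]) simp
      then have "?c * J r * (K / 2 * ((w r)\<^sup>2 * r powr \<beta> * F) - (norm (\<Delta> x))\<^sup>2 / r powr \<beta> / (2 * K))
        \<le> ?c * J r * (w r * (norm (D x) / r)\<^sup>2 + (w' r + 2 * v r) / r * X + w r * (f x \<bullet> \<Delta> x)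
          + (v' r + (m + (real CARD('n) - 1) / r) * v r) * F)"
        unfolding F(1) X_def using cb J_pos[OF r(2)] by (intro mult_left_mono) auto
      also have "\<dots> \<le> d x - ?c' * J r * (w r / r * X + v r * F)"
        unfolding dx using G by (simp add: algebra_simps)
      also have "\<dots> \<le> d x + E e x"
      proof -
        have "- (w r / r * \<bar>X\<bar> + v r * F) \<le> w r / r * X + v r * F"
        proof -
          have "w r / r * (- \<bar>X\<bar>) \<le> w r / r * X"
            using w_pos[OF r(1)] r(2) by (intro mult_left_mono) auto
          moreover have "0 \<le> v r * F" using v_nonneg[OF r(1)] F(2) by simp
          ultimately show ?thesis by linarith
        qed
        then have "?c' * J r * (- (w r / r * \<bar>X\<bar> + v r * F)) \<le> ?c' * J r * (w r / r * X + v r * F)"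
          using cb J_pos[OF r(2)] by (intro mult_left_mono) auto
        moreover have "E e x = ?c' * J r * (w r / r * \<bar>X\<bar> + v r * F)"
          using xU by (simp add: E_def F(1) X_def r_def)
        moreover have "a - q \<le> a + b" if "- p \<le> q" "b = p" for a b p q :: real
          using that by simp
        ultimately show ?thesis unfolding mult_minus_right by blast
      qed
      finally have *: "?c * J r * (K / 2 * ((w r)\<^sup>2 * r powr \<beta> * F) - (norm (\<Delta> x))\<^sup>2 / r powr \<beta> / (2 * K))
        \<le> d x + E e x" .
      have "K / 2 * (?c * A x) = ?c * J r * (K / 2 * ((w r)\<^sup>2 * r powr \<beta> * F))"
        using xU by (simp add: A_def F(1) r_def)
      moreover have "?c * (B x / (2 * K)) = ?c * J r * ((norm (\<Delta> x))\<^sup>2 / r powr \<beta> / (2 * K))"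
        using xU by (simp add: B_def r_def)
      \<comment> \<open>On the side of the Laplacian the cutoff can be discarded at once, because
        \<open>B\<close> is nonnegative; on the side of \<open>A\<close> it has to stay until the
        limit.\<close>
      moreover have "?c * (B x / (2 * K)) \<le> 1 * (B x / (2 * K))"
        using cb B_nonneg[of x] K by (intro mult_right_mono) auto
      moreover have "a \<le> y + (b + z)" if "c * (p - q) \<le> y + z" "a = c * p" "b' = c * q" "b' \<le> 1 * b"
        for a b b' c p q y z :: real
        using that by (simp add: right_diff_distrib)
      ultimately show ?thesis using * unfolding r_def by blast
    qed
    have [measurable]: "cutoff e \<in> borel_measurable borel"
      unfolding cutoff_def by measurable
    show ?thesis
    proof (rule nn_integral_le_if_integral_eq_0[OF _ _ d _ _ le])
      show "0 \<le> K / 2 * (cutoff e (norm x) * A x)" for x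
        using K A_nonneg cutoff_bounds(1)[OF e, of "norm x"] by (cases "x = 0") (auto simp: A_def U_def)
      show "0 \<le> B x / (2 * K) + E e x" for x
        using K B_nonneg E_nonneg[OF e] by (simp add: add_nonneg_nonneg)
    qed measurable
  qed

  have E0: "(\<lambda>n. \<integral>\<^sup>+x. ennreal (E (1 / real (Suc n)) x) \<partial>lborel) \<longlonglongrightarrow> (\<integral>\<^sup>+x. 0 \<partial>(lborel :: (real^'n) measure))"
  proof -
    obtain C1 where C1: "\<And>r. r \<in> {0<..1} \<Longrightarrow> J r \<le> C1" using J_bounded by blast
    have "R \<in> {0<..<1}" using R by simp
    from bound[OF this]
    obtain C2 where C2: "\<And>r. r \<in> {0<..R} \<Longrightarrow> w r \<le> C2 * r powr (- 2 - \<beta>) \<and> v r \<le> C2 * r powr (- 3 - \<beta>)"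
      by blast
    obtain C3 where C3: "\<And>x. x \<in> ball 0 1 \<Longrightarrow> norm (D x) \<le> C3 * norm x"
      using frechet_derivative_at_self_le[OF Ckf[of 1 UNIV]] unfolding D_def by blast
    obtain C4 where C4: "\<And>x. x \<in> cball 0 1 \<Longrightarrow> norm (f x) \<le> C4"
      using continuous_bounded_on_compact[OF Ck_on_continuous[OF Ckf] compact_cball] by blast
    define C where "C = 4 * C1 * (C2 * (C4 * C3) + C2 * C4\<^sup>2)"
    have E_le: "E e x \<le> indicator (ball 0 1) x * (C * norm x powr - (\<beta> + 4))" if e: "e > 0" for e x
    proof (cases "x \<in> U \<and> norm x \<le> R")
      case False
      have "C \<ge> 0"
      proof -
        \<comment> \<open>The signs of the constants are read off from their own bounds, at radius R
          / 2 or, for \<open>C4\<close>, at the pole.\<close>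
        let ?y = "(R / 2) *\<^sub>R axis undefined (1::real) :: real^'n"
        have y: "norm ?y = R / 2" "?y \<in> ball 0 1" using R by auto
        have "0 \<le> C1" using C1[of "R/2"] J_pos[of "R/2"] R by auto
        moreover have "0 \<le> C2"
        proof -
          have "0 < C2 * (R / 2) powr (- 2 - \<beta>)"
            using C2[of "R/2"] w_pos[of "R/2"] R by auto
          then show ?thesis using R by (simp add: zero_less_mult_iff)
        qed
        moreover have "0 \<le> C3"
          using order_trans[OF norm_ge_zero C3[OF y(2)]] y R by (simp add: zero_le_mult_iff)
        moreover have "0 \<le> C4" using order_trans[OF norm_ge_zero C4[of 0]] by simp
        ultimately show ?thesis by (simp add: C_def)
      qed
      then show ?thesis using False R(3)[of x] by (auto simp: E_def split: split_indicator)
    next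
      case True
      define r where "r = norm x"
      have r: "r \<in> {0<..R}" "r > 0" "r \<in> {0<..<1}" "r \<in> {0<..1}" "r < 1" "x \<in> ball 0 1"
        using True U[of x] by (auto simp: r_def)
      note w_pos = w_pos[OF r(3)] and v_nonneg = v_nonneg[OF r(3)]
      have "\<bar>f x \<bullet> D x\<bar> \<le> norm (f x) * norm (D x)" by (rule Cauchy_Schwarz_ineq2)
      also have "\<dots> \<le> C4 * (C3 * r)"
        using C3[OF r(6)] C4[of x] r(6) by (intro mult_mono) (auto simp: r_def intro: order_trans[OF norm_ge_zero])
      finally have X: "\<bar>f x \<bullet> D x\<bar> \<le> C4 * C3 * r" by simp
      have "w r / r * \<bar>f x \<bullet> D x\<bar> \<le> w r / r * (C4 * C3 * r)"
        using X w_pos r by (intro mult_left_mono) auto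
      also have "\<dots> = w r * (C4 * C3)" using r by simp
      also have "\<dots> \<le> (C2 * r powr (- 3 - \<beta>)) * (C4 * C3)"
      proof (rule mult_right_mono)
        have "w r \<le> C2 * r powr (- 2 - \<beta>)" using C2[OF r(1)] by simp
        moreover have "C2 \<ge> 0"
          using calculation w_pos r(2) by (metis less_le_trans less_imp_le powr_gt_zero zero_less_mult_pos2 less_numeral_extra(3))
        moreover have "r powr (- 2 - \<beta>) \<le> r powr (- 3 - \<beta>)"
          using r by (intro powr_mono') auto
        ultimately show "w r \<le> C2 * r powr (- 3 - \<beta>)"
          by (meson mult_left_mono order_trans)
        have "0 \<le> C4 * C3 * r" using X by linarith
        then show "0 \<le> C4 * C3" using r by (simp add: zero_le_mult_iff)
      qed
      finally have 1: "w r / r * \<bar>f x \<bullet> D x\<bar> \<le> (C2 * (C4 * C3)) * r powr (- 3 - \<beta>)"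
        by (simp add: mult_ac)
      have "(norm (f x))\<^sup>2 \<le> C4\<^sup>2" using C4[of x] r by (intro power_mono) auto
      then have "v r * (norm (f x))\<^sup>2 \<le> (C2 * r powr (- 3 - \<beta>)) * C4\<^sup>2"
        using C2[OF r(1)] v_nonneg by (intro mult_mono) auto
      with 1 have 2: "w r / r * \<bar>f x \<bullet> D x\<bar> + v r * (norm (f x))\<^sup>2 \<le> (C2 * (C4 * C3) + C2 * C4\<^sup>2) * r powr (- 3 - \<beta>)"
        by (simp add: algebra_simps)
      have "E e x = cutoff' e r * J r * (w r / r * \<bar>f x \<bullet> D x\<bar> + v r * (norm (f x))\<^sup>2)"
        using True by (simp add: E_def r_def)
      also have "\<dots> \<le> (4 / r * C1) * ((C2 * (C4 * C3) + C2 * C4\<^sup>2) * r powr (- 3 - \<beta>))"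
        using cutoff_bounds(3,4)[OF e r(2)] C1[OF r(4)] J_pos[OF r(2)] 2 w_pos v_nonneg r
        by (intro mult_mono) auto
      also have "\<dots> = C * r powr - (\<beta> + 4)"
      proof -
        have "r powr - (\<beta> + 4) = r powr (- 3 - \<beta>) / r"
        proof -
          have "- (\<beta> + 4) = (- 3 - \<beta>) - 1" by simp
          then show ?thesis using r powr_diff[of r "- 3 - \<beta>" 1] by (simp only: powr_one)
        qed
        then show ?thesis by (simp add: C_def)
      qed
      finally show ?thesis using r by (simp add: r_def)
    qed
    have [measurable]: "(ball 0 1 :: (real^'n) set) \<in> sets borel" by simp
    have "(\<lambda>r::real. r powr - (\<beta> + 4)) \<in> borel_measurable borel" by measurable
    from measurable_compose[OF borel_measurable_norm this]
    have [measurable]: "(\<lambda>x::real^'n. norm x powr - (\<beta> + 4)) \<in> borel_measurable borel" .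
    show ?thesis
    proof (rule nn_integral_dominated_convergence[where w = "\<lambda>x. ennreal (indicator (ball 0 1) x * (C * norm x powr - (\<beta> + 4)))"])
      show "AE x in lborel. ennreal (E (1 / real (Suc n)) x) \<le> ennreal (indicator (ball 0 1) x * (C * norm x powr - (\<beta> + 4)))" for n
        using E_le by (intro AE_I2 ennreal_leI) auto
      have "(\<integral>\<^sup>+(x::real^'n). ennreal (indicator (ball 0 1) x * (C * norm x powr - (\<beta> + 4))) \<partial>lborel)
        \<le> (\<integral>\<^sup>+(x::real^'n). ennreal \<bar>C\<bar> * ennreal (indicator (ball 0 1) x * norm x powr - (\<beta> + 4)) \<partial>lborel)"
        by (intro nn_integral_mono) (auto simp: ennreal_mult'[symmetric] intro!: ennreal_leI mult_right_mono split: split_indicator)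
      also have "\<dots> = ennreal \<bar>C\<bar> * (\<integral>\<^sup>+(x::real^'n). ennreal (indicator (ball 0 1) x * norm x powr - (\<beta> + 4)) \<partial>lborel)"
        by (rule nn_integral_cmult) measurable
      also have "\<dots> < \<infinity>"
        using nn_integral_norm_powr_finite[of "\<beta> + 4", where 'a = "real^'n"] \<beta>
        by (simp add: ennreal_mult_less_top)
      finally show "(\<integral>\<^sup>+(x::real^'n). ennreal (indicator (ball 0 1) x * (C * norm x powr - (\<beta> + 4))) \<partial>lborel) < \<infinity>" .
      have "(\<lambda>n. E (1 / real (Suc n)) x) \<longlonglongrightarrow> 0" for x
      proof (cases "x \<in> U")
        case True
        have "(\<lambda>n. E (1 / real (Suc n)) x) \<longlonglongrightarrow> indicator U x * (0 * J (norm x) *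
          (w (norm x) / norm x * \<bar>f x \<bullet> D x\<bar> + v (norm x) * (norm (f x))\<^sup>2))"
          unfolding E_def by (intro tendsto_intros cutoff_tendsto(2) U(2) True)
        then show ?thesis by simp
      qed (simp add: E_def)
      then show "AE x in lborel. (\<lambda>n. ennreal (E (1 / real (Suc n)) x)) \<longlonglongrightarrow> 0"
        by (intro AE_I2) (metis tendsto_ennrealI ennreal_0)
    qed measurable
  qed

  have "(\<integral>\<^sup>+x. ennreal (K / 2 * A x) \<partial>lborel) \<le> (\<integral>\<^sup>+x. ennreal (B x / (2 * K)) \<partial>lborel)"
  proof -
    have "(\<lambda>n. ennreal (K / 2 * (cutoff (1 / real (Suc n)) (norm x) * A x))) \<longlonglongrightarrow> ennreal (K / 2 * A x)" for x
    proof (cases "x \<in> U")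
      case True
      have "(\<lambda>n. K / 2 * (cutoff (1 / real (Suc n)) (norm x) * A x)) \<longlonglongrightarrow> K / 2 * (1 * A x)"
        by (intro tendsto_intros cutoff_tendsto(1) U(2) True)
      then show ?thesis by (intro tendsto_ennrealI) simp
    qed (simp add: A_def)
    then have "(\<integral>\<^sup>+x. ennreal (K / 2 * A x) \<partial>lborel) =
      (\<integral>\<^sup>+x. liminf (\<lambda>n. ennreal (K / 2 * (cutoff (1 / real (Suc n)) (norm x) * A x))) \<partial>lborel)"
      by (intro nn_integral_cong) (metis lim_imp_Liminf sequentially_bot)
    \<comment> \<open>Fatou rather than dominated convergence: nothing yet shows that
      \<open>A\<close> is integrable.\<close>
    also have "\<dots> \<le> liminf (\<lambda>n. \<integral>\<^sup>+x. ennreal (K / 2 * (cutoff (1 / real (Suc n)) (norm x) * A x)) \<partial>lborel)"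
      by (rule nn_integral_liminf) (unfold cutoff_def, measurable)
    also have "\<dots> \<le> liminf (\<lambda>n. (\<integral>\<^sup>+x. ennreal (B x / (2 * K)) \<partial>lborel) + (\<integral>\<^sup>+x. ennreal (E (1 / real (Suc n)) x) \<partial>lborel))"
    proof (rule Liminf_mono, intro always_eventually allI)
      fix n
      have e: "1 / real (Suc n) > 0" by simp
      show "(\<integral>\<^sup>+x. ennreal (K / 2 * (cutoff (1 / real (Suc n)) (norm x) * A x)) \<partial>lborel)
        \<le> (\<integral>\<^sup>+x. ennreal (B x / (2 * K)) \<partial>lborel) + (\<integral>\<^sup>+x. ennreal (E (1 / real (Suc n)) x) \<partial>lborel)"
        using step[OF e] B_nonneg E_nonneg[OF e] K by (simp add: nn_integral_add[symmetric])
    qed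
    also have "\<dots> = (\<integral>\<^sup>+x. ennreal (B x / (2 * K)) \<partial>lborel)"
      using tendsto_add[OF tendsto_const E0] by (intro lim_imp_Liminf) auto
    finally show ?thesis .
  qed
  \<comment> \<open>The factor 2 K clears the halves left by AM-GM: K/2 becomes K^2, and 1/(2K)
    becomes 1.\<close>
  then have "ennreal (2 * K) * (\<integral>\<^sup>+x. ennreal (K / 2 * A x) \<partial>lborel) \<le> ennreal (2 * K) * (\<integral>\<^sup>+x. ennreal (B x / (2 * K)) \<partial>lborel)"
    by (rule mult_left_mono) simp
  moreover have cmult: "ennreal c * (\<integral>\<^sup>+x. ennreal (h x) \<partial>lborel) = (\<integral>\<^sup>+x. ennreal (c * h x) \<partial>lborel)"
    if "0 \<le> c" "h \<in> borel_measurable borel" for c and h :: "real^'n \<Rightarrow> real"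
    using that by (subst nn_integral_cmult[symmetric]) (auto simp: ennreal_mult')
  moreover have "ennreal (2 * K) * (\<integral>\<^sup>+x. ennreal (K / 2 * A x) \<partial>lborel) = ennreal (K\<^sup>2) * (\<integral>\<^sup>+x. ennreal (A x) \<partial>lborel)"
    using K by (simp add: cmult power2_eq_square mult.assoc)
  moreover have "ennreal (2 * K) * (\<integral>\<^sup>+x. ennreal (B x / (2 * K)) \<partial>lborel) = (\<integral>\<^sup>+x. ennreal (B x) \<partial>lborel)"
    using K by (simp add: cmult)
  moreover have "(\<integral>\<^sup>+x. ennreal (A x) \<partial>lborel) =
      (\<integral>\<^sup>+x\<in>ball 0 1. ennreal (J (norm x) * ((w (norm x))\<^sup>2 * norm x powr \<beta> * (norm (f x))\<^sup>2)) \<partial>lborel)"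
    using AE_lborel_singleton[of "0 :: real^'n"]
    by (intro nn_integral_cong_AE) (auto elim!: eventually_mono simp: A_def U_def split: split_indicator)
  moreover have "(\<integral>\<^sup>+x. ennreal (B x) \<partial>lborel) =
      (\<integral>\<^sup>+x\<in>ball 0 1. ennreal (J (norm x) * ((norm (laplace_beltrami g f x))\<^sup>2 / norm x powr \<beta>)) \<partial>lborel)"
    using AE_lborel_singleton[of "0 :: real^'n"]
    by (intro nn_integral_cong_AE) (auto elim!: eventually_mono simp: B_def \<Delta>_def U_def split: split_indicator)
  ultimately show ?thesis by simp
qed

end

section \<open>Explicit weights and their Riccati inequality\<close>

lemma powr_eq_mult:
  fixes r a d a' :: real
  assumes "a + d = a'"
  shows "r powr a' = r powr a * r powr d"
  using assms powr_add by metis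

text \<open>The weights come from the ground state \<open>r powr (- c / 2) * (1 - r powr c)\<close> of the one-dimensional
  Hardy operator with weight \<open>w r = r powr (- 2 - \<beta>) / (1 - r powr c)\<close>; in terms of
  \<open>u = 1 / (1 - r powr c)\<close> the Riccati inequality is polynomial.\<close>

definition uw :: "real \<Rightarrow> real \<Rightarrow> real" where
  "uw c r = 1 / (1 - r powr c)"

definition w_rellich :: "real \<Rightarrow> real \<Rightarrow> real \<Rightarrow> real" where
  "w_rellich c b r = r powr - b * uw c r"

text \<open>The solution v of w' + 2 v = - 2 w \<phi>'/\<phi> for the ground state \<phi>, so that
  the square completed in the radial derivative vanishes on \<phi>. Here \<phi>'/\<phi> = - c (2 u -
  1) / (2 r), and inserting w' leaves u (b + c u) / 2 times the power of r.\<close>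

definition v_rellich :: "real \<Rightarrow> real \<Rightarrow> real \<Rightarrow> real" where
  "v_rellich c b r = r powr (- b - 1) * (uw c r * (b + c * uw c r) / 2)"

lemma uw_ge_1:
  assumes "c > 0" "r \<in> {0<..<1}"
  shows "uw c r \<ge> 1" "1 - r powr c > 0"
proof -
  have "r powr c < 1" using assms powr_less_mono2[of c r 1] by simp
  then show "uw c r \<ge> 1" "1 - r powr c > 0" by (auto simp: uw_def)
qed

lemma uw_mono:
  assumes "c > 0" "r \<in> {0<..R}" "R \<in> {0<..<1}"
  shows "uw c r \<le> uw c R"
proof -
  have "r powr c \<le> R powr c" using assms by (intro powr_mono2) auto
  then show ?thesis
    using uw_ge_1(2)[of c r] uw_ge_1(2)[of c R] assms unfolding uw_def by (intro divide_left_mono) auto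
qed

lemma uw_deriv:
  assumes "c > 0" "r \<in> {0<..<1}"
  shows "(uw c has_real_derivative c / r * uw c r * (uw c r - 1)) (at r)"
proof -
  have p: "1 - r powr c > 0" by (rule uw_ge_1(2)[OF assms])
  have "(uw c has_real_derivative (c * r powr (c - 1)) / (1 - r powr c)\<^sup>2) (at r)"
    unfolding uw_def using assms p
    by (auto intro!: derivative_eq_intros simp: power2_eq_square field_simps)
  also have "c * r powr (c - 1) = c / r * r powr c"
    using assms by (simp add: powr_diff)
  also have "(c / r * r powr c) / (1 - r powr c)\<^sup>2 = c / r * uw c r * (uw c r - 1)"
    using p by (simp add: uw_def power2_eq_square field_simps)
  finally show ?thesis .
qed

lemma Ck_on_uw: "c > 0 \<Longrightarrow> Ck_on k (uw c) {0<..<1}"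
  unfolding uw_def
  by (intro Ck_on_divide Ck_on_diff Ck_on_const Ck_on_subset[OF Ck_on_powr]) (auto dest: uw_ge_1(2)[of c])

lemma Ck_on_rellich:
  assumes "c > 0"
  shows "Ck_on k (w_rellich c b) {0<..<1}" "Ck_on k (v_rellich c b) {0<..<1}"
proof -
  have p: "Ck_on k (\<lambda>r::real. r powr a) {0<..<1}" for a
    by (rule Ck_on_subset[OF Ck_on_powr]) auto
  show "Ck_on k (w_rellich c b) {0<..<1}" "Ck_on k (v_rellich c b) {0<..<1}"
    unfolding w_rellich_def v_rellich_def
    by (intro Ck_on_mult Ck_on_divide Ck_on_add Ck_on_const p Ck_on_uw assms; simp)+
qed

lemma w_rellich_deriv:
  assumes "c > 0" "r \<in> {0<..<1}"
  shows "(w_rellich c b has_real_derivative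
    r powr (- b - 1) * (- b * uw c r + c * uw c r * (uw c r - 1))) (at r)"
proof -
  have "((\<lambda>r. r powr - b) has_real_derivative - b * r powr (- b - 1)) (at r)"
    using assms by (auto intro!: derivative_eq_intros)
  from DERIV_mult[OF this uw_deriv[OF assms]]
  have "(w_rellich c b has_real_derivative
    - b * r powr (- b - 1) * uw c r + c / r * uw c r * (uw c r - 1) * r powr - b) (at r)"
    by (simp add: w_rellich_def[abs_def])
  also have "r powr - b = r * r powr (- b - 1)"
    using assms by (simp add: powr_diff)
  also have "- b * r powr (- b - 1) * uw c r + c / r * uw c r * (uw c r - 1) * (r * r powr (- b - 1))
      = r powr (- b - 1) * (- b * uw c r + c * uw c r * (uw c r - 1))"
    using assms by (simp add: field_simps)
  finally show ?thesis .
qed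

lemma v_rellich_deriv:
  assumes "c > 0" "r \<in> {0<..<1}"
  shows "(v_rellich c b has_real_derivative
    r powr (- b - 2) * (uw c r * ((c * (uw c r - 1) * (b + 2 * c * uw c r) - (b + 1) * (b + c * uw c r)) / 2))) (at r)"
proof -
  have 1: "((\<lambda>r. r powr (- b - 1)) has_real_derivative (- b - 1) * r powr (- b - 2)) (at r)"
  proof -
    have "- b - 1 - 1 = - b - 2" by simp
    then show ?thesis using assms has_real_derivative_powr[of r "- b - 1"] by (simp only: greaterThanLessThan_iff)
  qed
  define d where "d = c / r * uw c r * (uw c r - 1)"
  have 2: "((\<lambda>r. uw c r * (b + c * uw c r) / 2) has_real_derivative d * (b + 2 * c * uw c r) / 2) (at r)"
    using uw_deriv[OF assms, folded d_def] by (auto intro!: derivative_eq_intros simp: algebra_simps)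
  from DERIV_mult[OF 1 2]
  have "(v_rellich c b has_real_derivative
    (- b - 1) * r powr (- b - 2) * (uw c r * (b + c * uw c r) / 2)
      + d * (b + 2 * c * uw c r) / 2 * r powr (- b - 1)) (at r)"
    by (simp add: v_rellich_def[abs_def])
  also have "r powr (- b - 1) = r * r powr (- b - 2)"
    using assms powr_eq_mult[of 1 "- b - 2" "- b - 1" r] by simp
  also have "(- b - 1) * r powr (- b - 2) * (uw c r * (b + c * uw c r) / 2)
      + d * (b + 2 * c * uw c r) / 2 * (r * r powr (- b - 2)) =
    r powr (- b - 2) * (uw c r * ((c * (uw c r - 1) * (b + 2 * c * uw c r) - (b + 1) * (b + c * uw c r)) / 2))"
    using assms unfolding d_def by (simp add: field_simps)
  finally show ?thesis .
qed

text \<open>The terms quadratic in u cancel, and four times the difference of the two sides is (c +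
  2 b)(N - 2 - b - c) + c (N - 2 - b)(u - 1). It vanishes only for c = N - 2 - b and u = 1, the
  value approached at the pole.\<close>

lemma rellich_polynomial:
  fixes N b c u :: real
  assumes "c > 0" "b \<ge> 2" "c \<le> N - 2 - b" "u \<ge> 1"
  shows "(N - 2 + b) / 4 * c * u \<le>
    (c * (u - 1) * (b + 2 * c * u) - (b + 1) * (b + c * u)) / 2 + (N - 1) * (b + c * u) / 2 - (2 * c * u - c)\<^sup>2 / 4"
proof -
  have "0 \<le> (c + 2 * b) * (N - 2 - b - c)" using assms by simp
  moreover have "0 \<le> c * (N - 2 - b) * (u - 1)" using assms by simp
  ultimately have "0 \<le> (c + 2 * b) * (N - 2 - b - c) + c * (N - 2 - b) * (u - 1)" by linarith
  also have "\<dots> = 4 * ((c * (u - 1) * (b + 2 * c * u) - (b + 1) * (b + c * u)) / 2 + (N - 1) * (b + c * u) / 2 - (2 * c * u - c)\<^sup>2 / 4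
     - (N - 2 + b) / 4 * c * u)"
    by (simp add: power2_eq_square field_simps)
  finally have "0 \<le> 4 * ((c * (u - 1) * (b + 2 * c * u) - (b + 1) * (b + c * u)) / 2 + (N - 1) * (b + c * u) / 2 - (2 * c * u - c)\<^sup>2 / 4
     - (N - 2 + b) / 4 * c * u)" .
  moreover have "a \<le> b" if "0 \<le> 4 * (b - a)" for a b :: real using that by simp
  ultimately show ?thesis by blast
qed

text \<open>With p = r^(-b-2) and b = 2 + \<beta>, one has w^2 r^\<beta> = p u^2, and every other
  term carries the factor p u as well; dividing it out leaves the polynomial inequality in
  u.\<close>

lemma rellich_riccati:
  assumes "c > 0" "\<beta> \<ge> 0" "c \<le> N - 4 - \<beta>" "r \<in> {0<..<1}"
  defines "b \<equiv> 2 + \<beta>"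
  defines "u \<equiv> uw c r"
  shows "(N + \<beta>) / 4 * c * (w_rellich c b r)\<^sup>2 * r powr \<beta> \<le>
    r powr (- b - 2) * (u * ((c * (u - 1) * (b + 2 * c * u) - (b + 1) * (b + c * u)) / 2))
    + (N - 1) * v_rellich c b r / r
    - (r powr (- b - 1) * (- b * u + c * u * (u - 1)) + 2 * v_rellich c b r)\<^sup>2 / (4 * w_rellich c b r)"
proof -
  define p where "p = r powr (- b - 2)"
  have r: "r > 0" and p: "p > 0" using assms by (auto simp: p_def)
  have u: "u \<ge> 1" unfolding u_def by (rule uw_ge_1(1)[OF assms(1,4)])
  have p1: "r powr (- b - 1) = p * r" using r powr_eq_mult[of 1 "- b - 2" "- b - 1" r] by (simp add: p_def)
  have p2: "r powr (- b) = p * r\<^sup>2"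
    using r powr_eq_mult[of 2 "- b - 2" "- b" r] by (simp add: p_def)
  have w: "w_rellich c b r = p * r\<^sup>2 * u" by (simp add: w_rellich_def p2 u_def)
  have v: "v_rellich c b r = p * r * (u * (b + c * u) / 2)" by (simp add: v_rellich_def p1 u_def)
  have "(w_rellich c b r)\<^sup>2 * r powr \<beta> = (r powr (- b) * r powr (- b) * r powr \<beta>) * u\<^sup>2"
    by (simp add: w_rellich_def u_def power2_eq_square)
  also have "r powr (- b) * r powr (- b) * r powr \<beta> = p"
    unfolding p_def powr_add[symmetric] by (rule arg_cong[where f = "\<lambda>a. r powr a"]) (simp add: b_def)
  finally have ww: "(w_rellich c b r)\<^sup>2 * r powr \<beta> = p * u\<^sup>2" .
  have "p * r * (- b * u + c * u * (u - 1)) + 2 * (p * r * (u * (b + c * u) / 2)) = p * r * u * (2 * c * u - c)"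
    by (simp add: algebra_simps add_divide_distrib)
  then have "(p * r * (- b * u + c * u * (u - 1)) + 2 * (p * r * (u * (b + c * u) / 2)))\<^sup>2 / (4 * (p * r\<^sup>2 * u))
      = (p * r * u * (2 * c * u - c))\<^sup>2 / (4 * (p * r\<^sup>2 * u))"
    by (simp only:)
  also have "\<dots> = p * u * ((2 * c * u - c)\<^sup>2 / 4)"
    using r p u by (simp add: power_mult_distrib power2_eq_square)
  finally have sq: "(p * r * (- b * u + c * u * (u - 1)) + 2 * (p * r * (u * (b + c * u) / 2)))\<^sup>2 / (4 * (p * r\<^sup>2 * u))
    = p * u * ((2 * c * u - c)\<^sup>2 / 4)" .
  define X Y Z where "X = (c * (u - 1) * (b + 2 * c * u) - (b + 1) * (b + c * u)) / 2"
    and "Y = (N - 1) * (b + c * u) / 2" and "Z = (2 * c * u - c)\<^sup>2 / 4"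
  have "(N + \<beta>) / 4 * c * (w_rellich c b r)\<^sup>2 * r powr \<beta> = (N + \<beta>) / 4 * c * (p * u\<^sup>2)"
    using ww by (simp only: mult.assoc)
  also have "\<dots> = p * u * ((N - 2 + b) / 4 * c * u)"
    by (simp add: b_def power2_eq_square)
  also have "\<dots> \<le> p * u * (X + Y - Z)"
    unfolding X_def Y_def Z_def
    using p u assms(1,2,3) by (intro mult_left_mono rellich_polynomial) (auto simp: b_def)
  also have "\<dots> = p * (u * X) + p * u * Y - p * u * Z"
    by (simp only: right_diff_distrib distrib_left mult.assoc)
  also have "p * u * Y = (N - 1) * v_rellich c b r / r"
    using r by (simp add: v Y_def)
  also have "p * u * Z = (r powr (- b - 1) * (- b * u + c * u * (u - 1)) + 2 * v_rellich c b r)\<^sup>2 / (4 * w_rellich c b r)"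
    unfolding w v p1 sq Z_def ..
  finally show ?thesis unfolding X_def p_def .
qed

section \<open>The Rellich inequality on the unit ball\<close>

context model
begin

lemma borel_measurable_J [measurable]: "(\<lambda>x::real^'n. J (norm x)) \<in> borel_measurable borel"
  using Ck_on_continuous[OF Ck_on_radial[OF Ck_on_J]]
  by (intro borel_measurable_continuous_countable_exceptions[of "{0}"]) auto

text \<open>The density is identified with \<open>J\<close> away from the pole, and the pole is a
  null set.\<close>

lemma nn_integral_riem_volume:
  assumes [measurable]: "h \<in> borel_measurable borel" "S \<in> sets borel"
  shows "(\<integral>\<^sup>+x\<in>S. ennreal (h x) \<partial>riem_volume g) = (\<integral>\<^sup>+x\<in>S. ennreal (J (norm x) * h x) \<partial>lborel)"
proof -
  have "continuous_on (- {0}) (\<lambda>x::real^'n. J (norm x))"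
    by (rule Ck_on_continuous[OF Ck_on_radial[OF Ck_on_J]])
  then have "continuous_on (- {0}) (\<lambda>x. sqrt (det (g x)))"
    by (simp add: sqrt_det_eq cong: continuous_on_cong_simp)
  then have [measurable]: "(\<lambda>x. sqrt (det (g x))) \<in> borel_measurable borel"
    by (intro borel_measurable_continuous_countable_exceptions[of "{0}"]) auto
  have "(\<integral>\<^sup>+x\<in>S. ennreal (h x) \<partial>riem_volume g)
    = (\<integral>\<^sup>+x. ennreal (sqrt (det (g x))) * (ennreal (h x) * indicator S x) \<partial>lborel)"
    unfolding riem_volume_def by (rule nn_integral_density) measurable
  also have "\<dots> = (\<integral>\<^sup>+x\<in>S. ennreal (J (norm x) * h x) \<partial>lborel)"
    using AE_lborel_singleton[of "0 :: real^'n"]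
    by (intro nn_integral_cong_AE, elim eventually_mono)
      (auto simp: sqrt_det_eq J_pos ennreal_mult' less_imp_le split: split_indicator)
  finally show ?thesis .
qed

lemma borel_measurable_laplace_beltrami:
  fixes f :: "real^'n \<Rightarrow> complex"
  assumes "Ck_on 2 f (- {0})"
  shows "laplace_beltrami g f \<in> borel_measurable borel"
  using continuous_on_laplace_beltrami[OF assms]
  by (intro borel_measurable_continuous_countable_exceptions[of "{0}"]) auto

text \<open>The function t \<psi>'(t) - \<psi>(t) vanishes at 0 and has derivative t
  \<psi>''(t).\<close>

lemma psi_le_if_convex:
  assumes "\<And>t. t > 0 \<Longrightarrow> \<psi>2 t \<ge> 0" "r > 0"
  shows "\<psi> r \<le> r * \<psi>1 r"
proof -
  define G where "G t = t * \<psi>1 t - \<psi> t" for t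
  have cont: "continuous_on {0..} \<psi>" "continuous_on {0..} \<psi>1"
    using halfline_deriv_works[of _ 0] halfline_deriv_works[of _ 1] by (auto intro!: DERIV_continuous_on)
  have dG: "(G has_real_derivative t * \<psi>2 t) (at t)" if "t > 0" for t
    unfolding G_def using psi_derivs[OF that] by (auto intro!: derivative_eq_intros)
  have "\<exists>l z. 0 < z \<and> z < r \<and> (G has_real_derivative l) (at z) \<and> G r - G 0 = (r - 0) * l"
  proof (rule MVT)
    show "continuous_on {0..r} G"
      unfolding G_def by (intro continuous_intros continuous_on_subset[OF cont(1)] continuous_on_subset[OF cont(2)]) auto
    show "G differentiable (at x)" if "0 < x" for x
      using dG[OF that] real_differentiable_def by blast
  qed (use assms in auto)
  then obtain l z where z: "0 < z" "(G has_real_derivative l) (at z)" "G r - G 0 = (r - 0) * l"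
    by blast
  then have "l = z * \<psi>2 z" using dG DERIV_unique by blast
  then have "0 \<le> G r" using z assms by (simp add: G_def psi_0)
  then show ?thesis by (simp add: G_def)
qed

lemma psi2_ge_if_curvature:
  assumes "\<And>x. x \<noteq> 0 \<Longrightarrow> - \<psi>2 (pole_dist g x) / \<psi> (pole_dist g x) \<le> - 1" "t > 0"
  shows "\<psi>2 t \<ge> \<psi> t"
proof -
  have "norm (t *\<^sub>R axis undefined (1::real) :: real^'n) = t" using assms by simp
  moreover have "t *\<^sub>R axis undefined (1::real) \<noteq> (0 :: real^'n)" using assms by simp
  ultimately have "- \<psi>2 t / \<psi> t \<le> - 1"
    using assms(1) by (metis pole_dist_eq)
  then show ?thesis using psi_pos[OF assms(2)] by (simp add: field_simps)
qed

text \<open>With b = 2 + \<beta>, squaring \<open>w_rellich\<close> and multiplying by r^\<beta>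
  gives exactly the weight on the left.\<close>

theorem rellich_inequality:
  fixes f :: "real^'n \<Rightarrow> complex"
  assumes f: "f \<in> test_functions (ball 0 1)"
    and mono: "\<And>r. r > 0 \<Longrightarrow> \<psi> r \<le> r * \<psi>1 r"
    and c: "c > 0" and \<beta>: "0 \<le> \<beta>" "\<beta> \<le> real CARD('n) - 4 - c"
  shows "ennreal (((real CARD('n) + \<beta>) / 4 * c)\<^sup>2) *
     (\<integral>\<^sup>+x\<in>ball 0 1. ennreal (J (norm x) * ((cmod (f x))\<^sup>2 / (norm x powr (4 + \<beta>) * (1 - norm x powr c)\<^sup>2))) \<partial>lborel)
    \<le> (\<integral>\<^sup>+x\<in>ball 0 1. ennreal (J (norm x) * ((cmod (laplace_beltrami g f x))\<^sup>2 / norm x powr \<beta>)) \<partial>lborel)"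
proof -
  let ?b = "2 + \<beta>"
  let ?K = "(real CARD('n) + \<beta>) / 4 * c"
  have "ennreal (?K\<^sup>2) * (\<integral>\<^sup>+x\<in>ball 0 1. ennreal (J (norm x) *
       ((w_rellich c ?b (norm x))\<^sup>2 * norm x powr \<beta> * (cmod (f x))\<^sup>2)) \<partial>lborel)
    \<le> (\<integral>\<^sup>+x\<in>ball 0 1. ennreal (J (norm x) * ((cmod (laplace_beltrami g f x))\<^sup>2 / norm x powr \<beta>)) \<partial>lborel)"
  proof (rule rellich_weighted[OF f _ _ mono Ck_on_rellich[OF c] _ _ w_rellich_deriv[OF c] v_rellich_deriv[OF c]])
    show "?K > 0" "\<beta> + 4 < real CARD('n)" using c \<beta> by auto
    show "w_rellich c ?b r > 0" "v_rellich c ?b r \<ge> 0" if "r \<in> {0<..<1}" for r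
      using uw_ge_1(1)[OF c that] that c \<beta> by (auto simp: w_rellich_def v_rellich_def)
    show "?K * (w_rellich c ?b r)\<^sup>2 * r powr \<beta> \<le>
      r powr (- ?b - 2) * (uw c r * ((c * (uw c r - 1) * (?b + 2 * c * uw c r) - (?b + 1) * (?b + c * uw c r)) / 2))
      + (real CARD('n) - 1) * v_rellich c ?b r / r
      - (r powr (- ?b - 1) * (- ?b * uw c r + c * uw c r * (uw c r - 1)) + 2 * v_rellich c ?b r)\<^sup>2 / (4 * w_rellich c ?b r)"
      if "r \<in> {0<..<1}" for r
      using \<beta> by (intro rellich_riccati c that) auto
    fix R :: real
    assume R: "R \<in> {0<..<1}"
    define U where "U = uw c R"
    \<comment> \<open>One constant for both weights: \<open>uw\<close> is increasing, so
      \<open>U\<close> bounds it on the whole interval, and C is at least \<open>U\<close> and at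
      least \<open>U\<close> (b + c \<open>U\<close>) / 2.\<close>
    define C where "C = U * (1 + (?b + c * U) / 2)"
    have U: "U \<ge> 1" unfolding U_def by (rule uw_ge_1(1)[OF c R])
    have "w_rellich c ?b r \<le> C * r powr (- 2 - \<beta>) \<and> v_rellich c ?b r \<le> C * r powr (- 3 - \<beta>)"
      if r: "r \<in> {0<..R}" for r
    proof -
      have u: "1 \<le> uw c r" "uw c r \<le> U"
        using uw_ge_1(1)[OF c, of r] uw_mono[OF c r R] r R by (auto simp: U_def)
      have pos: "0 \<le> (?b + c * U) / 2" using U c \<beta> by (intro divide_nonneg_nonneg add_nonneg_nonneg) auto
      have "U * 1 \<le> C" unfolding C_def using U pos by (intro mult_left_mono) auto
      then have w: "uw c r \<le> C" using u by simp
      have "uw c r * ((?b + c * uw c r) / 2) \<le> U * (1 + (?b + c * U) / 2)"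
      proof (rule mult_mono)
        have "c * uw c r \<le> c * U" using u c by simp
        then show "(?b + c * uw c r) / 2 \<le> 1 + (?b + c * U) / 2" by simp
      qed (use u U c \<beta> in auto)
      then have v: "uw c r * (?b + c * uw c r) / 2 \<le> C" by (simp add: C_def)
      have "- ?b = - 2 - \<beta>" "- ?b - 1 = - 3 - \<beta>" by auto
      then show ?thesis
        using mult_left_mono[OF w, of "r powr (- 2 - \<beta>)"] mult_left_mono[OF v, of "r powr (- 3 - \<beta>)"]
        unfolding w_rellich_def v_rellich_def by (simp add: mult.commute)
    qed
    then show "\<exists>C. \<forall>r\<in>{0<..R}. w_rellich c ?b r \<le> C * r powr (- 2 - \<beta>) \<and> v_rellich c ?b r \<le> C * r powr (- 3 - \<beta>)"
      by blast
  qed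
  moreover have "(w_rellich c ?b r)\<^sup>2 * r powr \<beta> * F = F / (r powr (4 + \<beta>) * (1 - r powr c)\<^sup>2)"
    if "r \<ge> 0" for r F
  \<comment> \<open>At r = 0 both sides are 0, by \<open>0 powr a = 0\<close> and division by
    zero.\<close>
  proof (cases "r = 0")
    case False
    then have r: "r > 0" using that by simp
    have "r powr (- ?b) * r powr (- ?b) * r powr \<beta> = r powr - (4 + \<beta>)"
      unfolding powr_add[symmetric] by (rule arg_cong[where f = "\<lambda>a. r powr a"]) simp
    then have *: "r powr (- ?b) * r powr (- ?b) * r powr \<beta> = 1 / r powr (4 + \<beta>)"
      by (simp only: powr_minus inverse_eq_divide)
    have "(w_rellich c ?b r)\<^sup>2 * r powr \<beta> * F = (r powr (- ?b) * r powr (- ?b) * r powr \<beta>) * (uw c r)\<^sup>2 * F"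
      by (simp only: w_rellich_def power2_eq_square mult_ac)
    also have "\<dots> = F / (r powr (4 + \<beta>) * (1 - r powr c)\<^sup>2)"
      unfolding * by (simp add: uw_def power_divide)
    finally show ?thesis .
  qed simp
  ultimately show ?thesis by simp
qed

end

section \<open>Sharpness\<close>

text \<open>The bump exp(-1/(1 - t^2)). Its lower bound on the inner half makes the denominator of
  the Rellich quotient grow linearly in n; the bounds on the derivatives control the
  remainder.\<close>

lemma bump_exists:
  obtains \<eta> \<eta>1 \<eta>2 :: "real \<Rightarrow> real" and c0 M :: real
  where "\<And>k. Ck_on k \<eta> UNIV"
    and "\<And>t. (\<eta> has_real_derivative \<eta>1 t) (at t)" "\<And>t. (\<eta>1 has_real_derivative \<eta>2 t) (at t)"
    and "\<And>t. \<bar>t\<bar> > 1 \<Longrightarrow> \<eta> t = 0 \<and> \<eta>1 t = 0 \<and> \<eta>2 t = 0"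
    and "\<And>t. \<bar>\<eta> t\<bar> \<le> M \<and> \<bar>\<eta>1 t\<bar> \<le> M \<and> \<bar>\<eta>2 t\<bar> \<le> M"
    and "c0 > 0" "\<And>t. \<bar>t\<bar> \<le> 1/2 \<Longrightarrow> \<eta> t \<ge> c0"
proof -
  define \<eta> where "\<eta> t = flat 0 (1 - t\<^sup>2)" for t :: real
  define \<eta>1 where "\<eta>1 t = frechet_derivative \<eta> (at t) 1" for t
  define \<eta>2 where "\<eta>2 t = frechet_derivative \<eta>1 (at t) 1" for t
  have Ck: "Ck_on k \<eta> UNIV" for k
    unfolding \<eta>_def
    by (intro Ck_on_compose_real[OF open_UNIV open_UNIV Ck_on_flat] Ck_on_diff Ck_on_const Ck_on_power
        Ck_on_bounded_linear[OF bounded_linear_ident]) auto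
  have Ck1: "Ck_on k \<eta>1 UNIV" for k
    unfolding \<eta>1_def by (rule Ck_on_real_SucD(2)[OF Ck])
  have Ck2: "Ck_on k \<eta>2 UNIV" for k
    unfolding \<eta>2_def by (rule Ck_on_real_SucD(2)[OF Ck1])
  have d1: "(\<eta> has_real_derivative \<eta>1 t) (at t)" for t
    unfolding \<eta>1_def has_real_derivative_iff_has_vector_derivative
    by (rule Ck_on_real_SucD(1)[OF Ck]) simp
  have d2: "(\<eta>1 has_real_derivative \<eta>2 t) (at t)" for t
    unfolding \<eta>2_def has_real_derivative_iff_has_vector_derivative
    by (rule Ck_on_real_SucD(1)[OF Ck1]) simp
  have z: "\<eta> t = 0" if "\<bar>t\<bar> > 1" for t
    using that abs_square_le_1[of t] by (simp add: \<eta>_def flat_def not_le)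
  have op: "open {t::real. \<bar>t\<bar> > 1}" by (intro open_Collect_less continuous_intros)
  have z1: "\<eta>1 t = 0" if "\<bar>t\<bar> > 1" for t
  proof -
    have "((\<lambda>_. 0) has_real_derivative \<eta>1 t) (at t)"
      by (rule has_field_derivative_transform_within_open[OF d1 op]) (use that z in auto)
    then show ?thesis using DERIV_const DERIV_unique by blast
  qed
  have z2: "\<eta>2 t = 0" if "\<bar>t\<bar> > 1" for t
  proof -
    have "((\<lambda>_. 0) has_real_derivative \<eta>2 t) (at t)"
      by (rule has_field_derivative_transform_within_open[OF d2 op]) (use that z1 in auto)
    then show ?thesis using DERIV_const DERIV_unique by blast
  qed
  have bd: "\<exists>M. \<forall>t. \<bar>h t\<bar> \<le> M" if h: "continuous_on UNIV h" "\<And>t. \<bar>t\<bar> > 1 \<Longrightarrow> h t = 0" for h :: "real \<Rightarrow> real"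
  proof -
    obtain M where M: "\<And>t. t \<in> {-1..1} \<Longrightarrow> norm (h t) \<le> M"
      using continuous_bounded_on_compact[OF continuous_on_subset[OF h(1)], of "{-1..1}"] by auto
    have "\<bar>h t\<bar> \<le> max M 0" for t
    proof (cases "\<bar>t\<bar> > 1")
      case False
      then have "t \<in> {-1..1}" by auto
      from M[OF this] show ?thesis by simp
    qed (simp add: h(2))
    then show ?thesis by blast
  qed
  obtain M0 where M0: "\<And>t. \<bar>\<eta> t\<bar> \<le> M0" using bd[OF Ck_on_continuous[OF Ck] z] by blast
  obtain M1 where M1: "\<And>t. \<bar>\<eta>1 t\<bar> \<le> M1" using bd[OF Ck_on_continuous[OF Ck1] z1] by blast
  obtain M2 where M2: "\<And>t. \<bar>\<eta>2 t\<bar> \<le> M2" using bd[OF Ck_on_continuous[OF Ck2] z2] by blast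
  show thesis
  proof (rule that[of \<eta> \<eta>1 \<eta>2 "max M0 (max M1 M2)" "exp (- 2)", OF Ck d1 d2])
    show "exp (- 2) \<le> \<eta> t" if "\<bar>t\<bar> \<le> 1/2" for t
    proof -
      have "t\<^sup>2 \<le> (1/2)\<^sup>2" using that by (metis abs_ge_zero power2_abs power_mono)
      then have p: "1 - t\<^sup>2 \<ge> 1/2" by (simp add: power2_eq_square)
      then have "inverse (1 - t\<^sup>2) \<le> 2" by (simp add: field_simps)
      then show ?thesis using p by (simp add: \<eta>_def flat_def)
    qed
  qed (use z z1 z2 M0 M1 M2 in \<open>auto simp: le_max_iff_disj\<close>)
qed

context model
begin

text \<open>The gradient of a radial function is radial, where the inverse metric has eigenvalue 1;
  the parts with s and 1 - s recombine.\<close>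

lemma flux_radial:
  fixes a :: "'b::real_normed_vector"
  assumes y: "y \<noteq> 0" and d: "(\<Phi> has_real_derivative \<Phi>') (at (norm y))"
  shows "flux (\<lambda>x. \<Phi> (norm x) *\<^sub>R a) i y = (J (norm y) * \<Phi>' / norm y * y $ i) *\<^sub>R a"
proof -
  let ?f = "\<lambda>x::real^'n. \<Phi> (norm x) *\<^sub>R a"
  define s where "s = (norm y / \<psi> (norm y))\<^sup>2"
  have D: "(?f has_derivative (\<lambda>e. ((y \<bullet> e) / norm y * \<Phi>') *\<^sub>R a)) (at y)"
    using has_derivative_radial[OF y d] by (auto intro!: derivative_eq_intros)
  then have fd: "?f differentiable at y" by (auto simp: differentiable_def)
  have D': "frechet_derivative ?f (at y) = (\<lambda>e. ((y \<bullet> e) / norm y * \<Phi>') *\<^sub>R a)"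
    using frechet_derivative_at[OF D] by simp
  have "flux ?f i y = (J (norm y) * (s * (y $ i / norm y * \<Phi>')
    + (1 - s) / (norm y)\<^sup>2 * y $ i * ((y \<bullet> y) / norm y * \<Phi>'))) *\<^sub>R a"
    unfolding flux_eq[OF y fd] partial_deriv_def D' s_def[symmetric]
    by (simp add: inner_axis scaleR_add_left scaleR_add_right distrib_left)
  also have "(1 - s) / (norm y)\<^sup>2 * y $ i * ((y \<bullet> y) / norm y * \<Phi>') = (1 - s) * (y $ i / norm y * \<Phi>')"
    using y by (simp add: dot_square_norm)
  also have "J (norm y) * (s * (y $ i / norm y * \<Phi>') + (1 - s) * (y $ i / norm y * \<Phi>')) = J (norm y) * \<Phi>' / norm y * y $ i"
    by (simp add: algebra_simps diff_divide_distrib)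
  finally show ?thesis .
qed

text \<open>The flux is k(r) x with k = J \<Phi>'/r, whose divergence is r k' + N k; the logarithmic
  derivative of \<open>J\<close> turns the Euclidean 1/r into \<psi>'/\<psi>.\<close>

lemma laplace_beltrami_radial:
  fixes a :: "'b::real_normed_vector"
  assumes x: "x \<noteq> 0"
    and d1: "\<And>r. r > 0 \<Longrightarrow> (\<Phi> has_real_derivative \<Phi>1 r) (at r)"
    and d2: "\<And>r. r > 0 \<Longrightarrow> (\<Phi>1 has_real_derivative \<Phi>2 r) (at r)"
  shows "laplace_beltrami g (\<lambda>x. \<Phi> (norm x) *\<^sub>R a) x =
    (\<Phi>2 (norm x) + (real CARD('n) - 1) * (\<psi>1 (norm x) / \<psi> (norm x)) * \<Phi>1 (norm x)) *\<^sub>R a"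
proof -
  let ?f = "\<lambda>x::real^'n. \<Phi> (norm x) *\<^sub>R a"
  define r where "r = norm x"
  have r: "r > 0" using x by (simp add: r_def)
  define m where "m = (real CARD('n) - 1) * (\<psi>1 r / \<psi> r - 1 / r)"
  define k where "k r = J r * \<Phi>1 r / r" for r
  define k' where "k' = J r / r * (m * \<Phi>1 r + \<Phi>2 r - \<Phi>1 r / r)"
  have dk: "(k has_real_derivative k') (at (norm x))"
    unfolding k_def k'_def r_def[symmetric] using J_deriv[OF r, folded m_def] d2[OF r] r
    by (auto intro!: derivative_eq_intros simp: field_simps)
  have pd: "partial_deriv i (flux ?f i) x = (x $ i * x $ i / r * k' + k r) *\<^sub>R a" for i
  proof -
    have "frechet_derivative (flux ?f i) (at x) = frechet_derivative (\<lambda>y. (k (norm y) * y $ i) *\<^sub>R a) (at x)"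
      by (rule frechet_derivative_cong_open[of "- {0}"]) (use x in \<open>auto simp: flux_radial[OF _ d1] k_def\<close>)
    moreover have "((\<lambda>y. (k (norm y) * y $ i) *\<^sub>R a) has_derivative
        (\<lambda>e. (k (norm x) * e $ i + (x \<bullet> e) / norm x * k' * x $ i) *\<^sub>R a)) (at x)"
      by (intro has_derivative_scaleR_left has_derivative_mult has_derivative_radial[OF x dk]
          bounded_linear_imp_has_derivative[OF bounded_linear_vec_nth])
    from frechet_derivative_at[OF this, symmetric]
    have "frechet_derivative (\<lambda>y. (k (norm y) * y $ i) *\<^sub>R a) (at x) (axis i 1)
        = (k (norm x) * axis i 1 $ i + (x \<bullet> axis i 1) / norm x * k' * x $ i) *\<^sub>R a"
      by simp
    ultimately show ?thesis
      by (simp add: partial_deriv_def inner_axis r_def mult_ac add.commute)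
  qed
  have nx: "(\<Sum>i\<in>UNIV. x $ i * x $ i) = r\<^sup>2"
    by (simp add: r_def inner_vec_def[symmetric, where 'a=real, simplified] power2_norm_eq_inner)
  have "(\<Sum>i\<in>UNIV. partial_deriv i (flux ?f i) x) = ((\<Sum>i\<in>UNIV. x $ i * x $ i) / r * k' + real CARD('n) * k r) *\<^sub>R a"
    unfolding pd by (simp add: scaleR_sum_left[symmetric] sum.distrib sum_divide_distrib sum_distrib_right)
  also have "(\<Sum>i\<in>UNIV. x $ i * x $ i) / r * k' + real CARD('n) * k r =
     J r * (\<Phi>2 r + (m + (real CARD('n) - 1) / r) * \<Phi>1 r)"
    unfolding nx using r by (simp add: k_def k'_def power2_eq_square field_simps)
  also have "m + (real CARD('n) - 1) / r = (real CARD('n) - 1) * (\<psi>1 r / \<psi> r)"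
    by (simp add: m_def right_diff_distrib)
  finally show ?thesis
    using J_pos[OF r] by (simp add: laplace_beltrami_eq[OF x] r_def)
qed

text \<open>Because \<psi>(0) = 0 and \<psi>'(0) = 1, both \<psi>(r)/r and \<psi>'(r) tend to 1:
  near the pole the Laplacian and the density are almost Euclidean.\<close>

lemma near_pole:
  assumes "\<delta> > 0"
  shows "\<exists>r0>0. \<forall>r. 0 < r \<and> r < r0 \<longrightarrow> \<bar>r * \<psi>1 r / \<psi> r - 1\<bar> \<le> \<delta> \<and> 1/2 \<le> J r \<and> J r \<le> 2"
proof -
  have nz: "(1::real) \<noteq> 0" by simp
  have "((\<lambda>r. \<psi>1 r / (\<psi> r / r)) \<longlongrightarrow> 1 / 1) (at_right 0)"
    by (rule tendsto_divide[OF psi1_tendsto psi_div_tendsto nz])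
  then have "((\<lambda>r. r * \<psi>1 r / \<psi> r) \<longlongrightarrow> 1) (at_right 0)"
    by (simp add: mult.commute)
  then have 1: "\<forall>\<^sub>F r in at_right 0. dist (r * \<psi>1 r / \<psi> r) 1 < \<delta>"
    using assms by (rule tendstoD)
  have J: "(J \<longlongrightarrow> 1 ^ (CARD('n) - 1)) (at_right 0)"
    unfolding J_def by (intro tendsto_power psi_div_tendsto)
  have 2: "\<forall>\<^sub>F r in at_right 0. J r < 2" "\<forall>\<^sub>F r in at_right 0. 1/2 < J r"
    by (rule order_tendstoD(2)[OF J], simp, rule order_tendstoD(1)[OF J], simp)
  from eventually_conj[OF 1 eventually_conj[OF 2]] obtain r0 where "r0 > 0"
    "\<And>r. 0 < r \<Longrightarrow> r < r0 \<Longrightarrow> dist (r * \<psi>1 r / \<psi> r) 1 < \<delta> \<and> J r < 2 \<and> 1/2 < J r"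
    unfolding eventually_at_right_field by blast
  then show ?thesis by (intro exI[of _ r0]) (auto simp: dist_real_def intro: less_imp_le)
qed

end

section \<open>Logarithmic test functions and their estimates\<close>

text \<open>The support lies in the annulus between exp(T - n) and exp(T + n). The function is zero
  around the pole, so the norm causes no loss of smoothness there, and T + n < 0 keeps the annulus
  inside the unit ball.\<close>

lemma radial_test_function:
  fixes \<eta> :: "real \<Rightarrow> real" and \<kappa> T n :: real
  assumes "\<And>k. Ck_on k \<eta> UNIV" "\<And>t. \<bar>t\<bar> > 1 \<Longrightarrow> \<eta> t = 0" "n > 0" "T + n < 0"
  shows "(\<lambda>x::real^'n. (norm x powr - \<kappa> * \<eta> ((ln (norm x) - T) / n)) *\<^sub>R (1::complex)) \<in> test_functions (ball 0 1)"
proof -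
  define \<Phi> where "\<Phi> r = r powr - \<kappa> * \<eta> ((ln r - T) / n)" for r
  let ?f = "\<lambda>x::real^'n. \<Phi> (norm x) *\<^sub>R (1::complex)"
  have zero: "\<Phi> r = 0" if "r < exp (T - n) \<or> r > exp (T + n)" "r \<ge> 0" for r
  proof (cases "r = 0")
    case False
    then have "r > 0" using that by simp
    have "\<bar>(ln r - T) / n\<bar> > 1"
      using that(1)
    proof
      assume "r < exp (T - n)"
      then have "ln r < T - n" using \<open>r > 0\<close> by (metis ln_exp ln_less_cancel_iff exp_gt_zero)
      then show ?thesis using assms(3) by (simp add: abs_if field_simps)
    next
      assume "r > exp (T + n)"
      then have "ln r > T + n" using \<open>r > 0\<close> by (metis ln_exp ln_less_cancel_iff exp_gt_zero)
      then show ?thesis using assms(3) by (simp add: abs_if field_simps)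
    qed
    then show ?thesis using assms(2) by (simp add: \<Phi>_def)
  qed (simp add: \<Phi>_def)
  have Ck\<Phi>: "Ck_on k \<Phi> {0<..}" for k
    unfolding \<Phi>_def
    by (intro Ck_on_mult Ck_on_powr Ck_on_compose_real[OF _ open_UNIV assms(1)] Ck_on_divide Ck_on_diff Ck_on_ln Ck_on_const)
      (use assms(3) in auto)
  have "Ck_on k ?f (- {0} \<union> ball 0 (exp (T - n)))" for k
  proof (rule Ck_on_Un)
    show "Ck_on k ?f (- {0})"
      by (intro Ck_on_scaleR Ck_on_radial Ck\<Phi> Ck_on_const) auto
    show "Ck_on k ?f (ball 0 (exp (T - n)))"
      by (subst Ck_on_cong[where g = "\<lambda>_. 0"]) (auto simp: zero intro: Ck_on_const)
  qed auto
  moreover have "- {0} \<union> ball 0 (exp (T - n)) = (UNIV :: (real^'n) set)" by auto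
  ultimately have "smooth_on UNIV ?f" by (simp add: smooth_on_def)
  moreover have sub: "closure {x. ?f x \<noteq> 0} \<subseteq> cball 0 (exp (T + n))"
  proof (rule closure_minimal)
    show "{x. ?f x \<noteq> 0} \<subseteq> cball 0 (exp (T + n))"
    proof
      fix x :: "real^'n"
      assume "x \<in> {x. ?f x \<noteq> 0}"
      then have "\<Phi> (norm x) \<noteq> 0" by simp
      then have "\<not> norm x > exp (T + n)" using zero[of "norm x"] by auto
      then show "x \<in> cball 0 (exp (T + n))" by simp
    qed
  qed simp
  moreover have "compact (closure {x. ?f x \<noteq> 0})"
    using sub by (meson bounded_cball bounded_subset closed_closure compact_eq_bounded_closed)
  moreover have "cball 0 (exp (T + n)) \<subseteq> (ball 0 1 :: (real^'n) set)"
    using assms(4) by (auto simp: order.strict_trans1)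
  ultimately show ?thesis
    unfolding test_functions_def \<Phi>_def by blast
qed

text \<open>Since \<sigma>' = 1/(r n), every derivative costs one power of r, and each one that
  falls on \<eta> gains a factor 1/n.\<close>

lemma log_radial_derivs:
  fixes \<eta> \<eta>1 \<eta>2 :: "real \<Rightarrow> real" and \<kappa> T n :: real
  assumes "\<And>t. (\<eta> has_real_derivative \<eta>1 t) (at t)" "\<And>t. (\<eta>1 has_real_derivative \<eta>2 t) (at t)"
    and "n > 0" "r > 0"
  defines "\<sigma> \<equiv> \<lambda>r. (ln r - T) / n"
  shows "((\<lambda>r. r powr - \<kappa> * \<eta> (\<sigma> r)) has_real_derivative
      r powr (- \<kappa> - 1) * (- \<kappa> * \<eta> (\<sigma> r) + \<eta>1 (\<sigma> r) / n)) (at r)" (is ?A)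
    and "((\<lambda>r. r powr (- \<kappa> - 1) * (- \<kappa> * \<eta> (\<sigma> r) + \<eta>1 (\<sigma> r) / n)) has_real_derivative
      r powr (- \<kappa> - 2) * ((- \<kappa> - 1) * (- \<kappa> * \<eta> (\<sigma> r) + \<eta>1 (\<sigma> r) / n)
        + (- \<kappa> * \<eta>1 (\<sigma> r) + \<eta>2 (\<sigma> r) / n) / n)) (at r)" (is ?B)
proof -
  \<comment> \<open>One rule for both orders: it is applied to \<eta> and then to the bracket that
    it produces.\<close>
  have gen: "((\<lambda>r. r powr a * h (\<sigma> r)) has_real_derivative r powr (a - 1) * (a * h (\<sigma> r) + h' (\<sigma> r) / n)) (at r)"
    if h: "\<And>t. (h has_real_derivative h' t) (at t)" for h h' :: "real \<Rightarrow> real" and a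
  proof -
    have s: "(\<sigma> has_real_derivative 1 / (r * n)) (at r)"
      unfolding \<sigma>_def using assms(3,4) by (auto intro!: derivative_eq_intros)
    have p: "((\<lambda>r. r powr a) has_real_derivative a * r powr (a - 1)) (at r)"
      using assms(4) by (rule has_real_derivative_powr)
    have "r powr a = r * r powr (a - 1)"
      using assms(4) powr_eq_mult[of 1 "a - 1" a r] by simp
    then have eq: "a * r powr (a - 1) * h (\<sigma> r) + h' (\<sigma> r) * (1 / (r * n)) * r powr a
        = r powr (a - 1) * (a * h (\<sigma> r) + h' (\<sigma> r) / n)"
      using assms(3,4) by (simp add: field_simps)
    show ?thesis
      using DERIV_mult[OF p DERIV_chain2[OF h s]] unfolding eq .
  qed
  show ?A using gen[OF assms(1), of "- \<kappa>"] .
  have d: "((\<lambda>t. - \<kappa> * \<eta> t + \<eta>1 t / n) has_real_derivative - \<kappa> * \<eta>1 t + \<eta>2 t / n) (at t)" for t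
    using assms(1,2,3) by (auto intro!: derivative_eq_intros)
  have "- \<kappa> - 1 - 1 = - \<kappa> - 2" by simp
  then show ?B using gen[OF d, of "- \<kappa> - 1"] by (simp only:)
qed

text \<open>Young's inequality, with the square of \<delta> a |t| - m, divided by \<delta>, as the
  gap. The leading coefficient stays close to a^2, and the cost is moved to the small term
  m.\<close>

lemma square_le_weighted:
  fixes H a m \<delta> t :: real
  assumes "\<bar>H\<bar> \<le> a * \<bar>t\<bar> + m" "\<delta> > 0"
  shows "H\<^sup>2 \<le> (1 + \<delta>) * a\<^sup>2 * t\<^sup>2 + (1 + 1 / \<delta>) * m\<^sup>2"
proof -
  have "H\<^sup>2 \<le> (a * \<bar>t\<bar> + m)\<^sup>2"
    using power_mono[OF assms(1) abs_ge_zero, of 2] by simp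
  also have "\<dots> \<le> (a * \<bar>t\<bar> + m)\<^sup>2 + (\<delta> * (a * \<bar>t\<bar>) - m)\<^sup>2 / \<delta>"
    using assms(2) by simp
  also have "\<dots> = (1 + \<delta>) * (a * \<bar>t\<bar>)\<^sup>2 + (1 + 1 / \<delta>) * m\<^sup>2"
    using assms(2) by (simp add: power2_eq_square field_simps)
  finally show ?thesis by (simp add: power_mult_distrib mult.assoc)
qed

text \<open>Here e stands for r \<psi>'/\<psi>, and h, h1, h2 for the values of \<eta> and its
  derivatives. For e = 1 the part without 1/n is -\<kappa> (N - 2 - \<kappa>) h; the deviation of e
  costs \<kappa> (N - 1) \<delta>, and the terms with h1, h2 add up to (2 N - 2) M at most.\<close>

lemma radial_symbol_le:
  fixes N \<kappa> e \<delta> n h h1 h2 M :: real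
  assumes "0 < \<kappa>" "\<kappa> \<le> N - 2" "1 \<le> n" "\<bar>e - 1\<bar> \<le> \<delta>" "\<delta> \<le> 1"
    and "\<bar>h1\<bar> \<le> M" "\<bar>h2\<bar> \<le> M"
  shows "\<bar>(- \<kappa> - 1) * (- \<kappa> * h + h1 / n) + (- \<kappa> * h1 + h2 / n) / n + (N - 1) * (e * (- \<kappa> * h + h1 / n))\<bar>
    \<le> (\<kappa> * (N - 2 - \<kappa>) + \<kappa> * (N - 1) * \<delta>) * \<bar>h\<bar> + M * (2 * N) / n"
proof -
  have M: "0 \<le> M" using assms by linarith
  define E where "E = (N - 2 - \<kappa>) * h1 + (N - 1) * ((e - 1) * h1) - \<kappa> * h1 + h2 / n"
  have "(- \<kappa> - 1) * (- \<kappa> * h + h1 / n) + (- \<kappa> * h1 + h2 / n) / n + (N - 1) * (e * (- \<kappa> * h + h1 / n))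
    = - (\<kappa> * (N - 2 - \<kappa>) * h) - \<kappa> * (N - 1) * ((e - 1) * h) + E / n"
    using assms(3) by (simp add: E_def field_simps)
  moreover have "\<bar>\<kappa> * (N - 2 - \<kappa>) * h\<bar> = \<kappa> * (N - 2 - \<kappa>) * \<bar>h\<bar>"
    using assms by (simp add: abs_mult)
  moreover have "\<bar>\<kappa> * (N - 1) * ((e - 1) * h)\<bar> \<le> \<kappa> * (N - 1) * (\<delta> * \<bar>h\<bar>)"
    using assms by (simp add: abs_mult mult_left_mono mult_right_mono)
  moreover have "\<bar>E / n\<bar> \<le> M * (2 * N) / n"
  proof -
    have "\<bar>(N - 2 - \<kappa>) * h1\<bar> \<le> (N - 2 - \<kappa>) * M"
      using assms by (simp add: abs_mult mult_left_mono)
    moreover have "\<bar>(N - 1) * ((e - 1) * h1)\<bar> \<le> (N - 1) * (1 * M)"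
    proof -
      have "\<bar>e - 1\<bar> * \<bar>h1\<bar> \<le> 1 * M" using assms by (intro mult_mono) auto
      then show ?thesis using assms by (simp add: abs_mult mult_left_mono)
    qed
    moreover have "\<bar>\<kappa> * h1\<bar> \<le> \<kappa> * M" using assms by (simp add: abs_mult)
    moreover have "\<bar>h2 / n\<bar> \<le> M"
    proof -
      have "\<bar>h2\<bar> / n \<le> \<bar>h2\<bar> / 1" using assms(3) by (intro divide_left_mono) auto
      then show ?thesis using assms by simp
    qed
    ultimately have "\<bar>E\<bar> \<le> (N - 2 - \<kappa>) * M + (N - 1) * (1 * M) + \<kappa> * M + M"
      unfolding E_def by linarith
    also have "\<dots> \<le> M * (2 * N)" using M by (simp add: algebra_simps)
    finally show ?thesis using assms(3) by (simp add: divide_right_mono)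
  qed
  moreover have "\<bar>- A - B + C\<bar> \<le> a + b + c" if "\<bar>A\<bar> = a" "\<bar>B\<bar> \<le> b" "\<bar>C\<bar> \<le> c" for A B C a b c :: real
    using that by linarith
  ultimately have "\<bar>(- \<kappa> - 1) * (- \<kappa> * h + h1 / n) + (- \<kappa> * h1 + h2 / n) / n + (N - 1) * (e * (- \<kappa> * h + h1 / n))\<bar>
      \<le> \<kappa> * (N - 2 - \<kappa>) * \<bar>h\<bar> + \<kappa> * (N - 1) * (\<delta> * \<bar>h\<bar>) + M * (2 * N) / n"
    by (simp only:)
  then show ?thesis by (simp only: distrib_right mult.assoc)
qed

context model
begin

text \<open>\<open>I1 f\<close> is at least a multiple of n, whereas the remainder of order 1/n^2,
  integrated over an annulus of logarithmic width 2 n, contributes only order 1/n. Positivity and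
  finiteness of \<open>I1 f\<close> are included so that the estimate can refute every smaller
  constant strictly.\<close>

lemma rellich_sharp:
  fixes \<beta> q :: real
  defines "N \<equiv> real CARD('n)"
  assumes \<beta>: "0 \<le> \<beta>" "N - \<beta> - 4 > 0" and q: "((N + \<beta>) / 4 * (N - \<beta> - 4))\<^sup>2 < q"
  defines "I1 \<equiv> \<lambda>f::real^'n \<Rightarrow> complex. \<integral>\<^sup>+x\<in>ball 0 1. ennreal (J (norm x) * ((cmod (f x))\<^sup>2 / norm x powr (4 + \<beta>))) \<partial>lborel"
  defines "I3 \<equiv> \<lambda>f::real^'n \<Rightarrow> complex. \<integral>\<^sup>+x\<in>ball 0 1. ennreal (J (norm x) * ((cmod (laplace_beltrami g f x))\<^sup>2 / norm x powr \<beta>)) \<partial>lborel"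
  shows "\<exists>f\<in>test_functions (ball 0 1). 0 < I1 f \<and> I1 f < \<infinity> \<and> I3 f \<le> ennreal q * I1 f"
proof -
  define \<kappa> where "\<kappa> = (N - 4 - \<beta>) / 2"
  define \<kappa>0 where "\<kappa>0 = \<kappa> * (N - 2 - \<kappa>)"
  have \<kappa>: "0 < \<kappa>" "\<kappa> \<le> N - 2" using \<beta> by (auto simp: \<kappa>_def)
  have q': "\<kappa>0\<^sup>2 < q"
  proof -
    have "\<kappa>0 = (N + \<beta>) / 4 * (N - \<beta> - 4)" by (simp add: \<kappa>0_def \<kappa>_def field_simps)
    with q show ?thesis by (simp only:)
  qed
  \<comment> \<open>Bound for the limiting quotient if the model deviates from flat space by d; the
    factor 1 + d is the price of Young's inequality. It tends to \<open>\<kappa>0\<^sup>2\<close> as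
    d decreases to 0, which leaves room below q.\<close>
  define Q where "Q d = (1 + d) * (\<kappa>0 + \<kappa> * (N - 1) * d)\<^sup>2" for d
  obtain \<delta> where \<delta>: "0 < \<delta>" "\<delta> < 1" "Q \<delta> < q"
  proof -
    have "(Q \<longlongrightarrow> (1 + 0) * (\<kappa>0 + \<kappa> * (N - 1) * 0)\<^sup>2) (at_right 0)"
      unfolding Q_def by (intro tendsto_intros)
    then have "\<forall>\<^sub>F d in at_right 0. Q d < q"
      by (rule order_tendstoD(2)) (use q' in simp)
    then obtain b where b: "b > 0" "\<And>d. 0 < d \<Longrightarrow> d < b \<Longrightarrow> Q d < q"
      unfolding eventually_at_right_field by blast
    show thesis using that[of "min b 1 / 2"] b by (auto simp: min_def)
  qed
  obtain \<eta> \<eta>1 \<eta>2 :: "real \<Rightarrow> real" and c0 M where \<eta>: "\<And>k. Ck_on k \<eta> UNIV"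
    and d\<eta>: "\<And>t. (\<eta> has_real_derivative \<eta>1 t) (at t)" "\<And>t. (\<eta>1 has_real_derivative \<eta>2 t) (at t)"
    and supp: "\<And>t. \<bar>t\<bar> > 1 \<Longrightarrow> \<eta> t = 0 \<and> \<eta>1 t = 0 \<and> \<eta>2 t = 0"
    and bd: "\<And>t. \<bar>\<eta> t\<bar> \<le> M \<and> \<bar>\<eta>1 t\<bar> \<le> M \<and> \<bar>\<eta>2 t\<bar> \<le> M"
    and c0: "c0 > 0" "\<And>t. \<bar>t\<bar> \<le> 1/2 \<Longrightarrow> \<eta> t \<ge> c0"
    by (rule bump_exists) blast
  obtain r0 where r0: "r0 > 0" "\<And>r. 0 < r \<Longrightarrow> r < r0 \<Longrightarrow> \<bar>r * \<psi>1 r / \<psi> r - 1\<bar> \<le> \<delta> \<and> 1/2 \<le> J r \<and> J r \<le> 2"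
    using near_pole[OF \<delta>(1)] by blast
  define P where "P = (1 + 1 / \<delta>) * (M * (2 * N))\<^sup>2"
  have P: "P \<ge> 0" using \<delta> by (simp add: P_def)
  \<comment> \<open>The remainder has mass (2 P / n^2) S (2 n) and \<open>I1 f\<close> is at least
    (c0^2 / 2) S n; their ratio 8 P / (c0^2 n^2) must fit into the gap q - Q \<delta>. A threshold
    linear in n works because n \<le> n^2.\<close>
  define n where "n = max 1 (8 * P / (c0\<^sup>2 * (q - Q \<delta>)))"
  have n1: "n \<ge> 1" by (simp add: n_def)
  then have n0: "n > 0" by simp
  have nq: "8 * P / (c0\<^sup>2 * n\<^sup>2) \<le> q - Q \<delta>"
  proof -
    have "8 * P / (c0\<^sup>2 * (q - Q \<delta>)) \<le> n" by (simp add: n_def)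
    then have "8 * P / c0\<^sup>2 \<le> (q - Q \<delta>) * n" using \<delta>(3) c0(1) by (simp add: field_simps)
    also have "\<dots> \<le> (q - Q \<delta>) * n\<^sup>2"
      using \<delta>(3) n1 by (intro mult_left_mono) (auto simp: power2_eq_square)
    finally show ?thesis using n0 c0(1) by (simp add: field_simps)
  qed
  \<comment> \<open>Places the outer radius exp(T + n) below both 1 and \<open>r0\<close>.\<close>
  define T where "T = min (ln r0) 0 - 1 - n"
  have T: "T + n < 0" "T + n < ln r0" by (auto simp: T_def min_def)
  define \<sigma> where "\<sigma> r = (ln r - T) / n" for r
  define \<Phi> where "\<Phi> r = r powr - \<kappa> * \<eta> (\<sigma> r)" for r
  define f where "f = (\<lambda>x::real^'n. \<Phi> (norm x) *\<^sub>R (1::complex))"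
  have ftest: "f \<in> test_functions (ball 0 1)"
    unfolding f_def \<Phi>_def \<sigma>_def
    by (rule radial_test_function[OF \<eta> _ n0 T(1)]) (use supp in auto)
  have f2: "Ck_on 2 f (- {0})"
    using ftest by (auto simp: test_functions_def smooth_on_def intro: Ck_on_subset)
  define a b where "a = exp (T - n)" and "b = exp (T + n)"
  define F1 where "F1 x = J (norm x) * ((cmod (f x))\<^sup>2 / norm x powr (4 + \<beta>))" for x
  define F3 where "F3 x = J (norm x) * ((cmod (laplace_beltrami g f x))\<^sup>2 / norm x powr \<beta>)" for x
  define G where "G u v x = indicator {u..v} (norm x) * norm x powr - N" for u v and x :: "real^'n"
  define S where "S = N * unit_ball_vol N"
  have S: "S > 0" using \<beta> by (simp add: S_def N_def)
  have G_int: "(\<integral>\<^sup>+x. ennreal (G u v x) \<partial>lborel) = ennreal (S * (ln v - ln u))" if "0 < u" "u \<le> v" for u v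
    using nn_integral_annulus[OF that, where 'a = "real^'n"] by (simp add: G_def S_def N_def)
  have b1: "b < 1" and br0: "b < r0"
    using T r0(1) by (auto simp: b_def) (metis exp_less_cancel_iff exp_ln)

  \<comment> \<open>By the choice of \<kappa> all these functions are multiples of r^(-N), so the
    comparison reduces to bounds for \<open>H\<close> in terms of \<open>h\<close>.\<close>
  have key: "F1 x \<ge> 0 \<and> F1 x \<le> 2 * M\<^sup>2 * G a b x \<and> F3 x \<le> Q \<delta> * F1 x + 2 * P / n\<^sup>2 * G a b x
      \<and> c0\<^sup>2 / 2 * G (exp (T - n / 2)) (exp (T + n / 2)) x \<le> F1 x" if x: "x \<noteq> 0" for x
  proof -
    define r where "r = norm x"
    have r: "r > 0" using x by (simp add: r_def)
    have Jr: "J r > 0" by (rule J_pos[OF r])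
    define p where "p = r powr (- \<kappa> - 2)"
    define h where "h = \<eta> (\<sigma> r)"
    define h1 where "h1 = \<eta>1 (\<sigma> r)"
    define h2 where "h2 = \<eta>2 (\<sigma> r)"
    define H where "H = (- \<kappa> - 1) * (- \<kappa> * h + h1 / n) + (- \<kappa> * h1 + h2 / n) / n
      + (N - 1) * (r * \<psi>1 r / \<psi> r * (- \<kappa> * h + h1 / n))"
    have p1: "r powr (- \<kappa> - 1) = r * p"
      using r powr_eq_mult[of 1 "- \<kappa> - 2" "- \<kappa> - 1" r] by (simp add: p_def)
    have fx: "f x = complex_of_real (r powr - \<kappa> * h)"
      by (simp add: f_def \<Phi>_def h_def r_def scaleR_conv_of_real)
    have "(r powr - \<kappa>)\<^sup>2 / r powr (4 + \<beta>) = r powr - N"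
    proof -
      have "(r powr - \<kappa>)\<^sup>2 / r powr (4 + \<beta>) = r powr (- \<kappa> + - \<kappa> - (4 + \<beta>))"
        by (simp only: powr_diff powr_add power2_eq_square)
      also have "- \<kappa> + - \<kappa> - (4 + \<beta>) = - N" by (simp add: \<kappa>_def field_simps)
      finally show ?thesis .
    qed
    then have F1: "F1 x = J r * (r powr - N * h\<^sup>2)"
      unfolding F1_def fx r_def[symmetric] norm_of_real
      by (simp add: power_mult_distrib flip: times_divide_eq_left)
    have "laplace_beltrami g f x = (r powr (- \<kappa> - 2) * ((- \<kappa> - 1) * (- \<kappa> * h + h1 / n) + (- \<kappa> * h1 + h2 / n) / n)
       + (N - 1) * (\<psi>1 r / \<psi> r) * (r powr (- \<kappa> - 1) * (- \<kappa> * h + h1 / n))) *\<^sub>R 1"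
      unfolding f_def N_def h_def h1_def h2_def \<Phi>_def[abs_def] \<sigma>_def r_def
      by (rule laplace_beltrami_radial[OF x]) (rule log_radial_derivs[OF d\<eta> n0]; assumption)+
    also have "r powr (- \<kappa> - 2) * ((- \<kappa> - 1) * (- \<kappa> * h + h1 / n) + (- \<kappa> * h1 + h2 / n) / n)
       + (N - 1) * (\<psi>1 r / \<psi> r) * (r powr (- \<kappa> - 1) * (- \<kappa> * h + h1 / n)) = p * H"
    proof -
      have "p * A + (N - 1) * s * (r * p * B) = p * (A + (N - 1) * (r * s * B))" for A B s
        by (simp add: algebra_simps)
      then show ?thesis
        unfolding p1 p_def[symmetric] H_def times_divide_eq_right[symmetric, of r] .
    qed
    also have "(p * H) *\<^sub>R (1::complex) = complex_of_real (p * H)"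
      by (simp add: scaleR_conv_of_real)
    finally have lap: "laplace_beltrami g f x = complex_of_real (p * H)" .
    have "p\<^sup>2 / r powr \<beta> = r powr - N"
    proof -
      have "p\<^sup>2 / r powr \<beta> = r powr ((- \<kappa> - 2) + (- \<kappa> - 2) - \<beta>)"
        unfolding p_def by (simp only: powr_diff powr_add power2_eq_square)
      also have "(- \<kappa> - 2) + (- \<kappa> - 2) - \<beta> = - N" by (simp add: \<kappa>_def field_simps)
      finally show ?thesis .
    qed
    then have F3: "F3 x = J r * (r powr - N * H\<^sup>2)"
      unfolding F3_def lap r_def[symmetric] norm_of_real
      by (simp add: power_mult_distrib flip: times_divide_eq_left)
    have in_iff: "r \<in> {exp (T - c * n)..exp (T + c * n)} \<longleftrightarrow> \<bar>\<sigma> r\<bar> \<le> c" for c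
    proof -
      have "r \<in> {exp (T - c * n)..exp (T + c * n)} \<longleftrightarrow> T - c * n \<le> ln r \<and> ln r \<le> T + c * n"
        using r by (simp add: ln_ge_iff ln_le_cancel_iff[of r "exp _", symmetric] del: ln_le_cancel_iff)
      also have "\<dots> \<longleftrightarrow> \<bar>\<sigma> r\<bar> \<le> c"
        using n0 by (auto simp: \<sigma>_def abs_le_iff field_simps)
      finally show ?thesis .
    qed
    have Gab: "G a b x = (if \<bar>\<sigma> r\<bar> \<le> 1 then r powr - N else 0)"
      using in_iff[of 1] by (auto simp: G_def a_def b_def r_def[symmetric] split: split_indicator)
    have Gh: "G (exp (T - n / 2)) (exp (T + n / 2)) x = (if \<bar>\<sigma> r\<bar> \<le> 1/2 then r powr - N else 0)"
      using in_iff[of "1/2"] by (auto simp: G_def r_def[symmetric] split: split_indicator)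
    show ?thesis
    proof (cases "\<bar>\<sigma> r\<bar> \<le> 1")
      case False
      then have "h = 0" "h1 = 0" "h2 = 0" using supp by (auto simp: h_def h1_def h2_def)
      then show ?thesis using False by (simp add: F1 F3 H_def Gab Gh)
    next
      case True
      then have "r \<le> b" using in_iff[of 1] by (simp add: b_def)
      then have "r < r0" using br0 by simp
      from r0(2)[OF r this] have near: "\<bar>r * \<psi>1 r / \<psi> r - 1\<bar> \<le> \<delta>" "1/2 \<le> J r" "J r \<le> 2" by auto
      have h: "\<bar>h\<bar> \<le> M" "\<bar>h1\<bar> \<le> M" "\<bar>h2\<bar> \<le> M" using bd by (auto simp: h_def h1_def h2_def)
      have rN: "r powr - N > 0" using r by simp
      have "\<bar>H\<bar> \<le> (\<kappa>0 + \<kappa> * (N - 1) * \<delta>) * \<bar>h\<bar> + M * (2 * N) / n"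
        unfolding H_def \<kappa>0_def
        using radial_symbol_le[OF \<kappa> n1 near(1) less_imp_le[OF \<delta>(2)] h(2,3)] .
      from square_le_weighted[OF this \<delta>(1)]
      have "H\<^sup>2 \<le> Q \<delta> * h\<^sup>2 + P / n\<^sup>2"
        by (simp add: Q_def P_def power_divide)
      then have "J r * (r powr - N * H\<^sup>2) \<le> J r * (r powr - N * (Q \<delta> * h\<^sup>2 + P / n\<^sup>2))"
        using rN Jr by (intro mult_left_mono) auto
      also have "\<dots> = Q \<delta> * (J r * (r powr - N * h\<^sup>2)) + J r * (P / n\<^sup>2 * r powr - N)"
        by (simp add: algebra_simps)
      also have "\<dots> \<le> Q \<delta> * (J r * (r powr - N * h\<^sup>2)) + 2 * (P / n\<^sup>2 * r powr - N)"
        using near(3) P rN by (intro add_left_mono mult_right_mono) auto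
      finally have A: "F3 x \<le> Q \<delta> * F1 x + 2 * P / n\<^sup>2 * G a b x"
        using True by (simp add: F1 F3 Gab)
      have "h\<^sup>2 \<le> M\<^sup>2" using power_mono[OF h(1) abs_ge_zero, of 2] by simp
      then have "J r * (r powr - N * h\<^sup>2) \<le> 2 * (r powr - N * M\<^sup>2)"
        using near(3) rN by (intro mult_mono mult_left_mono) auto
      then have B: "F1 x \<le> 2 * M\<^sup>2 * G a b x" using True by (simp add: F1 Gab mult_ac)
      have C: "c0\<^sup>2 / 2 * G (exp (T - n / 2)) (exp (T + n / 2)) x \<le> F1 x"
      proof (cases "\<bar>\<sigma> r\<bar> \<le> 1/2")
        case True
        have "c0\<^sup>2 \<le> h\<^sup>2" using c0(2)[OF True] c0(1) by (intro power_mono) (auto simp: h_def)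
        then have "1/2 * (r powr - N * c0\<^sup>2) \<le> J r * (r powr - N * h\<^sup>2)"
          using near(2) rN by (intro mult_mono mult_left_mono) auto
        then show ?thesis using True by (simp add: F1 Gh mult_ac)
      next
        case False
        then show ?thesis using rN Jr by (simp add: F1 Gh)
      qed
      show ?thesis using A B C rN Jr by (simp add: F1)
    qed
  qed

  have G_nonneg: "G u v x \<ge> 0" for u v x by (simp add: G_def)
  have Q: "Q \<delta> \<ge> 0" using \<delta> by (simp add: Q_def)
  have "f \<in> borel_measurable borel"
    using ftest by (intro borel_measurable_continuous_onI) (auto simp: test_functions_def smooth_on_def intro: Ck_on_continuous)
  note [measurable] = this
  have [measurable]: "F1 \<in> borel_measurable borel" unfolding F1_def by measurable
  have "(\<lambda>r. indicator {u..v} r * r powr - N) \<in> borel_measurable borel" for u v :: real by measurable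
  from measurable_compose[OF borel_measurable_norm this]
  have [measurable]: "G u v \<in> borel_measurable borel" for u v unfolding G_def[abs_def] .
  have AEx: "AE x in lborel. x \<noteq> (0::real^'n)" by (rule AE_lborel_singleton)
  have I1_eq: "I1 f = (\<integral>\<^sup>+x. ennreal (F1 x) * indicator (ball 0 1) x \<partial>lborel)"
    by (simp add: I1_def F1_def)

  have low: "ennreal (c0\<^sup>2 / 2 * (S * n)) \<le> I1 f"
  proof -
    have hb: "exp (T + n / 2) < 1" using T n0 by simp
    have "ennreal (c0\<^sup>2 / 2 * (S * n)) = ennreal (c0\<^sup>2 / 2) * (\<integral>\<^sup>+x. ennreal (G (exp (T - n / 2)) (exp (T + n / 2)) x) \<partial>lborel)"
      using n0 S by (subst G_int) (auto simp: ennreal_mult'[symmetric])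
    also have "\<dots> = (\<integral>\<^sup>+x. ennreal (c0\<^sup>2 / 2) * ennreal (G (exp (T - n / 2)) (exp (T + n / 2)) x) \<partial>lborel)"
      by (rule nn_integral_cmult[symmetric]) measurable
    also have "\<dots> \<le> I1 f"
      unfolding I1_eq
    proof (intro nn_integral_mono_AE, use AEx in eventually_elim)
      case (elim x)
      show ?case
      proof (cases "x \<in> ball 0 1")
        case True
        then show ?thesis using key[OF elim] by (simp add: ennreal_mult'[symmetric] ennreal_leI)
      next
        case False
        have "exp (T + n / 2) < norm x"
          by (rule order.strict_trans2[OF hb]) (use False in simp)
        then have "G (exp (T - n / 2)) (exp (T + n / 2)) x = 0"
          by (simp add: G_def)
        then show ?thesis by simp
      qed
    qed
    finally show ?thesis .
  qed
  have up: "I1 f < \<infinity>"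
  proof -
    have "I1 f \<le> (\<integral>\<^sup>+x. ennreal (2 * M\<^sup>2) * ennreal (G a b x) \<partial>lborel)"
      unfolding I1_eq using AEx
      by (intro nn_integral_mono_AE) (elim eventually_mono, auto simp: ennreal_mult'[symmetric] key ennreal_leI split: split_indicator)
    also have "\<dots> = ennreal (2 * M\<^sup>2) * (\<integral>\<^sup>+x. ennreal (G a b x) \<partial>lborel)"
      by (rule nn_integral_cmult) measurable
    also have "\<dots> < \<infinity>"
      using n0 by (subst G_int) (auto simp: a_def b_def ennreal_mult_less_top)
    finally show ?thesis .
  qed
  have "I3 f \<le> (\<integral>\<^sup>+x. ennreal (Q \<delta>) * (ennreal (F1 x) * indicator (ball 0 1) x) + ennreal (2 * P / n\<^sup>2) * ennreal (G a b x) \<partial>lborel)"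
    unfolding I3_def
  proof (intro nn_integral_mono_AE, use AEx in eventually_elim)
    case (elim x)
    show ?case
    proof (cases "x \<in> ball 0 1")
      case True
      have "ennreal (F3 x) \<le> ennreal (Q \<delta> * F1 x + 2 * P / n\<^sup>2 * G a b x)"
        using key[OF elim] by (intro ennreal_leI) simp
      also have "\<dots> = ennreal (Q \<delta>) * ennreal (F1 x) + ennreal (2 * P / n\<^sup>2) * ennreal (G a b x)"
        using key[OF elim] Q P G_nonneg by (simp add: ennreal_mult'[symmetric] ennreal_plus[symmetric] del: ennreal_plus)
      finally show ?thesis using True by (simp add: F3_def)
    qed simp
  qed
  also have "\<dots> = ennreal (Q \<delta>) * I1 f + ennreal (2 * P / n\<^sup>2) * (\<integral>\<^sup>+x. ennreal (G a b x) \<partial>lborel)"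
  proof -
    have [measurable]: "(ball 0 1 :: (real^'n) set) \<in> sets borel" by simp
    have "(\<lambda>x. ennreal (F1 x) * indicator (ball 0 1) x) \<in> borel_measurable lborel"
      "(\<lambda>x. ennreal (G a b x)) \<in> borel_measurable lborel" by measurable
    then show ?thesis unfolding I1_eq by (simp add: nn_integral_add nn_integral_cmult)
  qed
  also have "(\<integral>\<^sup>+x. ennreal (G a b x) \<partial>lborel) = ennreal (S * (2 * n))"
    using n0 by (subst G_int) (auto simp: a_def b_def)
  also have "ennreal (2 * P / n\<^sup>2) * ennreal (S * (2 * n)) = ennreal (8 * P / (c0\<^sup>2 * n\<^sup>2)) * ennreal (c0\<^sup>2 / 2 * (S * n))"
    using P n0 c0(1) S by (simp add: ennreal_mult'[symmetric] field_simps)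
  also have "\<dots> \<le> ennreal (q - Q \<delta>) * I1 f"
    by (intro mult_mono ennreal_leI nq low) auto
  also have "ennreal (Q \<delta>) * I1 f + ennreal (q - Q \<delta>) * I1 f = ennreal q * I1 f"
    using Q \<delta>(3) by (simp add: distrib_right[symmetric] ennreal_plus[symmetric] del: ennreal_plus)
  finally have "I3 f \<le> ennreal q * I1 f" by (simp add: add_left_mono)
  moreover have "0 < I1 f"
    using low S n0 c0(1) by (intro order.strict_trans2[OF _ low]) simp
  ultimately show ?thesis using ftest up by blast
qed

end

section \<open>Both inequalities and the optimality of the constant\<close>

text \<open>For c = N - \<beta> - 4 the factor in the first part is the reciprocal of
  \<open>C\<close>, so the second display follows by dividing. A counterexample for
  \<open>I1\<close> also serves for \<open>I2\<close>, because \<open>I1 \<le> I2\<close>.\<close>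

theorem mainTheorem14:
  fixes g :: "real^'n \<Rightarrow> real^'n^'n" and \<psi> :: "real \<Rightarrow> real"
  assumes dim: "CARD('n) \<ge> 4"
    and model: "model_manifold g \<psi>"
    and curv: "\<And>x. x \<noteq> 0 \<Longrightarrow> - halfline_deriv 2 \<psi> (pole_dist g x) / \<psi> (pole_dist g x) \<le> - 1"
  shows "let N = real CARD('n); \<rho> = pole_dist g; B = pole_ball g 1; \<Delta> = laplace_beltrami g;
             I = (\<lambda>h :: real^'n \<Rightarrow> real. \<integral>\<^sup>+x\<in>B. ennreal (h x) \<partial>riem_volume g)
    in
      (\<forall>c \<beta>. c > 0 \<and> 0 \<le> \<beta> \<and> \<beta> \<le> N - 4 - c \<longrightarrow>
        (\<forall>f\<in>test_functions B.
          ennreal (((N + \<beta>) / 4 * c)\<^sup>2) *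
            I (\<lambda>x. (cmod (f x))\<^sup>2 / (\<rho> x powr (4 + \<beta>) * (1 - \<rho> x powr c)\<^sup>2))
          \<le> I (\<lambda>x. (cmod (\<Delta> f x))\<^sup>2 / \<rho> x powr \<beta>)))
      \<and>
      (\<forall>\<beta>. 0 \<le> \<beta> \<and> N - \<beta> - 4 > 0 \<longrightarrow>
        (let C = 16 / ((N + \<beta>)\<^sup>2 * (N - \<beta> - 4)\<^sup>2);
             I1 = (\<lambda>f. I (\<lambda>x. (cmod (f x))\<^sup>2 / \<rho> x powr (4 + \<beta>)));
             I2 = (\<lambda>f. I (\<lambda>x. (cmod (f x))\<^sup>2 /
                          (\<rho> x powr (4 + \<beta>) * (1 - \<rho> x powr (N - \<beta> - 4))\<^sup>2)));
             I3 = (\<lambda>f. I (\<lambda>x. (cmod (\<Delta> f x))\<^sup>2 / \<rho> x powr \<beta>))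
         in
          (\<forall>f\<in>test_functions B. I1 f \<le> I2 f \<and> I2 f \<le> ennreal C * I3 f) \<and>
          (\<forall>K::real. K < C \<longrightarrow> \<not> (\<forall>f\<in>test_functions B. I1 f \<le> ennreal K * I3 f)) \<and>
          (\<forall>K::real. K < C \<longrightarrow> \<not> (\<forall>f\<in>test_functions B. I2 f \<le> ennreal K * I3 f))))"
proof -
  interpret model g \<psi> using model by unfold_locales
  define N where "N = real CARD('n)"
  define I where "I h = (\<integral>\<^sup>+x\<in>ball 0 1. ennreal (h x) \<partial>riem_volume g)" for h :: "real^'n \<Rightarrow> real"
  define H where "H c \<beta> f = (\<lambda>x. (cmod (f x))\<^sup>2 / (norm x powr (4 + \<beta>) * (1 - norm x powr c)\<^sup>2))"
    for c \<beta> and f :: "real^'n \<Rightarrow> complex"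
  define L where "L \<beta> f = (\<lambda>x. (cmod (laplace_beltrami g f x))\<^sup>2 / norm x powr \<beta>)"
    for \<beta> and f :: "real^'n \<Rightarrow> complex"
  define R where "R \<beta> f = (\<lambda>x. (cmod (f x))\<^sup>2 / norm x powr (4 + \<beta>))"
    for \<beta> and f :: "real^'n \<Rightarrow> complex"
  have mono: "\<psi> r \<le> r * \<psi>1 r" if "r > 0" for r
  proof (rule psi_le_if_convex[OF _ that])
    show "0 \<le> \<psi>2 t" if "t > 0" for t
      using psi2_ge_if_curvature[OF curv that] psi_pos[OF that] by simp
  qed
  have I: "I h = (\<integral>\<^sup>+x\<in>ball 0 1. ennreal (J (norm x) * h x) \<partial>lborel)" if "h \<in> borel_measurable borel" for h
    unfolding I_def by (rule nn_integral_riem_volume[OF that]) simp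
  have meas: "H c \<beta> f \<in> borel_measurable borel" "L \<beta> f \<in> borel_measurable borel" "R \<beta> f \<in> borel_measurable borel"
    if f: "f \<in> test_functions (ball 0 1)" for c \<beta> f
  proof -
    have Ck: "Ck_on k f UNIV" for k using f by (auto simp: test_functions_def smooth_on_def)
    have [measurable]: "f \<in> borel_measurable borel"
      by (intro borel_measurable_continuous_onI Ck_on_continuous[OF Ck])
    have [measurable]: "laplace_beltrami g f \<in> borel_measurable borel"
      by (rule borel_measurable_laplace_beltrami[OF Ck_on_subset[OF Ck]]) simp
    show "H c \<beta> f \<in> borel_measurable borel" "L \<beta> f \<in> borel_measurable borel" "R \<beta> f \<in> borel_measurable borel"
      unfolding H_def L_def R_def by measurable
  qed
  have rellich: "ennreal (((N + \<beta>) / 4 * c)\<^sup>2) * I (H c \<beta> f) \<le> I (L \<beta> f)"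
    if "c > 0" "0 \<le> \<beta>" "\<beta> \<le> N - 4 - c" "f \<in> test_functions (ball 0 1)" for c \<beta> f
    unfolding I[OF meas(1)[OF that(4)]] I[OF meas(2)[OF that(4)]] unfolding H_def L_def N_def
    using that by (intro rellich_inequality mono) (auto simp: N_def)
  have le: "I (R \<beta> f) \<le> I (H c \<beta> f)" if "c > 0" for c \<beta> f
    unfolding I_def R_def H_def
  proof (intro nn_integral_mono)
    fix x :: "real^'n"
    show "ennreal ((cmod (f x))\<^sup>2 / norm x powr (4 + \<beta>)) * indicator (ball 0 1) x
      \<le> ennreal ((cmod (f x))\<^sup>2 / (norm x powr (4 + \<beta>) * (1 - norm x powr c)\<^sup>2)) * indicator (ball 0 1) x"
    \<comment> \<open>At the pole both denominators are 0, so both quotients are 0.\<close>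
    proof (cases "x \<in> ball 0 1 - {0}")
      case True
      then have "norm x \<in> {0<..<1}" by auto
      from uw_ge_1(2)[OF that this] have p: "0 < 1 - norm x powr c" .
      have "(1 - norm x powr c)\<^sup>2 \<le> 1" using p by (intro power_le_one) auto
      then have "norm x powr (4 + \<beta>) * (1 - norm x powr c)\<^sup>2 \<le> norm x powr (4 + \<beta>) * 1"
        by (intro mult_left_mono) auto
      then show ?thesis
        using p True by (intro mult_right_mono ennreal_leI divide_left_mono) (auto intro!: mult_pos_pos)
    qed auto
  qed
  have sharp: "\<exists>f\<in>test_functions (ball 0 1). \<not> I (R \<beta> f) \<le> ennreal K * I (L \<beta> f)"
    if \<beta>: "0 \<le> \<beta>" "N - \<beta> - 4 > 0" and K: "K < 16 / ((N + \<beta>)\<^sup>2 * (N - \<beta> - 4)\<^sup>2)" for \<beta> K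
  proof -
    define k0 where "k0 = ((N + \<beta>) / 4 * (N - \<beta> - 4))\<^sup>2"
    have k0: "k0 > 0" using \<beta> by (simp add: k0_def N_def)
    have "16 / ((N + \<beta>)\<^sup>2 * (N - \<beta> - 4)\<^sup>2) = 1 / k0"
      by (simp add: k0_def power_mult_distrib power_divide)
    then have K1: "K < 1 / k0" using K by simp
    \<comment> \<open>Room between the two reciprocals: q lies above \<open>k0\<close> and, for
      positive K, below 1/K. For K \<le> 0 any q above \<open>k0\<close> works, and
      \<open>ennreal K\<close> is then 0.\<close>
    obtain q where q: "k0 < q" "K * q < 1"
    proof (cases "K \<le> 0")
      case True
      then show thesis using that[of "k0 + 1"] k0 by (smt (verit) mult_nonpos_nonneg)
    next
      case False
      then have "k0 < 1 / K" using K1 k0 by (simp add: field_simps)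
      then obtain q where "k0 < q" "q < 1 / K" using dense by blast
      then show thesis using that[of q] False by (simp add: field_simps)
    qed
    obtain f where f: "f \<in> test_functions (ball 0 1)"
      and i: "0 < I (R \<beta> f)" "I (R \<beta> f) < \<infinity>" "I (L \<beta> f) \<le> ennreal q * I (R \<beta> f)"
      using rellich_sharp[of \<beta> q] \<beta> q(1) unfolding k0_def N_def
      by (auto simp: I meas) (auto simp: L_def R_def)
    have "ennreal K * I (L \<beta> f) \<le> ennreal K * (ennreal q * I (R \<beta> f))"
      by (intro mult_left_mono i(3)) simp
    also have "\<dots> = ennreal (K * q) * I (R \<beta> f)"
      using q k0 by (simp add: mult.assoc[symmetric] ennreal_mult''[symmetric])
    \<comment> \<open>Strictness comes from K q < 1 and requires that \<open>I (R \<beta> f)\<close>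
      be positive and finite.\<close>
    also have "\<dots> < I (R \<beta> f)"
    proof -
      obtain y where y: "I (R \<beta> f) = ennreal y" "y > 0"
        using i(1,2) by (cases "I (R \<beta> f)") auto
      have "K * q * y < y" using q(2) y(2) by simp
      then show ?thesis unfolding y(1) using y(2)
        by (simp add: ennreal_mult''[symmetric] ennreal_less_iff ennreal_lessI)
    qed
    finally show ?thesis using f by (auto simp: not_le)
  qed
  show ?thesis
    unfolding Let_def pole_ball_eq pole_dist_eq I_def[symmetric] H_def[symmetric] L_def[symmetric] R_def[symmetric] N_def[symmetric]
  proof (intro conjI allI impI ballI)
    fix c \<beta> :: real and f :: "real^'n \<Rightarrow> complex"
    assume "c > 0 \<and> 0 \<le> \<beta> \<and> \<beta> \<le> N - 4 - c" "f \<in> test_functions (ball 0 1)"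
    then show "ennreal (((N + \<beta>) / 4 * c)\<^sup>2) * I (H c \<beta> f) \<le> I (L \<beta> f)"
      using rellich by blast
  next
    fix \<beta> :: real and f :: "real^'n \<Rightarrow> complex"
    assume \<beta>: "0 \<le> \<beta> \<and> N - \<beta> - 4 > 0" and f: "f \<in> test_functions (ball 0 1)"
    then show "I (R \<beta> f) \<le> I (H (N - \<beta> - 4) \<beta> f)" using le by blast
    define k0 where "k0 = ((N + \<beta>) / 4 * (N - \<beta> - 4))\<^sup>2"
    have k0: "k0 > 0" using \<beta> by (simp add: k0_def N_def)
    have C: "16 / ((N + \<beta>)\<^sup>2 * (N - \<beta> - 4)\<^sup>2) = 1 / k0"
      by (simp add: k0_def power_mult_distrib power_divide)
    have "ennreal k0 * I (H (N - \<beta> - 4) \<beta> f) \<le> I (L \<beta> f)"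
      unfolding k0_def using \<beta> f by (intro rellich) auto
    then have "ennreal (1 / k0) * (ennreal k0 * I (H (N - \<beta> - 4) \<beta> f)) \<le> ennreal (1 / k0) * I (L \<beta> f)"
      by (intro mult_left_mono) auto
    then show "I (H (N - \<beta> - 4) \<beta> f) \<le> ennreal (16 / ((N + \<beta>)\<^sup>2 * (N - \<beta> - 4)\<^sup>2)) * I (L \<beta> f)"
      unfolding C using k0 by (simp add: mult.assoc[symmetric] ennreal_mult''[symmetric])
  next
    fix \<beta> K :: real
    assume \<beta>: "0 \<le> \<beta> \<and> N - \<beta> - 4 > 0" and K: "K < 16 / ((N + \<beta>)\<^sup>2 * (N - \<beta> - 4)\<^sup>2)"
    then obtain f where f: "f \<in> test_functions (ball 0 1)" "\<not> I (R \<beta> f) \<le> ennreal K * I (L \<beta> f)"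
      using sharp by blast
    then show "\<not> (\<forall>f\<in>test_functions (ball 0 1). I (R \<beta> f) \<le> ennreal K * I (L \<beta> f))" by blast
    show "\<not> (\<forall>f\<in>test_functions (ball 0 1). I (H (N - \<beta> - 4) \<beta> f) \<le> ennreal K * I (L \<beta> f))"
      using f \<beta> le[of "N - \<beta> - 4" \<beta> f] order_trans by blast
  qed
qed

end
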